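(* Let $X$ be a reflexive Banach space and let $A\colon D(A)\to X$, $D(A)\subseteq X$, be a densely defined, closed linear operator such that $A\colon D(A)\to X$ is bijective with $A^{-1}\in L(X)$. Let $A'\colon D(A')\to X'$ be the dual operator, let $X_n^d=(D((A')^n),\|\cdot\|_{D((A')^n)})$ be the $n$-th interpolation space of $A'$, and let $X_{-n}$ be the $n$-th extrapolation space of $A$. Then there is an isomorphism of topological vector spaces $$\Bigl(\operatorname*{proj}_{n\in\mathbb{N}} X_n^d\Bigr)'_b\;\cong\;\operatorname*{ind}_{n\in\mathbb{N}} X_{-n}.$$ In particular, the inductive limit $\operatorname{ind}_{n\in\mathbb{N}} X_{-n}$ is complete.
   Context: $L(X)$ denotes the bounded linear operators on $X$, $X'$ the dual Banach space of $X$, and $\langle x,\varphi\rangle=\varphi(x)$ for $x\in X$, $\varphi\in X'$. Dual operator: $D(A')=\{x'\in X' : \exists\, y'\in X'\ \forall\, x\in D(A):\ \langle Ax,x'\rangle=\langle x,y'\rangle\}$ and $A'x'=y'$. Powers of an unbounded operator $B$ are defined on the natural domain: $D(B^{n+1})=\{x\in D(B^n) : B^nx\in D(B)\}$. The space $X_n^d$ ($n\geq 1$): $D((A')^n)$ with the graph norm $\|\psi\|_{D((A')^n)}=\|\psi\|_{X'}+\|(A')^n\psi\|_{X'}$. These spaces satisfy $X_{n+1}^d\subseteq X_n^d$ with continuous inclusion. Projective limit: $\operatorname{proj}_{n\in\mathbb{N}}X_n^d$ is the intersection $\bigcap_{n}X_n^d$ with the coarsest linear topology making all inclusions into $X_k^d$,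 $k\in\mathbb{N}$, continuous. Extrapolation spaces: for $n\ge 1$, $X_{-n}$ is the completion of $X$ with respect to the norm $\|x\|_{-n}=\|A^{-n}x\|_X$, where $A^{-n}=(A^{-1})^n$. The linking map $X_{-n}\to X_{-(n+1)}$ is the unique continuous linear extension of the identity $\mathrm{id}_X$ (it exists since $\|x\|_{-(n+1)}\leq\|A^{-1}\|\,\|x\|_{-n}$); it is injective, so $X_{-n}$ is regarded as a subspace of $X_{-(n+1)}$. Inductive limit: $\operatorname{ind}_{n\in\mathbb{N}}X_{-n}$ is the union $\bigcup_nX_{-n}$ (the algebraic direct limit along the linking maps) with the finest linear topology making all canonical maps from $X_{-k}$, $k\in\mathbb{N}$, continuous. For a locally convex space $E$, $E'_b$ denotes the strong dual, i.e. the space of continuous linear functionals with the topology of uniform convergence on bounded subsets of $E$. *)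

theory Defs
  imports "HOL-Analysis.Analysis"
begin

section \<open>Scalars and Banach spaces\<close>

text \<open>The scalar field is either the real or the complex numbers, with its usual absolute value:
  such a field is identified with one of these two through an embedding into \<^typ>\<open>complex\<close>.\<close>

class real_or_complex = real_normed_field +
  assumes ex_embedding_complex:
    "\<exists>h :: 'a \<Rightarrow> complex.
       (\<forall>x y. h (x + y) = h x + h y) \<and> (\<forall>x y. h (x * y) = h x * h y) \<and>
       (\<forall>r x. h (r *\<^sub>R x) = r *\<^sub>R h x) \<and> (\<forall>x. norm (h x) = norm x) \<and>
       (range h = \<real> \<or> range h = UNIV)"

instance real :: real_or_complex
  by standard (rule exI[where x = complex_of_real], auto simp: Reals_def scaleR_conv_of_real)

instance complex :: real_or_complex
  by standard (rule exI[where x = id], auto)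

text \<open>The class \<^class>\<open>banach\<close> only provides real scalars; the locale adds a compatible
  multiplication by scalars from \<open>'k\<close>. For \<open>'k = real\<close> it is necessarily \<open>(*\<^sub>R)\<close>.\<close>

locale banach_space = vector_space smul
  for smul :: "'k::real_or_complex \<Rightarrow> 'a::banach \<Rightarrow> 'a" +
  assumes norm_scale: "norm (smul c x) = norm c * norm x"
    and scale_of_real: "smul (of_real r) x = r *\<^sub>R x"


section \<open>Vector spaces on carrier sets\<close>

record ('k, 'v) vspace =
  vcarrier :: "'v set"
  vadd :: "'v \<Rightarrow> 'v \<Rightarrow> 'v"
  vzero :: 'v
  vscale :: "'k \<Rightarrow> 'v \<Rightarrow> 'v"

record ('k, 'v) normed_vspace = "('k, 'v) vspace" +
  vnorm :: "'v \<Rightarrow> real"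

record ('k, 'v) top_vspace = "('k, 'v) vspace" +
  vtop :: "'v topology"

definition with_norm :: "('k, 'v, 'z) vspace_scheme \<Rightarrow> ('v \<Rightarrow> real) \<Rightarrow> ('k, 'v) normed_vspace" where
  "with_norm V p = \<lparr>vcarrier = vcarrier V, vadd = vadd V, vzero = vzero V, vscale = vscale V,
     vnorm = p\<rparr>"

definition with_top :: "('k, 'v, 'z) vspace_scheme \<Rightarrow> 'v topology \<Rightarrow> ('k, 'v) top_vspace" where
  "with_top V T = \<lparr>vcarrier = vcarrier V, vadd = vadd V, vzero = vzero V, vscale = vscale V,
     vtop = T\<rparr>"

definition vsub :: "('k::real_or_complex, 'v, 'z) vspace_scheme \<Rightarrow> 'v \<Rightarrow> 'v \<Rightarrow> 'v" where
  "vsub V x y = vadd V x (vscale V (- 1) y)"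

definition linear_map ::
    "('k, 'v, 'y) vspace_scheme \<Rightarrow> ('k, 'w, 'z) vspace_scheme \<Rightarrow> ('v \<Rightarrow> 'w) \<Rightarrow> bool" where
  "linear_map V W f \<longleftrightarrow>
     f \<in> vcarrier V \<rightarrow> vcarrier W \<and>
     (\<forall>x\<in>vcarrier V. \<forall>y\<in>vcarrier V. f (vadd V x y) = vadd W (f x) (f y)) \<and>
     (\<forall>c. \<forall>x\<in>vcarrier V. f (vscale V c x) = vscale W c (f x))"

definition scalars :: "('k::real_or_complex, 'k) vspace" where
  "scalars = \<lparr>vcarrier = UNIV, vadd = (+), vzero = 0, vscale = (*)\<rparr>"

definition whole_space :: "('k::real_or_complex \<Rightarrow> 'a::banach \<Rightarrow> 'a) \<Rightarrow> ('k, 'a) normed_vspace" where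
  "whole_space smul =
     \<lparr>vcarrier = UNIV, vadd = (+), vzero = 0, vscale = smul, vnorm = norm\<rparr>"

text \<open>The value \<open>0\<close> outside the carrier is needed because \<^locale>\<open>Metric_space\<close> requires the distance
  to be nonnegative and symmetric on the whole type.\<close>

definition ndist :: "('k::real_or_complex, 'v) normed_vspace \<Rightarrow> 'v \<Rightarrow> 'v \<Rightarrow> real" where
  "ndist N x y = (if x \<in> vcarrier N \<and> y \<in> vcarrier N then vnorm N (vsub N x y) else 0)"

definition norm_tvs :: "('k::real_or_complex, 'v) normed_vspace \<Rightarrow> ('k, 'v) top_vspace" where
  "norm_tvs N = with_top N (Metric_space.mtopology (vcarrier N) (ndist N))"


section \<open>Topological vector spaces\<close>

definition linear_topology ::
    "('k::real_or_complex, 'v, 'z) vspace_scheme \<Rightarrow> 'v topology \<Rightarrow> bool" where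
  "linear_topology V T \<longleftrightarrow>
     topspace T = vcarrier V \<and>
     continuous_map (prod_topology T T) T (\<lambda>(x, y). vadd V x y) \<and>
     continuous_map (prod_topology euclidean T) T (\<lambda>(c, x). vscale V c x)"

definition coarsest_topology :: "('v topology \<Rightarrow> bool) \<Rightarrow> 'v topology" where
  "coarsest_topology P =
     (THE T. P T \<and> (\<forall>T'. P T' \<longrightarrow> (\<forall>U. openin T U \<longrightarrow> openin T' U)))"

definition finest_topology :: "('v topology \<Rightarrow> bool) \<Rightarrow> 'v topology" where
  "finest_topology P =
     (THE T. P T \<and> (\<forall>T'. P T' \<longrightarrow> (\<forall>U. openin T' U \<longrightarrow> openin T U)))"

definition tvs_isomorphic ::
    "('k, 'v) top_vspace \<Rightarrow> ('k, 'w) top_vspace \<Rightarrow> bool" where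
  "tvs_isomorphic V W \<longleftrightarrow>
     (\<exists>f. linear_map V W f \<and> bij_betw f (vcarrier V) (vcarrier W) \<and>
          homeomorphic_map (vtop V) (vtop W) f)"

definition tvs_cauchy_filter :: "('k::real_or_complex, 'v) top_vspace \<Rightarrow> 'v filter \<Rightarrow> bool" where
  "tvs_cauchy_filter E F \<longleftrightarrow>
     eventually (\<lambda>x. x \<in> vcarrier E) F \<and>
     (\<forall>U. openin (vtop E) U \<and> vzero E \<in> U \<longrightarrow>
        eventually (\<lambda>(x, y). vsub E x y \<in> U) (F \<times>\<^sub>F F))"

definition tvs_complete :: "('k::real_or_complex, 'v) top_vspace \<Rightarrow> bool" where
  "tvs_complete E \<longleftrightarrow>
     (\<forall>F. F \<noteq> bot \<and> tvs_cauchy_filter E F \<longrightarrow> (\<exists>l. limitin (vtop E) (\<lambda>x. x) l F))"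

definition tvs_bounded :: "('k::real_or_complex, 'v) top_vspace \<Rightarrow> 'v set \<Rightarrow> bool" where
  "tvs_bounded E B \<longleftrightarrow>
     B \<subseteq> vcarrier E \<and>
     (\<forall>U. openin (vtop E) U \<and> vzero E \<in> U \<longrightarrow>
        (\<exists>r>0. \<forall>c. norm c \<ge> r \<longrightarrow> B \<subseteq> vscale E c ` U))"


section \<open>Dual spaces\<close>

text \<open>Functionals are \<^const>\<open>extensional\<close> outside the carrier, so that equality of functionals is
  equality on the carrier.\<close>

definition dual_vspace :: "('k::real_or_complex, 'v) top_vspace \<Rightarrow> ('k, 'v \<Rightarrow> 'k) vspace" where
  "dual_vspace E =
     \<lparr>vcarrier = {f \<in> extensional (vcarrier E).
                   linear_map E scalars f \<and> continuous_map (vtop E) euclidean f},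
      vadd = (\<lambda>f g. \<lambda>x\<in>vcarrier E. f x + g x),
      vzero = (\<lambda>x\<in>vcarrier E. 0),
      vscale = (\<lambda>c f. \<lambda>x\<in>vcarrier E. c * f x)\<rparr>"

definition normed_dual ::
    "('k::real_or_complex, 'v) normed_vspace \<Rightarrow> ('k, 'v \<Rightarrow> 'k) normed_vspace" where
  "normed_dual N = with_norm (dual_vspace (norm_tvs N))
     (\<lambda>f. SUP x\<in>{x \<in> vcarrier N. vnorm N x \<le> 1}. norm (f x))"

definition strong_dual_nbhd ::
    "('k::real_or_complex, 'v) top_vspace \<Rightarrow> ('v \<Rightarrow> 'k) \<Rightarrow> 'v set \<Rightarrow> real \<Rightarrow> ('v \<Rightarrow> 'k) set" where
  "strong_dual_nbhd E f B \<epsilon> =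
     {g \<in> vcarrier (dual_vspace E). \<forall>x\<in>B. norm (g x - f x) \<le> \<epsilon>}"

definition strong_dual_open ::
    "('k::real_or_complex, 'v) top_vspace \<Rightarrow> ('v \<Rightarrow> 'k) set \<Rightarrow> bool" where
  "strong_dual_open E U \<longleftrightarrow>
     U \<subseteq> vcarrier (dual_vspace E) \<and>
     (\<forall>f\<in>U. \<exists>B \<epsilon>. tvs_bounded E B \<and> \<epsilon> > 0 \<and> strong_dual_nbhd E f B \<epsilon> \<subseteq> U)"

definition strong_dual ::
    "('k::real_or_complex, 'v) top_vspace \<Rightarrow> ('k, 'v \<Rightarrow> 'k) top_vspace" where
  "strong_dual E = with_top (dual_vspace E) (topology (strong_dual_open E))"

lemma tvs_bounded_Un:
  assumes "tvs_bounded E A" and "tvs_bounded E B"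
  shows "tvs_bounded E (A \<union> B)"
  unfolding tvs_bounded_def
proof (intro conjI allI impI)
  show "A \<union> B \<subseteq> vcarrier E"
    using assms by (auto simp: tvs_bounded_def)
  fix U assume U: "openin (vtop E) U \<and> vzero E \<in> U"
  obtain r where r: "r > 0" "\<forall>c. norm c \<ge> r \<longrightarrow> A \<subseteq> vscale E c ` U"
    using assms(1) U unfolding tvs_bounded_def by blast
  obtain s where s: "s > 0" "\<forall>c. norm c \<ge> s \<longrightarrow> B \<subseteq> vscale E c ` U"
    using assms(2) U unfolding tvs_bounded_def by blast
  have "\<forall>c. norm c \<ge> max r s \<longrightarrow> A \<union> B \<subseteq> vscale E c ` U"
    using r(2) s(2) by (meson Un_least max.boundedE)
  moreover have "max r s > 0"
    using r(1) by simp
  ultimately show "\<exists>r>0. \<forall>c. norm c \<ge> r \<longrightarrow> A \<union> B \<subseteq> vscale E c ` U"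
    by blast
qed

lemma istopology_strong_dual_open: "istopology (strong_dual_open E)"
  unfolding istopology_def
proof (intro conjI allI impI)
  fix S T assume S: "strong_dual_open E S" and T: "strong_dual_open E T"
  show "strong_dual_open E (S \<inter> T)"
    unfolding strong_dual_open_def
  proof (intro conjI ballI)
    show "S \<inter> T \<subseteq> vcarrier (dual_vspace E)"
      using S by (auto simp: strong_dual_open_def)
    fix f assume f: "f \<in> S \<inter> T"
    obtain A \<epsilon> where A: "tvs_bounded E A" "\<epsilon> > 0" "strong_dual_nbhd E f A \<epsilon> \<subseteq> S"
      using S f unfolding strong_dual_open_def by blast
    obtain B \<delta> where B: "tvs_bounded E B" "\<delta> > 0" "strong_dual_nbhd E f B \<delta> \<subseteq> T"
      using T f unfolding strong_dual_open_def by blast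
    have "strong_dual_nbhd E f (A \<union> B) (min \<epsilon> \<delta>) \<subseteq> strong_dual_nbhd E f A \<epsilon> \<inter> strong_dual_nbhd E f B \<delta>"
      by (auto simp: strong_dual_nbhd_def)
    then show "\<exists>B \<epsilon>. tvs_bounded E B \<and> \<epsilon> > 0 \<and> strong_dual_nbhd E f B \<epsilon> \<subseteq> S \<inter> T"
      using A B tvs_bounded_Un[OF A(1) B(1)]
      by (intro exI[of _ "A \<union> B"] exI[of _ "min \<epsilon> \<delta>"]) auto
  qed
next
  fix \<K> assume "\<forall>K\<in>\<K>. strong_dual_open E K"
  then show "strong_dual_open E (\<Union>\<K>)"
    unfolding strong_dual_open_def by (meson Sup_least Union_iff Union_upper subset_trans)
qed

lemma openin_strong_dual: "openin (vtop (strong_dual E)) = strong_dual_open E"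
  by (simp add: strong_dual_def with_top_def topology_inverse'[OF istopology_strong_dual_open])

text \<open>Surjectivity of the canonical map into the bidual.\<close>

definition reflexive :: "('k::real_or_complex, 'v) normed_vspace \<Rightarrow> bool" where
  "reflexive N \<longleftrightarrow>
     (\<forall>\<Phi>\<in>vcarrier (normed_dual (normed_dual N)).
        \<exists>x\<in>vcarrier N. \<forall>\<phi>\<in>vcarrier (normed_dual N). \<Phi> \<phi> = \<phi> x)"


section \<open>Unbounded operators\<close>

text \<open>An operator is a domain \<open>D\<close> together with a function whose values outside \<open>D\<close> are irrelevant.\<close>

definition linear_operator ::
    "('k::real_or_complex \<Rightarrow> 'a::banach \<Rightarrow> 'a) \<Rightarrow> 'a set \<Rightarrow> ('a \<Rightarrow> 'a) \<Rightarrow> bool" where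
  "linear_operator smul D A \<longleftrightarrow>
     module.subspace smul D \<and>
     (\<forall>x\<in>D. \<forall>y\<in>D. A (x + y) = A x + A y) \<and>
     (\<forall>c. \<forall>x\<in>D. A (smul c x) = smul c (A x))"

definition closed_operator :: "'a::banach set \<Rightarrow> ('a \<Rightarrow> 'a) \<Rightarrow> bool" where
  "closed_operator D A \<longleftrightarrow> closed ((\<lambda>x. (x, A x)) ` D)"

text \<open>Domain of \<open>B ^^ n\<close> for \<open>B\<close> with domain \<open>D\<close> in the space \<open>S\<close>.\<close>

primrec power_domain :: "'v set \<Rightarrow> 'v set \<Rightarrow> ('v \<Rightarrow> 'v) \<Rightarrow> nat \<Rightarrow> 'v set" where
  "power_domain S D B 0 = S"
| "power_domain S D B (Suc n) = {x \<in> power_domain S D B n. (B ^^ n) x \<in> D}"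

definition dual_domain ::
    "('k::real_or_complex, 'v) normed_vspace \<Rightarrow> 'v set \<Rightarrow> ('v \<Rightarrow> 'v) \<Rightarrow> ('v \<Rightarrow> 'k) set" where
  "dual_domain N D A =
     {\<phi> \<in> vcarrier (normed_dual N). \<exists>\<psi>\<in>vcarrier (normed_dual N). \<forall>x\<in>D. \<phi> (A x) = \<psi> x}"

definition dual_operator ::
    "('k::real_or_complex, 'v) normed_vspace \<Rightarrow> 'v set \<Rightarrow> ('v \<Rightarrow> 'v) \<Rightarrow> ('v \<Rightarrow> 'k) \<Rightarrow> ('v \<Rightarrow> 'k)" where
  "dual_operator N D A \<phi> =
     (THE \<psi>. \<psi> \<in> vcarrier (normed_dual N) \<and> (\<forall>x\<in>D. \<phi> (A x) = \<psi> x))"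

definition dual_interpolation_space ::
    "('k::real_or_complex, 'v) normed_vspace \<Rightarrow> 'v set \<Rightarrow> ('v \<Rightarrow> 'v) \<Rightarrow> nat
      \<Rightarrow> ('k, 'v \<Rightarrow> 'k) normed_vspace" where
  "dual_interpolation_space N D A n =
     with_norm
       ((normed_dual N)\<lparr>vcarrier :=
          power_domain (vcarrier (normed_dual N)) (dual_domain N D A) (dual_operator N D A) n\<rparr>)
       (\<lambda>\<psi>. vnorm (normed_dual N) \<psi> + vnorm (normed_dual N) ((dual_operator N D A ^^ n) \<psi>))"


section \<open>Completions and extrapolation spaces\<close>

text \<open>The completion consists of the Cauchy sequences modulo null sequences.\<close>

definition cauchy_rel ::
    "('k::real_or_complex, 'v) normed_vspace \<Rightarrow> ((nat \<Rightarrow> 'v) \<times> (nat \<Rightarrow> 'v)) set" where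
  "cauchy_rel N =
     {(u, v). Metric_space.MCauchy (vcarrier N) (ndist N) u \<and>
              Metric_space.MCauchy (vcarrier N) (ndist N) v \<and>
              (\<lambda>k. ndist N (u k) (v k)) \<longlonglongrightarrow> 0}"

definition completion ::
    "('k::real_or_complex, 'v) normed_vspace \<Rightarrow> ('k, (nat \<Rightarrow> 'v) set) normed_vspace" where
  "completion N =
     \<lparr>vcarrier = {u. Metric_space.MCauchy (vcarrier N) (ndist N) u} // cauchy_rel N,
      vadd = (\<lambda>P Q. \<Union>u\<in>P. \<Union>v\<in>Q. cauchy_rel N `` {\<lambda>k. vadd N (u k) (v k)}),
      vzero = cauchy_rel N `` {\<lambda>k. vzero N},
      vscale = (\<lambda>c P. \<Union>u\<in>P. cauchy_rel N `` {\<lambda>k. vscale N c (u k)}),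
      vnorm = (\<lambda>P. the_elem ((\<lambda>u. lim (\<lambda>k. vnorm N (u k))) ` P))\<rparr>"

definition completion_embed :: "('k::real_or_complex, 'v) normed_vspace \<Rightarrow> 'v \<Rightarrow> (nat \<Rightarrow> 'v) set" where
  "completion_embed N x = cauchy_rel N `` {\<lambda>k. x}"

definition extrapolation_norm_space ::
    "('k::real_or_complex \<Rightarrow> 'a::banach \<Rightarrow> 'a) \<Rightarrow> 'a set \<Rightarrow> ('a \<Rightarrow> 'a) \<Rightarrow> nat
      \<Rightarrow> ('k, 'a) normed_vspace" where
  "extrapolation_norm_space smul D A n =
     with_norm (whole_space smul) (\<lambda>x. norm ((inv_into D A ^^ n) x))"

definition extrapolation_space ::
    "('k::real_or_complex \<Rightarrow> 'a::banach \<Rightarrow> 'a) \<Rightarrow> 'a set \<Rightarrow> ('a \<Rightarrow> 'a) \<Rightarrow> nat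
      \<Rightarrow> ('k, (nat \<Rightarrow> 'a) set) normed_vspace" where
  "extrapolation_space smul D A n = completion (extrapolation_norm_space smul D A n)"

text \<open>The continuous linear extension of the identity of \<open>X\<close> from index \<open>n\<close> to index \<open>n + 1\<close>.\<close>

definition extrapolation_link ::
    "('k::real_or_complex \<Rightarrow> 'a::banach \<Rightarrow> 'a) \<Rightarrow> 'a set \<Rightarrow> ('a \<Rightarrow> 'a) \<Rightarrow> nat
      \<Rightarrow> (nat \<Rightarrow> 'a) set \<Rightarrow> (nat \<Rightarrow> 'a) set" where
  "extrapolation_link smul D A n =
     (let E = norm_tvs (extrapolation_space smul D A n);
          E' = norm_tvs (extrapolation_space smul D A (Suc n))
      in THE f. f \<in> extensional (vcarrier E) \<and> linear_map E E' f \<and>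
                continuous_map (vtop E) (vtop E') f \<and>
                (\<forall>x. f (completion_embed (extrapolation_norm_space smul D A n) x) =
                     completion_embed (extrapolation_norm_space smul D A (Suc n)) x))"


section \<open>Projective and inductive limits of sequences\<close>

text \<open>The projective limit of a decreasing sequence of spaces, each of which is a linear subspace of
  the preceding one. The algebraic operations are therefore those of the first space.\<close>

definition proj_limit :: "(nat \<Rightarrow> ('k::real_or_complex, 'v) top_vspace) \<Rightarrow> ('k, 'v) top_vspace" where
  "proj_limit E =
     (let V = (E 0)\<lparr>vcarrier := \<Inter>n. vcarrier (E n)\<rparr>
      in with_top V (coarsest_topology (\<lambda>T. linear_topology V T \<and>
           (\<forall>n. continuous_map T (vtop (E n)) (\<lambda>x. x)))))"

text \<open>The algebraic direct limit along linking maps \<open>l n\<close> from \<open>E n\<close> to \<open>E (n + 1)\<close> is the disjoint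
  union of the spaces, where two elements are identified if they agree in some later space.\<close>

primrec transit_by :: "(nat \<Rightarrow> 'v \<Rightarrow> 'v) \<Rightarrow> nat \<Rightarrow> nat \<Rightarrow> 'v \<Rightarrow> 'v" where
  "transit_by l n 0 x = x"
| "transit_by l n (Suc d) x = l (n + d) (transit_by l n d x)"

definition transit :: "(nat \<Rightarrow> 'v \<Rightarrow> 'v) \<Rightarrow> nat \<Rightarrow> nat \<Rightarrow> 'v \<Rightarrow> 'v" where
  "transit l n m = transit_by l n (m - n)"

definition direct_rel ::
    "(nat \<Rightarrow> ('k, 'v) top_vspace) \<Rightarrow> (nat \<Rightarrow> 'v \<Rightarrow> 'v) \<Rightarrow> ((nat \<times> 'v) \<times> (nat \<times> 'v)) set" where
  "direct_rel E l =
     {((n, x), (m, y)). x \<in> vcarrier (E n) \<and> y \<in> vcarrier (E m) \<and>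
        (\<exists>k. n \<le> k \<and> m \<le> k \<and> transit l n k x = transit l m k y)}"

definition direct_limit ::
    "(nat \<Rightarrow> ('k, 'v) top_vspace) \<Rightarrow> (nat \<Rightarrow> 'v \<Rightarrow> 'v) \<Rightarrow> ('k, (nat \<times> 'v) set) vspace" where
  "direct_limit E l =
     \<lparr>vcarrier = (SIGMA n:UNIV. vcarrier (E n)) // direct_rel E l,
      vadd = (\<lambda>P Q. \<Union>(n, x)\<in>P. \<Union>(m, y)\<in>Q. direct_rel E l ``
        {(max n m, vadd (E (max n m)) (transit l n (max n m) x) (transit l m (max n m) y))}),
      vzero = direct_rel E l `` {(0, vzero (E 0))},
      vscale = (\<lambda>c P. \<Union>(n, x)\<in>P. direct_rel E l `` {(n, vscale (E n) c x)})\<rparr>"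

definition ind_limit ::
    "(nat \<Rightarrow> ('k::real_or_complex, 'v) top_vspace) \<Rightarrow> (nat \<Rightarrow> 'v \<Rightarrow> 'v)
      \<Rightarrow> ('k, (nat \<times> 'v) set) top_vspace" where
  "ind_limit E l =
     with_top (direct_limit E l) (finest_topology (\<lambda>T. linear_topology (direct_limit E l) T \<and>
       (\<forall>n. continuous_map (vtop (E n)) T (\<lambda>x. direct_rel E l `` {(n, x)}))))"

text \<open>Both limits run over the indices \<open>n \<ge> 1\<close>, hence the shift by one.\<close>

definition proj_dual_interpolation ::
    "('k::real_or_complex, 'v) normed_vspace \<Rightarrow> 'v set \<Rightarrow> ('v \<Rightarrow> 'v) \<Rightarrow> ('k, 'v \<Rightarrow> 'k) top_vspace" where
  "proj_dual_interpolation N D A =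
     proj_limit (\<lambda>n. norm_tvs (dual_interpolation_space N D A (Suc n)))"

definition ind_extrapolation ::
    "('k::real_or_complex \<Rightarrow> 'a::banach \<Rightarrow> 'a) \<Rightarrow> 'a set \<Rightarrow> ('a \<Rightarrow> 'a)
      \<Rightarrow> ('k, (nat \<times> (nat \<Rightarrow> 'a) set) set) top_vspace" where
  "ind_extrapolation smul D A =
     ind_limit (\<lambda>n. norm_tvs (extrapolation_space smul D A (Suc n)))
       (\<lambda>n. extrapolation_link smul D A (Suc n))"

end

theory Submission
  imports Defs "HOL-Library.Function_Algebras"
begin

text \<open>Write \<open>b\<close> for the inverse of \<open>A\<close>. The isometry extending \<open>A\<close> to the power \<open>-n\<close> identifies
  \<open>X\<^sub>-\<^sub>n\<close> with \<open>X\<close>, and the linking maps become \<open>b\<close>; dually, the projective limit \<open>P\<close> consists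
  of the functionals that factor through all powers of \<open>b\<close>. By Hahn-Banach and reflexivity the
  adjoint of \<open>b\<close> has dense range, so \<open>P\<close> is dense in the dual of \<open>X\<close> by the Mittag-Leffler
  argument. Hence every continuous functional on \<open>P\<close> has the form \<open>\<psi> \<mapsto> ((A')\<^sup>n \<psi>) x\<close> with
  \<open>x\<close> determined by \<open>n\<close>, which gives the algebraic isomorphism.

  A neighborhood of zero in any linear topology on the inductive limit making the canonical maps
  continuous contains a set of finite sums of elements of small balls of the steps. The infimum of
  \<open>\<Sum>i c\<^sub>i \<parallel>x\<^sub>i\<parallel>\<close> over all decompositions of an element into \<open>\<Sum>i x\<^sub>i\<close> is a seminorm, and the functionals
  it dominates are elements \<open>\<psi>\<close> of \<open>P\<close> with \<open>\<parallel>(A')\<^sup>i \<psi>\<parallel> \<le> c\<^sub>i\<close> for all \<open>i\<close>. They form a bounded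
  set, so by Hahn-Banach the neighborhood contains the polar of a bounded set. Therefore the strong
  topology is the finest one. Completeness is that of the strong dual of a metrizable space.\<close>


section \<open>The Hahn-Banach theorem\<close>

text \<open>Scalars may be real or complex, whereas Hahn-Banach, the Mittag-Leffler step and the
  polar argument are carried out for real functionals. \<open>kre\<close> passes back and forth: a
  functional over \<open>'k\<close> is determined by its real part and has the same norm. The
  seminorm of the overview needs a vector space to live on before the direct limit has been
  identified. Functions on families of functionals serve as that space; the relations of the direct
  limit hold there by construction. A zero neighborhood is instead shrunk countably often, with one
  shrunken copy for each step of the limit. The bipolar theorem would yield membership in a closure
  only. Level n of both limits has order n + 1, whence the frequent \<open>Suc n\<close>.\<close>

locale real_linear_space = vector_space scale
  for scale :: "real \<Rightarrow> 'b::ab_group_add \<Rightarrow> 'b"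
begin

text \<open>The ambient space is a subspace \<open>L\<close> of the type, because the seminorm used
  later is an infimum over a set that is nonempty only on a subspace.\<close>

lemma hahn_banach:
  assumes L: "subspace L" and S: "subspace S" and SL: "S \<subseteq> L"
    and p_add: "\<And>x y. x \<in> L \<Longrightarrow> y \<in> L \<Longrightarrow> p (x + y) \<le> p x + p y"
    and p_scale: "\<And>r x. 0 \<le> r \<Longrightarrow> x \<in> L \<Longrightarrow> p (scale r x) = r * p x"
    and f_add: "\<And>x y. x \<in> S \<Longrightarrow> y \<in> S \<Longrightarrow> f (x + y) = f x + f y"
    and f_scale: "\<And>r x. x \<in> S \<Longrightarrow> f (scale r x) = r * f x"
    and f_le: "\<And>x. x \<in> S \<Longrightarrow> f x \<le> p x"
  obtains g where "\<And>x y. x \<in> L \<Longrightarrow> y \<in> L \<Longrightarrow> g (x + y) = g x + g y"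
    and "\<And>r x. x \<in> L \<Longrightarrow> g (scale r x) = r * g x"
    and "\<And>x. x \<in> L \<Longrightarrow> g x \<le> p x"
    and "\<And>x. x \<in> S \<Longrightarrow> g x = f x"
proof -
  define G0 where "G0 = {(x, f x) | x. x \<in> S}"
  \<comment> \<open>Members of \<open>GG\<close> are linear relations dominated by \<open>p\<close>.
    Single-valuedness is not part of the definition: domination forces it, since
    \<open>(0, r)\<close> and \<open>(0, - r)\<close> in the relation give r = 0. Hence no
    well-definedness has to be checked for the one-step extension \<open>M'\<close>.\<close>
  define GG where "GG = {G. (\<forall>x r. (x, r) \<in> G \<longrightarrow> x \<in> L \<and> r \<le> p x) \<and>
      (\<forall>x r y s. (x, r) \<in> G \<longrightarrow> (y, s) \<in> G \<longrightarrow> (x + y, r + s) \<in> G) \<and>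
      (\<forall>t x r. (x, r) \<in> G \<longrightarrow> (scale t x, t * r) \<in> G) \<and> G0 \<subseteq> G}"
  have G0: "G0 \<in> GG"
    unfolding GG_def G0_def
    using subsetD[OF SL] by (auto simp: f_add f_scale f_le subspace_add[OF S] subspace_scale[OF S])
  have "\<exists>M\<in>GG. \<forall>X\<in>GG. M \<subseteq> X \<longrightarrow> X = M"
  proof (rule subset_Zorn_nonempty)
    show "GG \<noteq> {}"
      using G0 by blast
    fix C assume C: "C \<noteq> {}" "subset.chain GG C"
    have CG: "\<And>G. G \<in> C \<Longrightarrow> G \<in> GG"
      using C(2) by (auto simp: subset.chain_def)
    have comp: "\<And>G H. G \<in> C \<Longrightarrow> H \<in> C \<Longrightarrow> G \<subseteq> H \<or> H \<subseteq> G"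
      using C(2) by (auto simp: subset.chain_def)
    show "\<Union>C \<in> GG"
      unfolding GG_def
    proof (intro CollectI conjI allI impI)
      fix x r y s assume "(x, r) \<in> \<Union>C" "(y, s) \<in> \<Union>C"
      then obtain G H where GH: "G \<in> C" "H \<in> C" "(x, r) \<in> G" "(y, s) \<in> H"
        by blast
      then obtain K where "K \<in> C" "(x, r) \<in> K" "(y, s) \<in> K"
        using comp by blast
      then show "(x + y, r + s) \<in> \<Union>C"
        using CG[of K] unfolding GG_def by blast
    next
      fix x r assume "(x, r) \<in> \<Union>C"
      then obtain G where G: "G \<in> C" "(x, r) \<in> G" by blast
      then show "x \<in> L" "r \<le> p x" using CG[of G] unfolding GG_def by blast+
      show "(scale t x, t * r) \<in> \<Union>C" for t
        using G CG[of G] unfolding GG_def by blast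
    next
      show "G0 \<subseteq> \<Union>C"
        using C(1) CG unfolding GG_def by blast
    qed
  qed
  then obtain M where M: "M \<in> GG" and max: "\<And>X. X \<in> GG \<Longrightarrow> M \<subseteq> X \<Longrightarrow> X = M"
    by blast
  have M_L: "\<And>x r. (x, r) \<in> M \<Longrightarrow> x \<in> L" and M_le: "\<And>x r. (x, r) \<in> M \<Longrightarrow> r \<le> p x"
    and M_add: "\<And>x r y s. (x, r) \<in> M \<Longrightarrow> (y, s) \<in> M \<Longrightarrow> (x + y, r + s) \<in> M"
    and M_scale: "\<And>t x r. (x, r) \<in> M \<Longrightarrow> (scale t x, t * r) \<in> M"
    and M_f: "\<And>x. x \<in> S \<Longrightarrow> (x, f x) \<in> M"
    using M unfolding GG_def G0_def by blast+
  have p0: "p 0 = 0"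
    using p_scale[of 0 0] L by (simp add: subspace_0)
  have M0: "(0, 0) \<in> M"
    using M_scale[OF M_f[OF subspace_0[OF S]], of 0] by simp
  have zero: "r = 0" if "(0, r) \<in> M" for r
    using M_le[OF that] M_le[OF M_scale[OF that, of "- 1"]] p0 by simp
  have single: "r = s" if "(x, r) \<in> M" "(x, s) \<in> M" for x r s
    using zero[of "r - s"] M_add[OF that(1) M_scale[OF that(2), of "- 1"]] by simp
  have dom: "\<exists>r. (x, r) \<in> M" if x: "x \<in> L" for x
  proof (rule ccontr)
    assume nx: "\<nexists>r. (x, r) \<in> M"
    \<comment> \<open>Subadditivity at (y - x) + (z + x) puts every lower bound for the value at
      \<open>x\<close> below every upper bound. The supremum \<open>a\<close> of the lower bounds is
      an admissible value.\<close>
    have le: "r - p (y - x) \<le> p (z + x) - s" if "(y, r) \<in> M" "(z, s) \<in> M" for y r z s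
    proof -
      have "r + s \<le> p ((y - x) + (z + x))"
        using M_le[OF M_add[OF that]] by (simp add: algebra_simps)
      also have "\<dots> \<le> p (y - x) + p (z + x)"
        by (rule p_add) (use L x M_L that in \<open>auto intro: subspace_add subspace_diff\<close>)
      finally show ?thesis by simp
    qed
    define a where "a = (SUP (y, r)\<in>M. r - p (y - x))"
    have bdd: "bdd_above ((\<lambda>(y, r). r - p (y - x)) ` M)"
      by (rule bdd_aboveI[of _ "p (0 + x) - 0"]) (use le M0 in fastforce)
    have a1: "r - p (y - x) \<le> a" if "(y, r) \<in> M" for y r
      unfolding a_def by (rule cSUP_upper2[OF bdd that]) simp
    have a2: "a \<le> p (z + x) - s" if "(z, s) \<in> M" for z s
      unfolding a_def by (rule cSUP_least) (use M0 le that in auto)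
    define M' where "M' = {(y + scale t x, r + t * a) | y r t. (y, r) \<in> M}"
    have MM': "M \<subseteq> M'"
    proof
      fix z assume "z \<in> M"
      then have "(fst z + scale 0 x, snd z + 0 * a) \<in> M'"
        unfolding M'_def by (intro CollectI exI[of _ "fst z"] exI[of _ "snd z"] exI[of _ 0]) simp
      then show "z \<in> M'" by simp
    qed
    \<comment> \<open>Homogeneity reduces the claim to t = 1 and t = -1: after division by the
      modulus of \<open>t\<close> it becomes \<open>a2\<close> for positive and \<open>a1\<close>
      for negative \<open>t\<close>.\<close>
    have pos: "r + t * a \<le> p (y + scale t x)" if yr: "(y, r) \<in> M" for y r t
    proof (cases t "0 :: real" rule: linorder_cases)
      case equal
      then show ?thesis using M_le[OF yr] by simp
    next
      case greater
      have "a \<le> p (scale (1 / t) y + x) - r / t"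
        using a2[OF M_scale[OF yr, of "1 / t"]] by simp
      then have "t * a \<le> t * p (scale (1 / t) y + x) - r"
        using greater by (simp add: field_simps)
      also have "t * p (scale (1 / t) y + x) = p (scale t (scale (1 / t) y + x))"
        by (rule p_scale[symmetric]) (use greater L x M_L yr in \<open>auto intro: subspace_add subspace_scale\<close>)
      also have "scale t (scale (1 / t) y + x) = y + scale t x"
        using greater by (simp add: scale_right_distrib)
      finally show ?thesis by simp
    next
      case less
      define u where "u = - t"
      have u: "u > 0" "t = - u" using less by (auto simp: u_def)
      have "r / u - p (scale (1 / u) y - x) \<le> a"
        using a1[OF M_scale[OF yr, of "1 / u"]] by simp
      then have "r - u * p (scale (1 / u) y - x) \<le> u * a"
        using u by (simp add: field_simps)
      also have "u * p (scale (1 / u) y - x) = p (scale u (scale (1 / u) y - x))"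
        by (rule p_scale[symmetric]) (use u L x M_L yr in \<open>auto intro: subspace_diff subspace_scale\<close>)
      also have "scale u (scale (1 / u) y - x) = y + scale t x"
        using u by (simp add: scale_right_diff_distrib)
      finally show ?thesis using u by simp
    qed
    have "M' \<in> GG"
      unfolding GG_def
    proof (intro CollectI conjI allI impI)
      fix z r assume "(z, r) \<in> M'"
      then show "z \<in> L" "r \<le> p z"
        using pos L x M_L unfolding M'_def by (auto intro!: subspace_add subspace_scale)
    next
      fix z r w s assume "(z, r) \<in> M'" "(w, s) \<in> M'"
      then obtain y1 r1 t1 y2 r2 t2 where *: "(y1, r1) \<in> M" "(y2, r2) \<in> M"
        "z = y1 + scale t1 x" "r = r1 + t1 * a" "w = y2 + scale t2 x" "s = r2 + t2 * a"
        unfolding M'_def by blast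
      have "z + w = (y1 + y2) + scale (t1 + t2) x" "r + s = (r1 + r2) + (t1 + t2) * a"
        using * by (simp_all add: scale_left_distrib algebra_simps)
      then show "(z + w, r + s) \<in> M'"
        using M_add[OF *(1,2)] unfolding M'_def by blast
    next
      fix t z r assume "(z, r) \<in> M'"
      then obtain y1 r1 t1 where *: "(y1, r1) \<in> M" "z = y1 + scale t1 x" "r = r1 + t1 * a"
        unfolding M'_def by blast
      have "scale t z = scale t y1 + scale (t * t1) x" "t * r = t * r1 + (t * t1) * a"
        using * by (simp_all add: scale_right_distrib algebra_simps)
      then show "(scale t z, t * r) \<in> M'"
        using M_scale[OF *(1)] unfolding M'_def by blast
    next
      show "G0 \<subseteq> M'"
        using M MM' unfolding GG_def by blast
    qed
    then have "M' = M" by (rule max) (rule MM')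
    moreover have "(x, a) \<in> M'"
      unfolding M'_def using M0 by (intro CollectI exI[of _ 0] exI[of _ 1]) force
    ultimately show False using nx by blast
  qed
  define g where "g x = (THE r. (x, r) \<in> M)" for x
  have g: "(x, g x) \<in> M" if "x \<in> L" for x
    using dom[OF that] single unfolding g_def by (metis theI)
  show thesis
  proof (rule that[of g])
    show "g (x + y) = g x + g y" if "x \<in> L" "y \<in> L" for x y
      using g M_add[OF g[OF that(1)] g[OF that(2)]] single subspace_add[OF L that] by blast
    show "g (scale r x) = r * g x" if "x \<in> L" for x r
      using g M_scale[OF g[OF that]] single subspace_scale[OF L that] by blast
    show "g x \<le> p x" if "x \<in> L" for x
      using M_le g that by blast
    show "g x = f x" if "x \<in> S" for x
      using g M_f single that SL by blast
  qed
qed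

text \<open>The prescription t x0 to t p(x0) on a line is dominated by \<open>p\<close>: for t \<ge>
  0 by homogeneity, for t < 0 because 0 = p(0) \<le> p(t x0) + p(-t x0).\<close>

lemma hahn_banach_point:
  assumes L: "subspace L" and x0: "x0 \<in> L"
    and p_add: "\<And>x y. x \<in> L \<Longrightarrow> y \<in> L \<Longrightarrow> p (x + y) \<le> p x + p y"
    and p_scale: "\<And>r x. 0 \<le> r \<Longrightarrow> x \<in> L \<Longrightarrow> p (scale r x) = r * p x"
  obtains g where "\<And>x y. x \<in> L \<Longrightarrow> y \<in> L \<Longrightarrow> g (x + y) = g x + g y"
    and "\<And>r x. x \<in> L \<Longrightarrow> g (scale r x) = r * g x"
    and "\<And>x. x \<in> L \<Longrightarrow> g x \<le> p x"
    and "g x0 = p x0"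
proof -
  have p0: "p 0 = 0"
    using p_scale[of 0 0] L by (simp add: subspace_0)
  have le: "t * p x0 \<le> p (scale t x0)" for t
  proof (cases "t \<ge> 0")
    case True
    then show ?thesis using p_scale[OF True x0] by simp
  next
    case False
    have "0 = p (scale t x0 + scale (- t) x0)"
      using p0 by (simp flip: scale_left_distrib)
    also have "\<dots> \<le> p (scale t x0) + p (scale (- t) x0)"
      by (rule p_add) (use subspace_scale[OF L x0] in \<open>auto simp del: scale_minus_left\<close>)
    also have "p (scale (- t) x0) = - t * p x0"
      using False x0 by (intro p_scale) auto
    finally show ?thesis by simp
  qed
  \<comment> \<open>The coefficient \<open>t\<close> is determined only if \<open>x0\<close> is
    nonzero. For \<open>x0 = 0\<close> the value 0 is the right one since p(0) = 0.\<close>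
  define f where "f x = (if x0 = 0 then 0 else (THE t. x = scale t x0) * p x0)" for x
  have f: "f (scale t x0) = t * p x0" for t
    by (auto simp: f_def p0 scale_cancel_right)
  have S: "subspace (range (\<lambda>t. scale t x0))"
    unfolding subspace_def
    by (auto intro: range_eqI[of _ _ 0] simp flip: scale_left_distrib)
  obtain g where "\<And>x y. x \<in> L \<Longrightarrow> y \<in> L \<Longrightarrow> g (x + y) = g x + g y"
    and "\<And>r x. x \<in> L \<Longrightarrow> g (scale r x) = r * g x"
    and "\<And>x. x \<in> L \<Longrightarrow> g x \<le> p x"
    and "\<And>x. x \<in> range (\<lambda>t. scale t x0) \<Longrightarrow> g x = f x"
  proof (rule hahn_banach[OF L S, of p f])
    show "range (\<lambda>t. scale t x0) \<subseteq> L"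
      using L x0 by (auto intro: subspace_scale)
    show "f (x + y) = f x + f y" if "x \<in> range (\<lambda>t. scale t x0)" "y \<in> range (\<lambda>t. scale t x0)" for x y
      using that by (auto simp: f distrib_right simp flip: scale_left_distrib)
    show "f (scale r x) = r * f x" if "x \<in> range (\<lambda>t. scale t x0)" for r x
      using that by (auto simp: f)
    show "f x \<le> p x" if "x \<in> range (\<lambda>t. scale t x0)" for x
      using that le by (auto simp: f)
  qed (use p_add p_scale in auto)
  then show thesis
    using that[of g] f[of 1] by (metis mult_1 rangeI scale_one)
qed

end

section \<open>Bounded real functionals: norming, extension, separation from a subspace\<close>

interpretation normed: real_linear_space "(*\<^sub>R) :: real \<Rightarrow> 'b::real_vector \<Rightarrow> 'b"
  by unfold_locales (auto simp: algebra_simps)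

lemma module_subspace_scaleR: "module.subspace (*\<^sub>R) = subspace"
  by (simp add: subspace_raw_def real_vector.subspace_def)

lemma infdist_less_obtain:
  fixes x :: "'b::metric_space"
  assumes "S \<noteq> {}" and "infdist x S < e"
  obtains s where "s \<in> S" and "dist x s < e"
proof -
  have "(INF s\<in>S. dist x s) < e"
    using assms by (simp add: infdist_notempty)
  then show thesis
    using that assms(1) by (auto simp: cInf_less_iff bdd_below_image_dist)
qed

text \<open>Symmetry of the seminorm turns the one-sided bound of Hahn-Banach into one for the
  absolute value. It is applied to the norm and to the distance from a subspace.\<close>

lemma blinfun_seminorm_attained:
  fixes x0 :: "'b::real_normed_vector"
  assumes p_add: "\<And>x y. p (x + y) \<le> p x + p y"
    and p_scale: "\<And>r x. p (r *\<^sub>R x) = \<bar>r\<bar> * p x"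
    and p_le: "\<And>x. p x \<le> norm x"
  obtains g :: "'b \<Rightarrow>\<^sub>L real" where "\<And>x. \<bar>g x\<bar> \<le> p x" and "g x0 = p x0"
proof -
  obtain g where g: "\<And>x y. g (x + y) = g x + g y" "\<And>r x. g (r *\<^sub>R x) = r * g x"
    "\<And>x. g x \<le> p x" "g x0 = p x0"
    by (rule normed.hahn_banach_point[of UNIV x0 p])
      (use p_add p_scale in \<open>auto simp: module_subspace_scaleR\<close>)
  have abs: "\<bar>g x\<bar> \<le> p x" for x
    using g(2)[of "- 1" x] g(3)[of x] g(3)[of "- x"] p_scale[of "- 1" x] by simp
  have "bounded_linear g"
    by (rule bounded_linear_intro[of _ 1]) (use g order_trans[OF abs p_le] in auto)
  then show thesis
    using that[of "Blinfun g"] abs g(4) by (simp add: bounded_linear_Blinfun_apply)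
qed

lemma blinfun_norm_attained:
  fixes x0 :: "'b::real_normed_vector"
  obtains g :: "'b \<Rightarrow>\<^sub>L real" where "\<And>x. \<bar>g x\<bar> \<le> norm x" and "g x0 = norm x0"
  by (rule blinfun_seminorm_attained[of norm x0]) (auto simp: norm_triangle_ineq)

lemma blinfun_extension:
  fixes f :: "'b::real_normed_vector \<Rightarrow> real"
  assumes S: "subspace S"
    and f_add: "\<And>x y. x \<in> S \<Longrightarrow> y \<in> S \<Longrightarrow> f (x + y) = f x + f y"
    and f_scale: "\<And>r x. x \<in> S \<Longrightarrow> f (r *\<^sub>R x) = r * f x"
    and f_le: "\<And>x. x \<in> S \<Longrightarrow> \<bar>f x\<bar> \<le> C * norm x" and C: "0 \<le> C"
  obtains g :: "'b \<Rightarrow>\<^sub>L real" where "\<And>x. x \<in> S \<Longrightarrow> g x = f x"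
proof -
  obtain g where g: "\<And>x y. g (x + y) = g x + g y" "\<And>r x. g (r *\<^sub>R x) = r * g x"
    "\<And>x. g x \<le> C * norm x" "\<And>x. x \<in> S \<Longrightarrow> g x = f x"
  proof (rule normed.hahn_banach[of UNIV S "\<lambda>x. C * norm x" f])
    show "C * norm (x + y) \<le> C * norm x + C * norm y" for x y :: 'b
      using C by (metis distrib_left mult_left_mono norm_triangle_ineq)
    show "f x \<le> C * norm x" if "x \<in> S" for x
      using f_le[OF that] by simp
  qed (use S f_add f_scale in \<open>auto simp: module_subspace_scaleR\<close>)
  have "\<bar>g x\<bar> \<le> norm x * C" for x
    using g(2)[of "- 1" x] g(3)[of x] g(3)[of "- x"] by (simp add: mult.commute)
  then have "bounded_linear g"
    by (intro bounded_linear_intro[of _ C]) (use g in auto)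
  then show thesis
    using that[of "Blinfun g"] g(4) by (simp add: bounded_linear_Blinfun_apply)
qed

text \<open>The distance to a subspace is the quotient seminorm; these properties make Hahn-Banach
  applicable to it.\<close>

lemma infdist_subspace:
  fixes S :: "'b::real_normed_vector set"
  assumes S: "subspace S"
  shows "infdist (x + y) S \<le> infdist x S + infdist y S"
    and "infdist (r *\<^sub>R x) S = \<bar>r\<bar> * infdist x S"
    and "infdist x S \<le> norm x"
proof -
  have ne: "S \<noteq> {}" using subspace_0[OF S] by blast
  show n: "infdist x S \<le> norm x" for x
    using infdist_le[OF subspace_0[OF S], of x] by simp
  show "infdist (x + y) S \<le> infdist x S + infdist y S"
  proof (rule field_le_epsilon)
    fix e :: real assume e: "e > 0"
    obtain s where s: "s \<in> S" "dist x s < infdist x S + e / 2"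
      using infdist_less_obtain[OF ne] e by (metis less_add_same_cancel1 half_gt_zero)
    obtain t where t: "t \<in> S" "dist y t < infdist y S + e / 2"
      using infdist_less_obtain[OF ne] e by (metis less_add_same_cancel1 half_gt_zero)
    have "infdist (x + y) S \<le> dist (x + y) (s + t)"
      by (rule infdist_le[OF subspace_add[OF S s(1) t(1)]])
    also have "\<dots> \<le> dist x s + dist y t"
      by (rule dist_triangle_add)
    finally show "infdist (x + y) S \<le> infdist x S + infdist y S + e"
      using s t by simp
  qed
  have le: "infdist (r *\<^sub>R x) S \<le> \<bar>r\<bar> * infdist x S" for r x
  proof (rule field_le_epsilon)
    fix e :: real assume e: "e > 0"
    obtain s where s: "s \<in> S" "dist x s < infdist x S + e / (\<bar>r\<bar> + 1)"
      by (rule infdist_less_obtain[OF ne, of x "infdist x S + e / (\<bar>r\<bar> + 1)"]) (use e in auto)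
    have "infdist (r *\<^sub>R x) S \<le> dist (r *\<^sub>R x) (r *\<^sub>R s)"
      by (rule infdist_le[OF subspace_scale[OF S s(1)]])
    also have "\<dots> = \<bar>r\<bar> * dist x s" by (simp add: dist_norm flip: scaleR_diff_right)
    also have "\<dots> \<le> \<bar>r\<bar> * (infdist x S + e / (\<bar>r\<bar> + 1))"
      using s by (intro mult_left_mono) auto
    also have "\<dots> \<le> \<bar>r\<bar> * infdist x S + e"
      using e by (simp add: field_simps)
    finally show "infdist (r *\<^sub>R x) S \<le> \<bar>r\<bar> * infdist x S + e" .
  qed
  show "infdist (r *\<^sub>R x) S = \<bar>r\<bar> * infdist x S"
  proof (cases "r = 0")
    case True
    then show ?thesis using n[of 0] infdist_nonneg[of 0 S] by simp
  next
    case False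
    \<comment> \<open>The reverse inequality is \<open>le\<close> for the factor 1 / r at the point
      r x.\<close>
    have "\<bar>r\<bar> * infdist x S = \<bar>r\<bar> * infdist ((1 / r) *\<^sub>R (r *\<^sub>R x)) S"
      using False by simp
    also have "\<dots> \<le> \<bar>r\<bar> * (\<bar>1 / r\<bar> * infdist (r *\<^sub>R x) S)"
      by (intro mult_left_mono le) auto
    also have "\<dots> = infdist (r *\<^sub>R x) S" using False by simp
    finally show ?thesis using le[of r x] by simp
  qed
qed

text \<open>A point off the closure has positive distance from \<open>S\<close>. A functional that
  is dominated by the distance and attains it at this point vanishes on \<open>S\<close> but is
  nonzero.\<close>

lemma dense_subspaceI:
  fixes S :: "'b::real_normed_vector set"
  assumes S: "subspace S"
    and zero: "\<And>(g :: 'b \<Rightarrow>\<^sub>L real) y. (\<And>x. x \<in> S \<Longrightarrow> g x = 0) \<Longrightarrow> g y = 0"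
  shows "closure S = UNIV"
proof (rule ccontr)
  have ne: "S \<noteq> {}" using subspace_0[OF S] by blast
  assume "closure S \<noteq> UNIV"
  then obtain x where "x \<notin> closure S" by blast
  then have x: "infdist x S > 0"
    using in_closure_iff_infdist_zero[OF ne] infdist_nonneg[of x S] by force
  obtain g :: "'b \<Rightarrow>\<^sub>L real" where g: "\<And>x. \<bar>g x\<bar> \<le> infdist x S" "g x = infdist x S"
    using blinfun_seminorm_attained[of "\<lambda>x. infdist x S" x] infdist_subspace[OF S] by metis
  have "g y = 0" if "y \<in> S" for y
    using g(1)[of y] that by simp
  then show False using zero[of g x] g(2) x by simp
qed

text \<open>Hahn-Banach for the infimum of the weighted norm sums over all decompositions.\<close>

lemma (in real_linear_space) bounded_decomposition_or_functional:
  fixes e :: "nat \<Rightarrow> 'a::real_normed_vector \<Rightarrow> 'b"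
  assumes e_add: "\<And>n x y. e n (x + y) = e n x + e n y"
    and e_scale: "\<And>n r x. e n (r *\<^sub>R x) = scale r (e n x)"
    and c: "\<And>n. 0 \<le> c n"
  obtains N x where "e m y = (\<Sum>i<N. e i (x i))" and "(\<Sum>i<N. c i * norm (x i)) < 2"
  | \<xi> :: "nat \<Rightarrow> 'a \<Rightarrow>\<^sub>L real" and g :: "'b \<Rightarrow> real"
    where "\<And>i x. \<xi> i x = g (e i x)" and "\<And>i. norm (\<xi> i) \<le> c i" and "\<xi> m y > 1"
proof (cases "\<exists>N x. e m y = (\<Sum>i<N. e i (x i)) \<and> (\<Sum>i<N. c i * norm (x i)) < 2")
  case True
  then show thesis using that(1) by blast
next
  case large: False
  have e0: "e n 0 = 0" for n
    using e_scale[of n 0 0] by simp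
  \<comment> \<open>Decompositions are padded by zeros, so that two of them can be added termwise at
    the common length \<open>max N K\<close>.\<close>
  define dec where "dec F w \<longleftrightarrow> (\<exists>N x. (\<forall>i\<ge>N. x i = 0) \<and> F = (\<Sum>i<N. e i (x i)) \<and>
      w = (\<Sum>i<N. c i * norm (x i)))" for F w
  have dec_pos: "0 \<le> w" if "dec F w" for F w
    using that c unfolding dec_def by (auto intro!: sum_nonneg)
  have dec_add: "\<exists>u. dec (F + G) u \<and> u \<le> v + w" if Fv: "dec F v" and Gw: "dec G w" for F G v w
  proof -
    obtain N x where x: "\<forall>i\<ge>N. x i = 0" "F = (\<Sum>i<N. e i (x i))" "v = (\<Sum>i<N. c i * norm (x i))"
      using Fv unfolding dec_def by blast
    obtain K z where z: "\<forall>i\<ge>K. z i = 0" "G = (\<Sum>i<K. e i (z i))" "w = (\<Sum>i<K. c i * norm (z i))"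
      using Gw unfolding dec_def by blast
    have "F = (\<Sum>i<max N K. e i (x i))" "v = (\<Sum>i<max N K. c i * norm (x i))"
      "G = (\<Sum>i<max N K. e i (z i))" "w = (\<Sum>i<max N K. c i * norm (z i))"
      unfolding x(2,3) z(2,3)
      by (rule sum.mono_neutral_left; use x(1) z(1) e0 in auto)+
    then have FG: "F + G = (\<Sum>i<max N K. e i (x i + z i))"
      and vw: "v + w = (\<Sum>i<max N K. c i * norm (x i) + c i * norm (z i))"
      by (simp_all only: e_add sum.distrib)
    have le: "(\<Sum>i<max N K. c i * norm (x i + z i)) \<le> v + w"
      unfolding vw
      by (intro sum_mono) (metis c distrib_left mult_left_mono norm_triangle_ineq)
    have "\<forall>i\<ge>max N K. x i + z i = 0"
      using x z by simp
    then have "dec (F + G) (\<Sum>i<max N K. c i * norm (x i + z i))"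
      unfolding dec_def
      by (intro exI[of _ "max N K"] exI[of _ "\<lambda>i. x i + z i"] conjI FG refl)
    with le show ?thesis by blast
  qed
  have dec_scale: "dec (scale r F) (\<bar>r\<bar> * v)" if Fv: "dec F v" for F v r
  proof -
    obtain N x where x: "\<forall>i\<ge>N. x i = 0" "F = (\<Sum>i<N. e i (x i))" "v = (\<Sum>i<N. c i * norm (x i))"
      using Fv unfolding dec_def by blast
    have "scale r F = (\<Sum>i<N. e i (r *\<^sub>R x i))"
      by (simp add: x(2) e_scale scale_sum_right)
    moreover have "\<bar>r\<bar> * v = (\<Sum>i<N. c i * norm (r *\<^sub>R x i))"
      by (simp add: x(3) sum_distrib_left mult.left_commute)
    moreover have "\<forall>i\<ge>N. r *\<^sub>R x i = 0"
      using x(1) by simp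
    ultimately show ?thesis
      unfolding dec_def by (intro exI[of _ N] exI[of _ "\<lambda>i. r *\<^sub>R x i"]) simp
  qed
  have dec_e: "dec (e n z) (c n * norm z)" for n z
  proof -
    define x where "x = (\<lambda>i. if i = n then z else 0)"
    have "e n z = (\<Sum>i<Suc n. e i (x i))" "c n * norm z = (\<Sum>i<Suc n. c i * norm (x i))"
      by (simp_all add: x_def e0)
    moreover have "\<forall>i\<ge>Suc n. x i = 0"
      by (simp add: x_def)
    ultimately show ?thesis
      unfolding dec_def by blast
  qed
  \<comment> \<open>Outside the span \<open>L\<close> of the images, \<open>p\<close> would be an
    infimum over the empty set, so \<open>L\<close> is the ambient space for Hahn-Banach.\<close>
  define L where "L = {F. \<exists>w. dec F w}"
  define p where "p F = Inf {w. dec F w}" for F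
  have bdd: "bdd_below {w. dec F w}" for F
    using dec_pos by (intro bdd_belowI[of _ 0]) auto
  have p_le: "p F \<le> w" if "dec F w" for F w
    unfolding p_def using bdd that by (intro cInf_lower) auto
  have p_ge: "t \<le> p F" if "F \<in> L" "\<And>w. dec F w \<Longrightarrow> t \<le> w" for F t
    unfolding p_def using that by (intro cInf_greatest) (auto simp: L_def)
  have L: "subspace L"
    unfolding subspace_def
  proof (intro conjI ballI allI)
    show "0 \<in> L"
      using dec_scale[OF dec_e, of 0] unfolding L_def by (simp, blast)
    show "F + G \<in> L" if FG: "F \<in> L" "G \<in> L" for F G
    proof -
      obtain v w where "dec F v" "dec G w"
        using FG unfolding L_def by blast
      then show ?thesis
        using dec_add[of F v G w] unfolding L_def by blast
    qed
    show "scale r F \<in> L" if "F \<in> L" for r F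
      using that dec_scale[of F _ r] unfolding L_def by blast
  qed
  have p_add: "p (F + G) \<le> p F + p G" if "F \<in> L" "G \<in> L" for F G
  proof -
    have "p (F + G) - w \<le> p F" if Gw: "dec G w" for w
    proof (rule p_ge[OF \<open>F \<in> L\<close>])
      fix v assume "dec F v"
      then obtain u where "dec (F + G) u" "u \<le> v + w"
        using dec_add Gw by blast
      then show "p (F + G) - w \<le> v" using p_le by force
    qed
    then have "p (F + G) - p F \<le> p G"
      by (intro p_ge[OF \<open>G \<in> L\<close>]) (smt (verit))
    then show ?thesis by simp
  qed
  have p_scale_le: "p (scale r F) \<le> r * p F" if "F \<in> L" "0 < r" for F r
  proof -
    have "p (scale r F) / r \<le> p F"
    proof (rule p_ge[OF \<open>F \<in> L\<close>])
      fix w assume "dec F w"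
      from p_le[OF dec_scale[OF this, of r]] show "p (scale r F) / r \<le> w"
        using \<open>0 < r\<close> by (simp add: field_simps)
    qed
    then show ?thesis using \<open>0 < r\<close> by (simp add: field_simps)
  qed
  have p_scale: "p (scale r F) = r * p F" if F: "F \<in> L" and "0 \<le> r" for F r
  proof (cases "r = 0")
    case True
    have "p 0 \<le> 0" "0 \<le> p 0"
      using p_le[OF dec_scale[OF dec_e, of 0]] p_ge[of 0 0] subspace_0[OF L] dec_pos by auto
    then show ?thesis using True by simp
  next
    case False
    then have r: "r > 0" using \<open>0 \<le> r\<close> by simp
    have "p (scale (1 / r) (scale r F)) \<le> 1 / r * p (scale r F)"
      by (rule p_scale_le) (use r F L in \<open>auto intro: subspace_scale\<close>)
    then have "r * p F \<le> p (scale r F)"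
      using r by (simp add: field_simps)
    then show ?thesis using p_scale_le[OF F r] by simp
  qed
  have eL: "e n z \<in> L" for n z
    using dec_e unfolding L_def by blast
  obtain g where g: "\<And>x y. x \<in> L \<Longrightarrow> y \<in> L \<Longrightarrow> g (x + y) = g x + g y"
    "\<And>r x. x \<in> L \<Longrightarrow> g (scale r x) = r * g x" "\<And>x. x \<in> L \<Longrightarrow> g x \<le> p x"
    "g (e m y) = p (e m y)"
    by (rule hahn_banach_point[OF L eL[of m y], of p]) (use p_add p_scale in auto)
  have g_le: "g (e n z) \<le> c n * norm z" for n z
    using g(3)[OF eL] p_le[OF dec_e] by (rule order_trans)
  have g_abs: "\<bar>g (e n z)\<bar> \<le> c n * norm z" for n z
    using g_le[of n z] g_le[of n "- z"] g(2)[OF eL, of "- 1" n z] e_scale[of n "- 1" z] by simp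
  have lin: "bounded_linear (\<lambda>z. g (e n z))" for n
    by (rule bounded_linear_intro[of _ "c n"])
      (use g eL g_abs in \<open>auto simp: e_add e_scale mult.commute\<close>)
  define \<xi> where "\<xi> n = Blinfun (\<lambda>z. g (e n z))" for n
  have \<xi>: "\<xi> n z = g (e n z)" for n z
    by (simp add: \<xi>_def bounded_linear_Blinfun_apply lin)
  \<comment> \<open>In the remaining case every decomposition of \<open>e m y\<close> costs at least
    2. As \<open>g\<close> attains \<open>p\<close> there, its value is at least 2, strictly above
    the threshold 1.\<close>
  have "2 \<le> p (e m y)"
    using large by (intro p_ge eL) (auto simp: dec_def not_less)
  then have "1 < \<xi> m y"
    using g(4) by (simp add: \<xi>)
  moreover have "norm (\<xi> n) \<le> c n" for n
    by (rule norm_blinfun_bound) (use c g_abs in \<open>auto simp: \<xi>\<close>)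
  ultimately show thesis
    using that(2) \<xi> by blast
qed

lemma real_linear_space_fun: "real_linear_space (\<lambda>r (f :: 'x \<Rightarrow> real) y. r * f y)"
  by unfold_locales (auto simp: fun_eq_iff distrib_left distrib_right)

section \<open>Dense ranges\<close>

text \<open>Mittag-Leffler: preimages under a map with dense range are chosen so that the errors,
  transported back to the start, are summable.\<close>

lemma dense_Inter_range_funpow:
  fixes T :: "'b::banach \<Rightarrow> 'b"
  assumes T: "bounded_linear T" and dense: "closure (range T) = UNIV"
  shows "closure {w. \<forall>k. w \<in> range (T ^^ k)} = UNIV"
proof -
  obtain C where C: "C > 0" "\<And>x. norm (T x) \<le> norm x * C"
    using bounded_linear.pos_bounded[OF T] by blast
  have Tn: "bounded_linear (T ^^ m)" for m
    by (induction m) (use T bounded_linear_compose in \<open>auto simp: o_def\<close>)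
  have Cn: "norm ((T ^^ m) x) \<le> C ^ m * norm x" for m x
  proof (induction m)
    case (Suc m)
    have "norm ((T ^^ Suc m) x) \<le> norm ((T ^^ m) x) * C"
      using C(2) by simp
    also have "\<dots> \<le> (C ^ m * norm x) * C"
      using Suc C by (intro mult_right_mono) auto
    finally show ?case by (simp add: mult_ac)
  qed simp
  have "\<exists>w\<in>{w. \<forall>k. w \<in> range (T ^^ k)}. dist w y < \<epsilon>" if \<epsilon>: "\<epsilon> > 0" for y \<epsilon>
  proof -
    \<comment> \<open>The denominator absorbs the growth under up to \<open>n\<close> applications
      of \<open>T\<close>. With \<open>max 1 C\<close> in place of \<open>C\<close> its powers
      increase, so that one sequence of errors serves every starting level \<open>k\<close>.\<close>
    define d where "d n = (\<epsilon> / 2) * (1 / 2) ^ Suc n / (max 1 C) ^ n" for n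
    have d: "d n > 0" for n
      using \<epsilon> by (simp add: d_def)
    have "\<exists>z'. dist (T z') z < d n" for n z
    proof -
      have "z \<in> closure (range T)" using dense by simp
      then show ?thesis using d[of n] unfolding closure_approachable by blast
    qed
    then have "\<forall>n. \<exists>f. \<forall>z. dist (T (f z)) z < d n"
      by (intro allI choice)
    then obtain step where step: "\<And>n z. dist (T (step n z)) z < d n"
      using choice[of "\<lambda>n f. \<forall>z. dist (T (f z)) z < d n"] by blast
    define z where "z = rec_nat y step"
    have z0: "z 0 = y" and z: "norm (T (z (Suc n)) - z n) < d n" for n
      using step[of n "z n"] by (simp_all add: z_def dist_norm)
    \<comment> \<open>\<open>z\<close> is a backward orbit of \<open>T\<close> up to the errors
      \<open>d\<close>. Its member \<open>k + m\<close>, carried \<open>m\<close> steps back to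
      level \<open>k\<close>, moves by at most (\<epsilon> / 2) (1 / 2)^(m + 1) when
      \<open>m\<close> grows by one.\<close>
    define s where "s k m = (T ^^ m) (z (k + m))" for k m
    have s_diff: "norm (s k (Suc m) - s k m) \<le> (\<epsilon> / 2) * (1 / 2) ^ Suc m" for k m
    proof -
      have "s k (Suc m) - s k m = (T ^^ m) (T (z (Suc (k + m))) - z (k + m))"
        using bounded_linear.linear[OF Tn[of m]]
        by (simp add: s_def linear_diff funpow_swap1)
      then have "norm (s k (Suc m) - s k m) \<le> C ^ m * norm (T (z (Suc (k + m))) - z (k + m))"
        using Cn by simp
      also have "\<dots> \<le> (max 1 C) ^ (k + m) * d (k + m)"
      proof (rule mult_mono)
        have "C ^ m \<le> (max 1 C) ^ m"
          using C by (intro power_mono) auto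
        also have "\<dots> \<le> (max 1 C) ^ (k + m)"
          by (intro power_increasing) auto
        finally show "C ^ m \<le> (max 1 C) ^ (k + m)" .
      qed (use z[of "k + m"] in auto)
      also have "\<dots> = (\<epsilon> / 2) * (1 / 2) ^ Suc (k + m)"
        by (simp add: d_def)
      also have "\<dots> \<le> (\<epsilon> / 2) * (1 / 2) ^ Suc m"
        using \<epsilon> by (intro mult_left_mono power_decreasing) auto
      finally show ?thesis .
    qed
    have geo: "(\<lambda>m. (\<epsilon> / 2) * (1 / 2) ^ Suc m) sums (\<epsilon> / 2)"
      using sums_mult[OF power_half_series, of "\<epsilon> / 2"] by simp
    have summ: "summable (\<lambda>m. s k (Suc m) - s k m)" for k
      by (rule summable_comparison_test'[OF sums_summable[OF geo], of 0]) (use s_diff in auto)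
    have tele: "(\<Sum>i<m. s k (Suc i) - s k i) = s k m - z k" for k m
      by (subst sum_lessThan_telescope) (simp add: s_def)
    define w where "w k = z k + (\<Sum>m. s k (Suc m) - s k m)" for k
    have w: "s k \<longlonglongrightarrow> w k" for k
      using tendsto_add[OF tendsto_const[of "z k"] summable_LIMSEQ[OF summ[of k]]]
      by (simp add: tele w_def)
    \<comment> \<open>The limits form an exact backward orbit, since \<open>T\<close> merely shifts
      the approximating sequences. This puts \<open>w 0\<close> into the range of every
      power.\<close>
    have Tw: "T (w (Suc k)) = w k" for k
    proof -
      have "(\<lambda>m. T (s (Suc k) m)) \<longlonglongrightarrow> T (w (Suc k))"
        by (rule bounded_linear.tendsto[OF T w])
      moreover have "(\<lambda>m. T (s (Suc k) m)) = (\<lambda>m. s k (Suc m))"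
        by (simp add: s_def)
      ultimately show ?thesis
        using LIMSEQ_Suc[OF w[of k]] LIMSEQ_unique by metis
    qed
    have "w 0 = (T ^^ k) (w k)" for k
    proof (induction k)
      case (Suc k)
      then have "w 0 = (T ^^ k) (T (w (Suc k)))" by (simp add: Tw)
      then show ?case by (simp add: funpow_swap1)
    qed simp
    then have "w 0 \<in> {w. \<forall>k. w \<in> range (T ^^ k)}"
      by blast
    moreover have "norm (w 0 - y) \<le> (\<Sum>m. (\<epsilon> / 2) * (1 / 2) ^ Suc m)"
      unfolding w_def z0 add_diff_cancel_left'
      by (rule norm_suminf_le[OF _ sums_summable[OF geo]]) (rule s_diff)
    then have "dist (w 0) y < \<epsilon>"
      using geo \<epsilon> by (simp add: dist_norm sums_iff)
    ultimately show ?thesis by blast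
  qed
  then show ?thesis
    by (auto simp: set_eq_iff closure_approachable)
qed

lemma blinfun_eq_on_dense:
  fixes \<phi> \<psi> :: "'a::real_normed_vector \<Rightarrow>\<^sub>L real"
  assumes "closure S = UNIV" and "\<And>x. x \<in> S \<Longrightarrow> \<phi> x = \<psi> x"
  shows "\<phi> = \<psi>"
proof (rule blinfun_eqI)
  fix x
  have "closed {x. \<phi> x = \<psi> x}"
    by (intro closed_Collect_eq continuous_intros)
  then have "closure S \<subseteq> {x. \<phi> x = \<psi> x}"
    using assms(2) by (intro closure_minimal) auto
  then show "\<phi> x = \<psi> x" using assms(1) by auto
qed

section \<open>Functionals that factor through all powers of an operator\<close>

lemma blinfun_compose_assoc:
  fixes \<phi> :: "'c::real_normed_vector \<Rightarrow>\<^sub>L 'd::real_normed_vector"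
  shows "(\<phi> o\<^sub>L S) o\<^sub>L T = \<phi> o\<^sub>L (S o\<^sub>L T)"
  by (rule blinfun_eqI) simp

lemma blinfun_compose_id_right:
  fixes \<phi> :: "'c::real_normed_vector \<Rightarrow>\<^sub>L 'd::real_normed_vector"
  shows "\<phi> o\<^sub>L id_blinfun = \<phi>"
  by (rule blinfun_eqI) simp

primrec bpow :: "('a::real_normed_vector \<Rightarrow>\<^sub>L 'a) \<Rightarrow> nat \<Rightarrow> 'a \<Rightarrow>\<^sub>L 'a" where
  "bpow B 0 = id_blinfun"
| "bpow B (Suc n) = B o\<^sub>L bpow B n"

lemma bpow_apply: "bpow B n x = ((blinfun_apply B) ^^ n) x"
  by (induction n arbitrary: x) simp_all

lemma bpow_add: "bpow B (m + n) = bpow B m o\<^sub>L bpow B n"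
  by (rule blinfun_eqI) (simp add: bpow_apply funpow_add)

text \<open>The intersection of the ranges of the powers of the adjoint of \<open>B\<close>. When
  \<open>B\<close> is the inverse of A, these are the real parts of the elements of the projective
  limit.\<close>

definition smooth_functionals :: "('a::real_normed_vector \<Rightarrow>\<^sub>L 'a) \<Rightarrow> ('a \<Rightarrow>\<^sub>L real) set" where
  "smooth_functionals B = {\<psi>. \<forall>n. \<exists>\<xi>. \<psi> = \<xi> o\<^sub>L bpow B n}"

lemma subspace_smooth_functionals: "subspace (smooth_functionals B)"
  unfolding subspace_def smooth_functionals_def
proof (intro conjI ballI allI CollectI)
  fix n
  show "\<exists>\<xi>. (0 :: 'a \<Rightarrow>\<^sub>L real) = \<xi> o\<^sub>L bpow B n"
    by (intro exI[of _ "0 :: 'a \<Rightarrow>\<^sub>L real"] blinfun_eqI) simp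
  fix \<phi> \<psi> :: "'a \<Rightarrow>\<^sub>L real" and r :: real
  assume \<phi>: "\<phi> \<in> {\<psi>. \<forall>n. \<exists>\<xi>. \<psi> = \<xi> o\<^sub>L bpow B n}"
  then obtain \<xi> where \<xi>: "\<phi> = \<xi> o\<^sub>L bpow B n" by blast
  show "\<exists>\<xi>. r *\<^sub>R \<phi> = \<xi> o\<^sub>L bpow B n"
    by (intro exI[of _ "r *\<^sub>R \<xi>"] blinfun_eqI) (simp add: \<xi> blinfun.scaleR_left)
  assume "\<psi> \<in> {\<psi>. \<forall>n. \<exists>\<xi>. \<psi> = \<xi> o\<^sub>L bpow B n}"
  then obtain \<xi>' where \<xi>': "\<psi> = \<xi>' o\<^sub>L bpow B n" by blast
  show "\<exists>\<xi>. \<phi> + \<psi> = \<xi> o\<^sub>L bpow B n"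
    by (intro exI[of _ "\<xi> + \<xi>'"] blinfun_eqI) (simp add: \<xi> \<xi>' blinfun.add_left)
qed

text \<open>Powers of \<open>B\<close> commute, so a factor of order \<open>k\<close> can be moved
  to the right of the new factor of order \<open>n\<close>.\<close>

lemma smooth_functionals_compose:
  assumes "\<psi> \<in> smooth_functionals B"
  shows "\<psi> o\<^sub>L bpow B n \<in> smooth_functionals B"
  unfolding smooth_functionals_def
proof (intro CollectI allI)
  fix k
  obtain \<xi> where \<xi>: "\<psi> = \<xi> o\<^sub>L bpow B k"
    using assms by (auto simp: smooth_functionals_def)
  have "\<psi> o\<^sub>L bpow B n = \<xi> o\<^sub>L bpow B (k + n)"
    by (simp add: \<xi> bpow_add blinfun_compose_assoc)
  also have "\<dots> = (\<xi> o\<^sub>L bpow B n) o\<^sub>L bpow B k"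
    by (simp add: add.commute[of k] bpow_add blinfun_compose_assoc)
  finally show "\<exists>\<xi>. \<psi> o\<^sub>L bpow B n = \<xi> o\<^sub>L bpow B k" by blast
qed

text \<open>The real core of the proof. \<open>B\<close> plays the role of the inverse of A, and
  \<open>bidual_evaluation\<close> is reflexivity expressed by real functionals; scalars from
  \<open>'k\<close> enter later through real parts.\<close>

locale smooth_dual =
  fixes B :: "'a::banach \<Rightarrow>\<^sub>L 'a"
  assumes inj_B: "inj (blinfun_apply B)"
    and dense_range_B: "closure (range (blinfun_apply B)) = UNIV"
    and bidual_evaluation: "\<And>G :: ('a \<Rightarrow>\<^sub>L real) \<Rightarrow>\<^sub>L real. \<exists>x. \<forall>\<phi> :: 'a \<Rightarrow>\<^sub>L real. blinfun_apply G \<phi> = blinfun_apply \<phi> x"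
begin

text \<open>An operator with dense range has an injective adjoint.\<close>

lemma compose_bpow_cancel:
  fixes \<phi> \<psi> :: "'a \<Rightarrow>\<^sub>L real"
  assumes "\<phi> o\<^sub>L bpow B n = \<psi> o\<^sub>L bpow B n"
  shows "\<phi> = \<psi>"
  using assms
proof (induction n arbitrary: \<phi> \<psi>)
  case 0
  then show ?case by (simp add: blinfun_compose_id_right)
next
  case (Suc n)
  then have "(\<phi> o\<^sub>L B) o\<^sub>L bpow B n = (\<psi> o\<^sub>L B) o\<^sub>L bpow B n"
    by (simp add: blinfun_compose_assoc)
  then have "\<phi> o\<^sub>L B = \<psi> o\<^sub>L B"
    by (rule Suc.IH)
  then show ?case
    by (intro blinfun_eq_on_dense[OF dense_range_B]) (metis blinfun_apply_blinfun_compose rangeE)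
qed

text \<open>Cancellation makes the factor \<xi> unique. Comparing it with a factorization of \<psi>
  of order k + n shows that \<xi> itself factors through the k-th power, for every k.\<close>

lemma smooth_functionals_decompose:
  assumes \<psi>: "\<psi> \<in> smooth_functionals B"
  obtains \<xi> where "\<xi> \<in> smooth_functionals B" and "\<psi> = \<xi> o\<^sub>L bpow B n"
proof -
  obtain \<xi> where \<xi>: "\<psi> = \<xi> o\<^sub>L bpow B n"
    using \<psi> by (auto simp: smooth_functionals_def)
  have "\<exists>\<xi>'. \<xi> = \<xi>' o\<^sub>L bpow B k" for k
  proof -
    obtain \<xi>' where \<xi>': "\<psi> = \<xi>' o\<^sub>L bpow B (k + n)"
      using \<psi> unfolding smooth_functionals_def by blast
    have "\<xi> o\<^sub>L bpow B n = (\<xi>' o\<^sub>L bpow B k) o\<^sub>L bpow B n"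
      using \<xi> \<xi>' by (simp add: bpow_add blinfun_compose_assoc)
    then show ?thesis using compose_bpow_cancel by blast
  qed
  then show thesis
    using that[of \<xi>] \<xi> by (simp add: smooth_functionals_def)
qed

lemma functional_zero:
  assumes "\<And>\<phi> :: 'a \<Rightarrow>\<^sub>L real. \<phi> x = 0"
  shows "x = 0"
  using blinfun_norm_attained[of x] assms by (metis norm_eq_zero)

lemma dense_smooth_functionals: "closure (smooth_functionals B) = UNIV"
proof -
  define T where "T = (\<lambda>\<phi> :: 'a \<Rightarrow>\<^sub>L real. \<phi> o\<^sub>L B)"
  have T: "bounded_linear T"
    unfolding T_def by (rule bounded_bilinear.bounded_linear_left[OF bounded_bilinear_blinfun_compose])
  \<comment> \<open>A functional on the dual that kills the range of the adjoint \<open>T\<close> is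
    evaluation at some \<open>x\<close> by reflexivity. Then \<open>B x\<close> is annihilated by
    all functionals, and injectivity of \<open>B\<close> gives x = 0.\<close>
  have "closure (range T) = UNIV"
  proof (rule dense_subspaceI)
    show "subspace (range T)"
      by (rule linear_subspace_image[OF bounded_linear.linear[OF T] subspace_UNIV])
    fix G :: "('a \<Rightarrow>\<^sub>L real) \<Rightarrow>\<^sub>L real"
    assume G: "\<And>\<phi>. \<phi> \<in> range T \<Longrightarrow> blinfun_apply G \<phi> = 0"
    obtain x where x: "\<And>\<phi> :: 'a \<Rightarrow>\<^sub>L real. blinfun_apply G \<phi> = blinfun_apply \<phi> x"
      using bidual_evaluation by blast
    have "\<phi> (B x) = 0" for \<phi> :: "'a \<Rightarrow>\<^sub>L real"
      using G[of "T \<phi>"] x[of "T \<phi>"] by (simp add: T_def)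
    then have "B x = B 0"
      using functional_zero by simp
    then have "x = 0"
      using inj_B by (simp only: inj_eq)
    then show "G \<phi> = 0" for \<phi>
      by (simp add: x)
  qed
  moreover have "(T ^^ k) \<xi> = \<xi> o\<^sub>L bpow B k" for k \<xi>
  proof (induction k)
    case (Suc k)
    then have "(T ^^ Suc k) \<xi> = \<xi> o\<^sub>L bpow B (k + 1)"
      unfolding bpow_add by (simp add: T_def blinfun_compose_assoc blinfun_compose_id_right)
    then show ?case by simp
  qed (simp add: blinfun_compose_id_right)
  then have "{w. \<forall>k. w \<in> range (T ^^ k)} = smooth_functionals B"
    by (auto simp: smooth_functionals_def image_iff)
  ultimately show ?thesis
    using dense_Inter_range_funpow[OF T] by simp
qed

text \<open>Vanishing at \<open>x\<close> is a norm-closed condition on functionals, so by density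
  it passes from the smooth ones to all.\<close>

lemma smooth_functionals_separate:
  assumes "\<And>\<phi>. \<phi> \<in> smooth_functionals B \<Longrightarrow> \<phi> x = 0"
  shows "x = 0"
proof (rule functional_zero)
  fix \<phi> :: "'a \<Rightarrow>\<^sub>L real"
  have "closed {\<phi> :: 'a \<Rightarrow>\<^sub>L real. \<phi> x = 0}"
    by (intro closed_Collect_eq continuous_intros)
  then have "closure (smooth_functionals B) \<subseteq> {\<phi> :: 'a \<Rightarrow>\<^sub>L real. \<phi> x = 0}"
    using assms by (intro closure_minimal) auto
  then show "\<phi> x = 0" using dense_smooth_functionals by auto
qed

text \<open>The bound is in terms of the factor \<xi>, not of its composition with the power of
  \<open>B\<close>. Thus \<open>f\<close> becomes a norm bounded functional of \<xi>, which extends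
  to the whole dual by Hahn-Banach and is an evaluation by reflexivity.\<close>

lemma functional_on_smooth_is_evaluation:
  fixes f :: "('a \<Rightarrow>\<^sub>L real) \<Rightarrow> real"
  assumes f_add: "\<And>\<phi> \<psi>. \<phi> \<in> smooth_functionals B \<Longrightarrow> \<psi> \<in> smooth_functionals B \<Longrightarrow> f (\<phi> + \<psi>) = f \<phi> + f \<psi>"
    and f_scale: "\<And>r \<phi>. \<phi> \<in> smooth_functionals B \<Longrightarrow> f (r *\<^sub>R \<phi>) = r * f \<phi>"
    and f_le: "\<And>\<xi>. \<xi> \<in> smooth_functionals B \<Longrightarrow> \<bar>f (\<xi> o\<^sub>L bpow B n)\<bar> \<le> C * norm \<xi>" and "0 \<le> C"
  obtains x where "\<And>\<xi>. \<xi> \<in> smooth_functionals B \<Longrightarrow> f (\<xi> o\<^sub>L bpow B n) = \<xi> x"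
proof -
  have compose_add: "(\<phi> + \<psi>) o\<^sub>L bpow B n = (\<phi> o\<^sub>L bpow B n) + (\<psi> o\<^sub>L bpow B n)" for \<phi> \<psi> :: "'a \<Rightarrow>\<^sub>L real"
    by (rule blinfun_eqI) (simp add: blinfun.add_left)
  have compose_scale: "(r *\<^sub>R \<phi>) o\<^sub>L bpow B n = r *\<^sub>R (\<phi> o\<^sub>L bpow B n)" for r and \<phi> :: "'a \<Rightarrow>\<^sub>L real"
    by (rule blinfun_eqI) (simp add: blinfun.scaleR_left)
  obtain G :: "('a \<Rightarrow>\<^sub>L real) \<Rightarrow>\<^sub>L real"
    where "\<And>\<xi>. \<xi> \<in> smooth_functionals B \<Longrightarrow> blinfun_apply G \<xi> = f (\<xi> o\<^sub>L bpow B n)"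
    by (rule blinfun_extension[OF subspace_smooth_functionals, of B "\<lambda>\<xi>. f (\<xi> o\<^sub>L bpow B n)" C])
      (use assms in \<open>auto simp: compose_add compose_scale smooth_functionals_compose\<close>)
  then show thesis
    using bidual_evaluation[of G] that by metis
qed

text \<open>If there were no decomposition of cost below 2, Hahn-Banach would give a coherent family
  bounded by \<open>c\<close> with a value above 1 at \<open>y\<close>, against
  \<open>bound\<close>. The decomposition is expressed as an identity of values on all coherent
  families.\<close>

lemma evaluation_bounded_decomposition:
  assumes c: "\<And>n. 0 \<le> c n"
    and bound: "\<And>\<psi> (\<xi> :: nat \<Rightarrow> 'a \<Rightarrow>\<^sub>L real). (\<And>n. \<psi> = \<xi> n o\<^sub>L bpow B (Suc n)) \<Longrightarrow> (\<And>n. norm (\<xi> n) \<le> c n) \<Longrightarrow> \<xi> m y \<le> 1"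
  obtains N x where "(\<Sum>i<N. c i * norm (x i)) < 2"
    and "\<And>\<psi> (\<xi> :: nat \<Rightarrow> 'a \<Rightarrow>\<^sub>L real). (\<And>n. \<psi> = \<xi> n o\<^sub>L bpow B (Suc n)) \<Longrightarrow> \<xi> m y = (\<Sum>i<N. \<xi> i (x i))"
proof -
  \<comment> \<open>Functions of a family \<xi> model the direct limit: \<open>e n x\<close> is
    evaluation of the n-th member at \<open>x\<close>. Setting it to 0 on incoherent families makes
    \<open>e n x = e (Suc n) (B x)\<close> an equality of functions.\<close>
  define coherent :: "(nat \<Rightarrow> 'a \<Rightarrow>\<^sub>L real) \<Rightarrow> bool"
    where "coherent \<xi> \<longleftrightarrow> (\<forall>n. \<xi> n = \<xi> (Suc n) o\<^sub>L B)" for \<xi>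
  define e :: "nat \<Rightarrow> 'a \<Rightarrow> (nat \<Rightarrow> 'a \<Rightarrow>\<^sub>L real) \<Rightarrow> real"
    where "e n x \<xi> = (if coherent \<xi> then \<xi> n x else 0)" for n x \<xi>
  interpret fn: real_linear_space "\<lambda>r (f :: (nat \<Rightarrow> 'a \<Rightarrow>\<^sub>L real) \<Rightarrow> real) \<xi>. r * f \<xi>"
    by (rule real_linear_space_fun)
  have e_add: "e n (x + y) = e n x + e n y" for n x y
    by (auto simp: e_def fun_eq_iff blinfun.add_right)
  have e_scale: "e n (r *\<^sub>R x) = (\<lambda>\<xi>. r * e n x \<xi>)" for n r x
    by (auto simp: e_def fun_eq_iff blinfun.scaleR_right)
  have e_step: "e n x = e (Suc n) (B x)" for n x
  proof
    fix \<xi>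
    show "e n x \<xi> = e (Suc n) (B x) \<xi>"
    proof (cases "coherent \<xi>")
      case True
      then have "\<xi> n = \<xi> (Suc n) o\<^sub>L B" unfolding coherent_def by blast
      then show ?thesis using True by (simp add: e_def)
    qed (simp add: e_def)
  qed
  have sum_apply: "(\<Sum>i<N. e i (x i)) \<xi> = (\<Sum>i<N. e i (x i) \<xi>)" for N x \<xi>
    by (induction N) auto
  have chain: "\<xi> n = \<xi> (Suc n) o\<^sub>L B" if "\<And>n. \<psi> = \<xi> n o\<^sub>L bpow B (Suc n)" for \<psi> and \<xi> :: "nat \<Rightarrow> 'a \<Rightarrow>\<^sub>L real" and n
    by (rule compose_bpow_cancel[of _ "Suc n"]) (use that[of n] that[of "Suc n"] in \<open>simp add: blinfun_compose_assoc\<close>)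
  show thesis
    using e_add e_scale c
  proof (rule fn.bounded_decomposition_or_functional[of e c m y])
    fix N x assume *: "e m y = (\<Sum>i<N. e i (x i))" "(\<Sum>i<N. c i * norm (x i)) < 2"
    have "\<xi> m y = (\<Sum>i<N. \<xi> i (x i))" if "\<And>n. \<psi> = \<xi> n o\<^sub>L bpow B (Suc n)" for \<psi> and \<xi> :: "nat \<Rightarrow> 'a \<Rightarrow>\<^sub>L real"
    proof -
      have "e i z \<xi> = \<xi> i z" for i z
      proof -
        have "coherent \<xi>" unfolding coherent_def using chain[OF that] by blast
        then show ?thesis by (simp add: e_def)
      qed
      then show ?thesis
        using fun_cong[OF *(1), of \<xi>] by (simp add: sum_apply)
    qed
    then show thesis using that *(2) by blast
  next
    fix \<xi> :: "nat \<Rightarrow> 'a \<Rightarrow>\<^sub>L real" and g :: "((nat \<Rightarrow> 'a \<Rightarrow>\<^sub>L real) \<Rightarrow> real) \<Rightarrow> real"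
    assume *: "\<And>i x. \<xi> i x = g (e i x)" "\<And>i. norm (\<xi> i) \<le> c i" "1 < \<xi> m y"
    \<comment> \<open>Since \<xi> comes from a single functional \<open>g\<close>, the relation
      \<open>e_step\<close> makes it coherent. Its common composite
      \<open>\<xi> 0 o\<^sub>L B\<close> is the \<psi> to which \<open>bound\<close>
      applies.\<close>
    have step: "\<xi> n = \<xi> (Suc n) o\<^sub>L B" for n
      by (rule blinfun_eqI) (simp add: *(1) e_step[of n])
    have "\<xi> 0 o\<^sub>L B = \<xi> n o\<^sub>L bpow B (Suc n)" for n
    proof (induction n)
      case 0
      then show ?case by (auto intro: blinfun_eqI)
    next
      case (Suc n)
      then have "\<xi> 0 o\<^sub>L B = (\<xi> (Suc n) o\<^sub>L B) o\<^sub>L bpow B (Suc n)"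
        using step by metis
      then show ?case by (simp add: blinfun_compose_assoc)
    qed
    then show thesis
      using bound[of "\<xi> 0 o\<^sub>L B" \<xi>] * by simp
  qed
qed

end

section \<open>Scalars\<close>

definition scalar_embedding :: "'k::real_or_complex \<Rightarrow> complex" where
  "scalar_embedding = (SOME h. (\<forall>x y. h (x + y) = h x + h y) \<and> (\<forall>x y. h (x * y) = h x * h y) \<and>
     (\<forall>r x. h (r *\<^sub>R x) = r *\<^sub>R h x) \<and> (\<forall>x. norm (h x) = norm x) \<and>
     (range h = \<real> \<or> range h = UNIV))"

lemma scalar_embedding:
  fixes x y :: "'k::real_or_complex"
  shows "scalar_embedding (x + y) = scalar_embedding x + scalar_embedding y"
    and "scalar_embedding (x * y) = scalar_embedding x * scalar_embedding y"
    and "scalar_embedding (r *\<^sub>R x) = r *\<^sub>R scalar_embedding x"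
    and "norm (scalar_embedding x) = norm x"
    and "range (scalar_embedding :: 'k \<Rightarrow> complex) = \<real> \<or> range (scalar_embedding :: 'k \<Rightarrow> complex) = UNIV"
  using someI_ex[OF ex_embedding_complex[where 'a = 'k]] unfolding scalar_embedding_def by blast+

text \<open>The image of 1 is an idempotent complex number of modulus 1.\<close>

lemma scalar_embedding_one: "scalar_embedding (1 :: 'k::real_or_complex) = 1"
proof -
  have "scalar_embedding (1 :: 'k) * scalar_embedding (1 :: 'k) = scalar_embedding (1 :: 'k)"
    using scalar_embedding(2)[of "1 :: 'k" 1] by simp
  moreover have "scalar_embedding (1 :: 'k) \<noteq> 0"
    using scalar_embedding(4)[of "1 :: 'k"] by force
  ultimately show ?thesis by simp
qed

lemma scalar_embedding_diff:
  "scalar_embedding (x - y) = scalar_embedding x - scalar_embedding (y :: 'k::real_or_complex)"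
  using scalar_embedding(1)[of "x - y" y] by simp

lemma dist_scalar_embedding:
  "dist (scalar_embedding x) (scalar_embedding y) = dist x (y :: 'k::real_or_complex)"
  by (simp add: dist_norm scalar_embedding(4) flip: scalar_embedding_diff)

lemma scalar_embedding_eq_iff:
  "scalar_embedding x = scalar_embedding y \<longleftrightarrow> x = (y :: 'k::real_or_complex)"
  by (metis dist_eq_0_iff dist_scalar_embedding)

text \<open>The embedding is isometric with closed range, the real line or the whole plane, so
  completeness is inherited from \<open>complex\<close>.\<close>

lemma complete_scalars: "complete (UNIV :: 'k::real_or_complex set)"
proof (rule completeI)
  fix f :: "nat \<Rightarrow> 'k" assume "Cauchy f"
  then have "Cauchy (\<lambda>n. scalar_embedding (f n))"
    by (simp add: Cauchy_def dist_scalar_embedding)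
  then obtain z where z: "(\<lambda>n. scalar_embedding (f n)) \<longlonglongrightarrow> z"
    using Cauchy_convergent_iff convergent_def by blast
  have "closed (range (scalar_embedding :: 'k \<Rightarrow> complex))"
    using scalar_embedding(5)[where 'k = 'k] closed_complex_Reals by auto
  then have "z \<in> range (scalar_embedding :: 'k \<Rightarrow> complex)"
    by (rule closed_sequentially[OF _ _ z]) simp
  then obtain l :: 'k where l: "z = scalar_embedding l" by blast
  have "f \<longlonglongrightarrow> l"
    using z unfolding l tendsto_iff dist_scalar_embedding .
  then show "\<exists>l\<in>UNIV. f \<longlonglongrightarrow> l" by blast
qed

section \<open>Real parts of scalars\<close>

definition kre :: "'k::real_or_complex \<Rightarrow> real" where
  "kre x = Re (scalar_embedding x)"

lemma kre_add: "kre (x + y) = kre x + kre y"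
  by (simp add: kre_def scalar_embedding)

lemma kre_scaleR: "kre (r *\<^sub>R x) = r * kre x"
  by (simp add: kre_def scalar_embedding)

lemma kre_of_real: "kre (of_real r :: 'k::real_or_complex) = r"
  by (simp add: kre_def of_real_def scalar_embedding scalar_embedding_one)

lemma abs_kre_le: "\<bar>kre x\<bar> \<le> norm x"
  unfolding kre_def using abs_Re_le_cmod[of "scalar_embedding x"] scalar_embedding(4)[of x] by simp

lemma bounded_linear_kre: "bounded_linear kre"
  by (rule bounded_linear_intro[of _ 1]) (auto simp: kre_add kre_scaleR abs_kre_le)

lemma kre_sum: "kre (\<Sum>i\<in>I. f i) = (\<Sum>i\<in>I. kre (f i))"
  by (rule linear_sum[OF bounded_linear.linear[OF bounded_linear_kre]])

text \<open>For nonzero \<open>x\<close> the scalar is the inverse phase |x| / x.\<close>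

lemma kre_attains_norm:
  fixes x :: "'k::real_or_complex"
  obtains c :: 'k where "norm c \<le> 1" and "kre (c * x) = norm x"
proof (cases "x = 0")
  case True
  then show thesis using that[of 0] kre_of_real[of 0, where 'k = 'k] by simp
next
  case False
  then show thesis
    using that[of "of_real (norm x) * inverse x"] kre_of_real[of "norm x", where 'k = 'k]
    by (simp add: norm_mult norm_inverse mult.assoc)
qed

lemma kre_eqI:
  fixes x y :: "'k::real_or_complex"
  assumes "\<And>c. kre (c * x) = kre (c * y)"
  shows "x = y"
proof -
  obtain c where "kre (c * (x - y)) = norm (x - y)"
    by (rule kre_attains_norm)
  moreover have "kre (c * x) = kre (c * (x - y)) + kre (c * y)"
    by (simp flip: kre_add distrib_left)
  ultimately show ?thesis using assms[of c] by simp
qed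

text \<open>This is how a value in \<open>'k\<close> is recovered from a real-linear functional:
  with \<open>l c\<close> the real functional at c x, the scalar \<open>k\<close> becomes the value
  at x of the functional over \<open>'k\<close>.\<close>

lemma kre_represents:
  fixes l :: "'k::real_or_complex \<Rightarrow> real"
  assumes add: "\<And>x y. l (x + y) = l x + l y" and scale: "\<And>r x. l (r *\<^sub>R x) = r * l x"
  shows "\<exists>k. \<forall>c. l c = kre (c * k)"
  using scalar_embedding(5)[where 'k = 'k]
proof
  assume R: "range (scalar_embedding :: 'k \<Rightarrow> complex) = \<real>"
  have "l c = kre (c * of_real (l 1))" for c :: 'k
  proof -
    have "scalar_embedding c \<in> \<real>" using R by blast
    then have "scalar_embedding c = scalar_embedding (kre c *\<^sub>R (1 :: 'k))"
      by (simp add: scalar_embedding scalar_embedding_one kre_def complex_eq_iff complex_is_Real_iff)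
    then have "c = kre c *\<^sub>R 1"
      by (simp only: scalar_embedding_eq_iff)
    then have "l c = kre c * l 1" using scale by metis
    then show ?thesis by (simp add: kre_scaleR of_real_def mult.commute)
  qed
  then show ?thesis by blast
next
  assume C: "range (scalar_embedding :: 'k \<Rightarrow> complex) = UNIV"
  obtain j :: 'k where j: "scalar_embedding j = \<i>" using C by (metis UNIV_I imageE)
  \<comment> \<open>With j = i this is l(1) - i l(i), because the real part of (a + i b) (l(1) - i
    l(i)) is a l(1) + b l(i).\<close>
  obtain k :: 'k where k: "scalar_embedding k = Complex (l 1) (- l j)" using C by (metis UNIV_I imageE)
  have "l c = kre (c * k)" for c :: 'k
  proof -
    have "scalar_embedding c = scalar_embedding (Re (scalar_embedding c) *\<^sub>R (1 :: 'k) + Im (scalar_embedding c) *\<^sub>R j)"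
      by (simp add: scalar_embedding scalar_embedding_one j complex_eq_iff)
    then have "c = Re (scalar_embedding c) *\<^sub>R (1 :: 'k) + Im (scalar_embedding c) *\<^sub>R j"
      by (simp only: scalar_embedding_eq_iff)
    then have "l c = Re (scalar_embedding c) * l 1 + Im (scalar_embedding c) * l j"
      using add scale by metis
    then show ?thesis by (simp add: kre_def scalar_embedding k)
  qed
  then show ?thesis by blast
qed


section \<open>Topologies defined by seminorms\<close>

text \<open>Additive inverses are provided by the factor -1 together with
  \<open>scale_zero\<close>.\<close>

locale carrier_space =
  fixes V :: "('k::real_or_complex, 'v, 'z) vspace_scheme"
  assumes add_closed: "\<And>x y. x \<in> vcarrier V \<Longrightarrow> y \<in> vcarrier V \<Longrightarrow> vadd V x y \<in> vcarrier V"
    and zero_closed: "vzero V \<in> vcarrier V"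
    and scale_closed: "\<And>c x. x \<in> vcarrier V \<Longrightarrow> vscale V c x \<in> vcarrier V"
    and add_assoc: "\<And>x y z. x \<in> vcarrier V \<Longrightarrow> y \<in> vcarrier V \<Longrightarrow> z \<in> vcarrier V \<Longrightarrow>
      vadd V (vadd V x y) z = vadd V x (vadd V y z)"
    and add_commute: "\<And>x y. x \<in> vcarrier V \<Longrightarrow> y \<in> vcarrier V \<Longrightarrow> vadd V x y = vadd V y x"
    and add_zero: "\<And>x. x \<in> vcarrier V \<Longrightarrow> vadd V x (vzero V) = x"
    and scale_add: "\<And>c x y. x \<in> vcarrier V \<Longrightarrow> y \<in> vcarrier V \<Longrightarrow>
      vscale V c (vadd V x y) = vadd V (vscale V c x) (vscale V c y)"
    and add_scale: "\<And>c d x. x \<in> vcarrier V \<Longrightarrow> vscale V (c + d) x = vadd V (vscale V c x) (vscale V d x)"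
    and scale_scale: "\<And>c d x. x \<in> vcarrier V \<Longrightarrow> vscale V c (vscale V d x) = vscale V (c * d) x"
    and scale_one: "\<And>x. x \<in> vcarrier V \<Longrightarrow> vscale V 1 x = x"
    and scale_zero: "\<And>x. x \<in> vcarrier V \<Longrightarrow> vscale V 0 x = vzero V"
begin

lemma sub_closed: "x \<in> vcarrier V \<Longrightarrow> y \<in> vcarrier V \<Longrightarrow> vsub V x y \<in> vcarrier V"
  by (simp add: vsub_def add_closed scale_closed)

lemma add_left_commute:
  "x \<in> vcarrier V \<Longrightarrow> y \<in> vcarrier V \<Longrightarrow> z \<in> vcarrier V \<Longrightarrow>
    vadd V x (vadd V y z) = vadd V y (vadd V x z)"
  by (metis add_assoc add_commute)

lemma sub_self: "x \<in> vcarrier V \<Longrightarrow> vsub V x x = vzero V"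
  using add_scale[of x 1 "- 1"] by (simp add: vsub_def scale_one scale_zero)

lemma add_sub_self:
  assumes "x \<in> vcarrier V" and "y \<in> vcarrier V"
  shows "vadd V x (vsub V y x) = y"
proof -
  have "vadd V x (vsub V y x) = vadd V y (vsub V x x)"
    unfolding vsub_def using assms by (intro add_left_commute scale_closed)
  then show ?thesis using assms by (simp add: sub_self add_zero)
qed

lemma sub_add_add:
  assumes "x \<in> vcarrier V" "y \<in> vcarrier V" "x' \<in> vcarrier V" "y' \<in> vcarrier V"
  shows "vsub V (vadd V x y) (vadd V x' y') = vadd V (vsub V x x') (vsub V y y')"
  using assms by (simp add: vsub_def scale_add add_closed scale_closed add_assoc add_left_commute)

lemma zero_scale: "vscale V c (vzero V) = vzero V"
  using scale_scale[OF zero_closed, of c 0] by (simp add: scale_zero zero_closed)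

lemma zero_add: "x \<in> vcarrier V \<Longrightarrow> vadd V (vzero V) x = x"
  by (simp add: add_commute add_zero zero_closed)

lemma sub_zero: "x \<in> vcarrier V \<Longrightarrow> vsub V x (vzero V) = x"
  by (simp add: vsub_def zero_scale add_zero)

lemma sub_scale_scale:
  assumes "x \<in> vcarrier V" "y \<in> vcarrier V"
  shows "vsub V (vscale V c x) (vscale V d y) = vadd V (vscale V c (vsub V x y)) (vscale V (c - d) y)"
  using assms add_scale[of y "- c" "c - d"]
  by (simp add: vsub_def scale_add scale_scale scale_closed add_assoc)

lemma sub_triangle:
  assumes "x \<in> vcarrier V" "y \<in> vcarrier V" "z \<in> vcarrier V"
  shows "vsub V x z = vadd V (vsub V x y) (vsub V y z)"
proof -
  have "vadd V (vsub V x y) (vsub V y z) = vadd V (vscale V (- 1) y) (vadd V y (vadd V x (vscale V (- 1) z)))"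
    using assms by (simp add: vsub_def scale_closed add_closed add_assoc add_left_commute)
  also have "\<dots> = vadd V (vsub V y y) (vadd V x (vscale V (- 1) z))"
    using assms by (simp add: vsub_def scale_closed add_closed add_assoc add_left_commute)
  also have "\<dots> = vadd V x (vscale V (- 1) z)"
    using assms by (simp add: sub_self zero_add add_closed scale_closed)
  finally show ?thesis by (simp add: vsub_def)
qed

lemma sub_swap:
  assumes "x \<in> vcarrier V" "y \<in> vcarrier V"
  shows "vscale V (- 1) (vsub V x y) = vsub V y x"
  using assms by (simp add: vsub_def scale_add scale_scale scale_one scale_closed add_commute[of _ y])

text \<open>The opposite inequality is the given one for the inverse scalar at c x.\<close>

lemma homogeneousI:
  assumes le: "\<And>c x. x \<in> vcarrier V \<Longrightarrow> p (vscale V c x) \<le> norm c * p x"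
    and nonneg: "\<And>x. x \<in> vcarrier V \<Longrightarrow> 0 \<le> p x" and x: "x \<in> vcarrier V"
  shows "p (vscale V c x) = norm c * p x"
proof (cases "c = 0")
  case True
  then show ?thesis using le[OF x, of 0] nonneg[OF scale_closed[OF x], of 0] by simp
next
  case False
  then have "p x \<le> inverse (norm c) * p (vscale V c x)"
    using le[OF scale_closed[OF x], of "inverse c" c] x by (simp add: scale_scale scale_one norm_inverse)
  then have "norm c * p x \<le> p (vscale V c x)"
    using False by (simp add: field_simps)
  then show ?thesis using le[OF x, of c] by simp
qed

end

text \<open>One seminorm per neighborhood suffices because \<open>Q\<close> will be
  directed.\<close>

definition seminorm_open ::
    "('k::real_or_complex, 'v, 'z) vspace_scheme \<Rightarrow> ('v \<Rightarrow> real) set \<Rightarrow> 'v set \<Rightarrow> bool" where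
  "seminorm_open V Q U \<longleftrightarrow> U \<subseteq> vcarrier V \<and>
     (\<forall>x\<in>U. \<exists>p\<in>Q. \<exists>e>0. \<forall>y\<in>vcarrier V. p (vsub V y x) < e \<longrightarrow> y \<in> U)"

definition seminorm_topology ::
    "('k::real_or_complex, 'v, 'z) vspace_scheme \<Rightarrow> ('v \<Rightarrow> real) set \<Rightarrow> 'v topology" where
  "seminorm_topology V Q = topology (seminorm_open V Q)"

locale seminormed_space = carrier_space V
  for V :: "('k::real_or_complex, 'v, 'z) vspace_scheme" +
  fixes Q :: "('v \<Rightarrow> real) set"
  assumes seminorm_add: "\<And>p x y. p \<in> Q \<Longrightarrow> x \<in> vcarrier V \<Longrightarrow> y \<in> vcarrier V \<Longrightarrow>
      p (vadd V x y) \<le> p x + p y"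
    and seminorm_scale: "\<And>p c x. p \<in> Q \<Longrightarrow> x \<in> vcarrier V \<Longrightarrow> p (vscale V c x) = norm c * p x"
    and directed: "\<And>p q. p \<in> Q \<Longrightarrow> q \<in> Q \<Longrightarrow> \<exists>r\<in>Q. \<forall>x\<in>vcarrier V. p x \<le> r x \<and> q x \<le> r x"
    and nonempty: "Q \<noteq> {}"
begin

abbreviation "\<T> \<equiv> seminorm_topology V Q"

lemma seminorm_zero: "p \<in> Q \<Longrightarrow> p (vzero V) = 0"
  using seminorm_scale[of p "vzero V" 0] by (simp add: zero_scale zero_closed)

lemma seminorm_sub_swap: "p \<in> Q \<Longrightarrow> x \<in> vcarrier V \<Longrightarrow> y \<in> vcarrier V \<Longrightarrow> p (vsub V x y) = p (vsub V y x)"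
  using seminorm_scale[of p "vsub V x y" "- 1"] by (simp add: sub_swap sub_closed)

lemma seminorm_triangle:
  assumes "p \<in> Q" "x \<in> vcarrier V" "y \<in> vcarrier V" "z \<in> vcarrier V"
  shows "p (vsub V x z) \<le> p (vsub V x y) + p (vsub V y z)"
  using assms by (simp add: sub_triangle[of x y z] seminorm_add sub_closed)

lemma seminorm_nonneg: "p \<in> Q \<Longrightarrow> x \<in> vcarrier V \<Longrightarrow> 0 \<le> p x"
  using seminorm_triangle[of p x x "vzero V"] seminorm_triangle[of p "vzero V" x "vzero V"]
    seminorm_sub_swap[of p x "vzero V"]
  by (simp add: zero_closed sub_zero sub_self seminorm_zero)

lemma openin_seminorm_topology: "openin \<T> U \<longleftrightarrow> seminorm_open V Q U"
proof -
  have "istopology (seminorm_open V Q)"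
    unfolding istopology_def
  proof (intro conjI allI impI)
    fix S T assume S: "seminorm_open V Q S" and T: "seminorm_open V Q T"
    show "seminorm_open V Q (S \<inter> T)"
      unfolding seminorm_open_def
    proof (intro conjI ballI)
      show "S \<inter> T \<subseteq> vcarrier V"
        using S by (auto simp: seminorm_open_def)
      fix x assume x: "x \<in> S \<inter> T"
      obtain p e where p: "p \<in> Q" "e > 0" "\<And>y. y \<in> vcarrier V \<Longrightarrow> p (vsub V y x) < e \<Longrightarrow> y \<in> S"
        using S x unfolding seminorm_open_def by blast
      obtain q d where q: "q \<in> Q" "d > 0" "\<And>y. y \<in> vcarrier V \<Longrightarrow> q (vsub V y x) < d \<Longrightarrow> y \<in> T"
        using T x unfolding seminorm_open_def by blast
      obtain r where r: "r \<in> Q" "\<And>x. x \<in> vcarrier V \<Longrightarrow> p x \<le> r x \<and> q x \<le> r x"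
        using directed[OF p(1) q(1)] by blast
      have "x \<in> vcarrier V" using x S by (auto simp: seminorm_open_def)
      then have "y \<in> S \<inter> T" if "y \<in> vcarrier V" "r (vsub V y x) < min e d" for y
        using that r(2)[OF sub_closed[of y x]] p(3)[of y] q(3)[of y] by force
      then show "\<exists>p\<in>Q. \<exists>e>0. \<forall>y\<in>vcarrier V. p (vsub V y x) < e \<longrightarrow> y \<in> S \<inter> T"
        using r(1) p(2) q(2) by (intro bexI[of _ r] exI[of _ "min e d"]) auto
    qed
  next
    fix \<K> assume "\<forall>K\<in>\<K>. seminorm_open V Q K"
    then show "seminorm_open V Q (\<Union>\<K>)"
      unfolding seminorm_open_def by (meson Sup_least Union_iff)
  qed
  then show ?thesis
    by (simp add: seminorm_topology_def topology_inverse')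
qed

lemma topspace_seminorm_topology: "topspace \<T> = vcarrier V"
proof -
  obtain p where "p \<in> Q" using nonempty by blast
  then have "openin \<T> (vcarrier V)"
    unfolding openin_seminorm_topology seminorm_open_def by (auto intro: exI[of _ 1])
  then show ?thesis
    unfolding topspace_def openin_seminorm_topology seminorm_open_def by blast
qed

lemma openin_ball:
  assumes p: "p \<in> Q" and x: "x \<in> vcarrier V"
  shows "openin \<T> {y \<in> vcarrier V. p (vsub V y x) < e}"
  unfolding openin_seminorm_topology seminorm_open_def
proof (intro conjI ballI)
  fix y assume y: "y \<in> {y \<in> vcarrier V. p (vsub V y x) < e}"
  have "p (vsub V z x) < e" if "z \<in> vcarrier V" "p (vsub V z y) < e - p (vsub V y x)" for z
    using seminorm_triangle[OF p that(1) _ x, of y] y that by simp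
  then show "\<exists>p'\<in>Q. \<exists>d>0. \<forall>z\<in>vcarrier V. p' (vsub V z y) < d \<longrightarrow> z \<in> {y \<in> vcarrier V. p (vsub V y x) < e}"
    using y p by (intro bexI[of _ p] exI[of _ "e - p (vsub V y x)"]) auto
qed auto

lemma center_in_ball: "p \<in> Q \<Longrightarrow> x \<in> vcarrier V \<Longrightarrow> e > 0 \<Longrightarrow> x \<in> {y \<in> vcarrier V. p (vsub V y x) < e}"
  by (simp add: sub_self seminorm_zero)

lemma continuous_map_into:
  assumes range: "\<And>x. x \<in> topspace X \<Longrightarrow> f x \<in> vcarrier V"
    and nbhd: "\<And>x p e. x \<in> topspace X \<Longrightarrow> p \<in> Q \<Longrightarrow> e > 0 \<Longrightarrow>
      \<exists>U. openin X U \<and> x \<in> U \<and> (\<forall>y\<in>U. p (vsub V (f y) (f x)) < e)"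
  shows "continuous_map X \<T> f"
  unfolding continuous_map_def
proof (intro conjI allI impI)
  show "f \<in> topspace X \<rightarrow> topspace \<T>"
    using range by (auto simp: topspace_seminorm_topology)
  fix U assume U: "openin \<T> U"
  show "openin X {x \<in> topspace X. f x \<in> U}"
  proof (subst openin_subopen, intro ballI)
    fix x assume x: "x \<in> {x \<in> topspace X. f x \<in> U}"
    then obtain p e where p: "p \<in> Q" "e > 0" "\<And>y. y \<in> vcarrier V \<Longrightarrow> p (vsub V y (f x)) < e \<Longrightarrow> y \<in> U"
      using U unfolding openin_seminorm_topology seminorm_open_def by blast
    have "\<exists>U. openin X U \<and> x \<in> U \<and> (\<forall>y\<in>U. p (vsub V (f y) (f x)) < e)"
      by (rule nbhd) (use x p(1,2) in auto)
    then obtain T where T: "openin X T" "x \<in> T" "\<forall>y\<in>T. p (vsub V (f y) (f x)) < e"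
      by (elim exE conjE)
    have "T \<subseteq> {x \<in> topspace X. f x \<in> U}"
    proof
      fix y assume y: "y \<in> T"
      then have "y \<in> topspace X" using openin_subset[OF T(1)] by blast
      then show "y \<in> {x \<in> topspace X. f x \<in> U}"
        using T(3) y p(3) range by blast
    qed
    then show "\<exists>T. openin X T \<and> x \<in> T \<and> T \<subseteq> {x \<in> topspace X. f x \<in> U}"
      using T by blast
  qed
qed

lemma linear_topology_seminorm_topology: "linear_topology V \<T>"
  unfolding linear_topology_def
proof (intro conjI)
  show "topspace \<T> = vcarrier V" by (rule topspace_seminorm_topology)
  show "continuous_map (prod_topology \<T> \<T>) \<T> (\<lambda>(x, y). vadd V x y)"
  proof (rule continuous_map_into)
    fix z p and e :: real assume z: "z \<in> topspace (prod_topology \<T> \<T>)" and p: "p \<in> Q" and e: "e > 0"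
    obtain x y where xy: "z = (x, y)" "x \<in> vcarrier V" "y \<in> vcarrier V"
      using z by (auto simp: topspace_seminorm_topology)
    define d where "d = e / 2"
    have d: "d > 0" "e = d + d" using e by (auto simp: d_def)
    let ?B = "\<lambda>x. {y \<in> vcarrier V. p (vsub V y x) < d}"
    have "p (vsub V (vadd V x' y') (vadd V x y)) < e" if "x' \<in> ?B x" "y' \<in> ?B y" for x' y'
      using that xy seminorm_add[OF p sub_closed[of x' x] sub_closed[of y' y]]
      by (simp add: sub_add_add d)
    moreover have "openin (prod_topology \<T> \<T>) (?B x \<times> ?B y)"
      using openin_ball[OF p] xy by (simp add: openin_prod_Times_iff)
    ultimately show "\<exists>U. openin (prod_topology \<T> \<T>) U \<and> z \<in> U \<and>
        (\<forall>w\<in>U. p (vsub V (case w of (x, y) \<Rightarrow> vadd V x y) (case z of (x, y) \<Rightarrow> vadd V x y)) < e)"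
      using center_in_ball[OF p, of _ d] xy d(1) by (intro exI[of _ "?B x \<times> ?B y"]) auto
  qed (auto simp: topspace_seminorm_topology add_closed)
  show "continuous_map (prod_topology euclidean \<T>) \<T> (\<lambda>(c, x). vscale V c x)"
  proof (rule continuous_map_into)
    fix z p and e :: real
    assume z: "z \<in> topspace (prod_topology (euclidean :: 'k topology) \<T>)" and p: "p \<in> Q" and e: "e > 0"
    obtain c x where cx: "z = (c, x)" "x \<in> vcarrier V"
      using z by (auto simp: topspace_seminorm_topology)
    have px: "0 \<le> p x" using seminorm_nonneg[OF p cx(2)] .
    \<comment> \<open>Based on c' y - c x = c' (y - x) + (c' - c) x. The bound d \<le> 1 keeps the
      modulus of c' below that of c plus 1, the other bound makes the second term smaller than e /
      2, and \<open>b\<close> below serves the first term.\<close>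
    define d where "d = min 1 (e / (2 * (p x + 1)))"
    have d: "d > 0" "d \<le> 1" "d * p x < e / 2"
    proof -
      show "d > 0" "d \<le> 1" using e px by (auto simp: d_def)
      have "d * p x \<le> (e / (2 * (p x + 1))) * p x"
        using px by (intro mult_right_mono) (auto simp: d_def)
      also have "\<dots> < e / 2"
        using px e by (simp add: field_simps)
      finally show "d * p x < e / 2" .
    qed
    define b where "b = (e / 2) / (norm c + 1)"
    have b: "b > 0" "(norm c + 1) * b = e / 2"
    proof -
      have "norm c + 1 > 0" by (simp add: add_nonneg_pos)
      then show "b > 0" using e by (simp add: b_def)
      show "(norm c + 1) * b = e / 2"
        unfolding b_def using \<open>norm c + 1 > 0\<close>
        by (metis less_irrefl nonzero_mult_div_cancel_left times_divide_eq_right)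
    qed
    let ?B = "{y \<in> vcarrier V. p (vsub V y x) < b}"
    have "p (vsub V (vscale V c' y) (vscale V c x)) < e" if "c' \<in> ball c d" "y \<in> ?B" for c' y
    proof -
      have "norm (c' - c) < d" using that(1) by (simp add: dist_norm norm_minus_commute)
      then have c': "norm (c' - c) < d" "norm c' \<le> norm c + 1"
        using d norm_triangle_ineq2[of c' c] by auto
      have "p (vsub V (vscale V c' y) (vscale V c x)) \<le> norm c' * p (vsub V y x) + norm (c' - c) * p x"
        using that(2) cx seminorm_add[OF p scale_closed[OF sub_closed[of y x], of c'] scale_closed[of x "c' - c"]]
        by (simp add: sub_scale_scale seminorm_scale[OF p] sub_closed)
      also have "\<dots> \<le> (norm c + 1) * b + d * p x"
        using c' d(1) that(2) px cx seminorm_nonneg[OF p sub_closed[of y x]]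
        by (intro add_mono mult_mono) auto
      also have "\<dots> < e" using b d by simp
      finally show ?thesis .
    qed
    moreover have "openin (prod_topology euclidean \<T>) (ball c d \<times> ?B)"
      using openin_ball[OF p cx(2)] by (simp add: openin_prod_Times_iff)
    moreover have "z \<in> ball c d \<times> ?B"
      using center_in_ball[OF p cx(2) b(1)] d cx by auto
    ultimately show "\<exists>U. openin (prod_topology euclidean \<T>) U \<and> z \<in> U \<and>
        (\<forall>w\<in>U. p (vsub V (case w of (c, x) \<Rightarrow> vscale V c x) (case z of (c, x) \<Rightarrow> vscale V c x)) < e)"
      using cx by (intro exI[of _ "ball c d \<times> ?B"]) auto
  qed (auto simp: topspace_seminorm_topology scale_closed)
qed

lemma tvs_bounded_iff:
  "tvs_bounded (with_top V \<T>) M \<longleftrightarrow> M \<subseteq> vcarrier V \<and> (\<forall>p\<in>Q. \<exists>K. \<forall>x\<in>M. p x \<le> K)"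
proof (intro iffI conjI ballI)
  assume M: "tvs_bounded (with_top V \<T>) M"
  then show "M \<subseteq> vcarrier V" by (simp add: tvs_bounded_def with_top_def)
  fix p assume p: "p \<in> Q"
  let ?B = "{y \<in> vcarrier V. p (vsub V y (vzero V)) < 1}"
  obtain r where r: "r > 0" "\<And>c. norm c \<ge> r \<Longrightarrow> M \<subseteq> vscale V c ` ?B"
    using M openin_ball[OF p zero_closed, of 1] center_in_ball[OF p zero_closed, of 1]
    unfolding tvs_bounded_def with_top_def by auto
  have "p x \<le> r" if x: "x \<in> M" for x
  proof -
    have "M \<subseteq> vscale V (of_real r) ` ?B" using r by simp
    then obtain y where "y \<in> vcarrier V" "p y < 1" "x = vscale V (of_real r) y"
      using x by (auto simp: sub_zero)
    then show ?thesis using r p by (simp add: seminorm_scale mult_left_le)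
  qed
  then show "\<exists>K. \<forall>x\<in>M. p x \<le> K" by blast
next
  assume M: "M \<subseteq> vcarrier V \<and> (\<forall>p\<in>Q. \<exists>K. \<forall>x\<in>M. p x \<le> K)"
  show "tvs_bounded (with_top V \<T>) M"
    unfolding tvs_bounded_def
  proof (intro conjI allI impI)
    show "M \<subseteq> vcarrier (with_top V \<T>)" using M by (simp add: with_top_def)
    fix U assume "openin (vtop (with_top V \<T>)) U \<and> vzero (with_top V \<T>) \<in> U"
    then obtain p e where p: "p \<in> Q" "e > 0" "\<And>y. y \<in> vcarrier V \<Longrightarrow> p (vsub V y (vzero V)) < e \<Longrightarrow> y \<in> U"
      unfolding with_top_def by (auto simp: openin_seminorm_topology seminorm_open_def)
    obtain K where K: "\<And>x. x \<in> M \<Longrightarrow> p x \<le> K" using M p(1) by blast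
    \<comment> \<open>The summand 1 makes \<open>r\<close> positive and the resulting inequality
      p(x) < e r strict.\<close>
    define r where "r = (\<bar>K\<bar> + 1) / e"
    have r: "r > 0" using p(2) by (simp add: r_def)
    have "x \<in> vscale V c ` U" if c: "norm c \<ge> r" and x: "x \<in> M" for c :: 'k and x
    proof (rule image_eqI)
      have xV: "x \<in> vcarrier V" using x M by blast
      have c0: "c \<noteq> 0" using c r by auto
      show "x = vscale V c (vscale V (inverse c) x)"
        using xV c0 by (simp add: scale_scale scale_one)
      have "p (vscale V (inverse c) x) = p x / norm c"
        using xV p(1) by (simp add: seminorm_scale norm_inverse divide_inverse)
      also have "\<dots> < e"
      proof -
        have "p x < \<bar>K\<bar> + 1" using K[OF x] by simp
        also have "\<dots> = e * r" using p(2) by (simp add: r_def)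
        also have "\<dots> \<le> e * norm c" using c p(2) by simp
        finally show ?thesis using c0 by (simp add: field_simps)
      qed
      finally show "vscale V (inverse c) x \<in> U"
        using p(3)[of "vscale V (inverse c) x"] xV by (simp add: scale_closed sub_zero)
    qed
    then show "\<exists>r>0. \<forall>c. norm c \<ge> r \<longrightarrow> M \<subseteq> vscale (with_top V \<T>) c ` U"
      using r by (auto simp: with_top_def)
  qed
qed

lemma continuous_functional_iff:
  assumes f: "linear_map V scalars f"
  shows "continuous_map \<T> euclidean f \<longleftrightarrow> (\<exists>p\<in>Q. \<exists>K\<ge>0. \<forall>x\<in>vcarrier V. norm (f x) \<le> K * p x)"
proof
  have f_scale: "f (vscale V c x) = c * f x" if "x \<in> vcarrier V" for c x
    using f that by (simp add: linear_map_def scalars_def)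
  have f_add: "f (vadd V x y) = f x + f y" if "x \<in> vcarrier V" "y \<in> vcarrier V" for x y
    using f that by (simp add: linear_map_def scalars_def)
  have f_zero: "f (vzero V) = 0"
    using f_scale[OF zero_closed, of 0] by (simp add: zero_scale)
  {
    assume cont: "continuous_map \<T> euclidean f"
    have "openin \<T> {x \<in> topspace \<T>. f x \<in> ball 0 1}"
      by (rule openin_continuous_map_preimage[OF cont]) simp
    then obtain p e where p: "p \<in> Q" "e > 0"
      "\<And>y. y \<in> vcarrier V \<Longrightarrow> p (vsub V y (vzero V)) < e \<Longrightarrow> norm (f y) < 1"
      unfolding openin_seminorm_topology seminorm_open_def topspace_seminorm_topology
      using f_zero zero_closed by fastforce
    have "norm (f x) \<le> (1 / e) * p x" if x: "x \<in> vcarrier V" for x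
    proof (rule field_le_epsilon)
      fix d :: real assume d: "d > 0"
      have px: "0 \<le> p x" using seminorm_nonneg[OF p(1) x] .
      \<comment> \<open>The extra \<open>d\<close> permits division by \<open>t\<close> when p(x) =
        0 and puts x / t strictly inside the ball of radius \<open>e\<close>.\<close>
      define t where "t = p x / e + d"
      have t: "t > 0" using px p(2) d by (simp add: t_def add_nonneg_pos)
      have "p (vscale V (of_real (1 / t)) x) = (1 / t) * p x"
        using t by (simp only: seminorm_scale[OF p(1) x] norm_of_real) simp
      also have "\<dots> < e"
        using t p(2) d px by (simp add: t_def field_simps)
      finally have "p (vscale V (of_real (1 / t)) x) < e" .
      then have "norm (f (vscale V (of_real (1 / t)) x)) < 1"
        using p(3) x by (simp add: scale_closed sub_zero)
      then have "norm (f x) < t"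
        using t by (simp add: f_scale x norm_mult norm_divide field_simps)
      then show "norm (f x) \<le> (1 / e) * p x + d" by (simp add: t_def)
    qed
    then show "\<exists>p\<in>Q. \<exists>K\<ge>0. \<forall>x\<in>vcarrier V. norm (f x) \<le> K * p x"
      using p by (intro bexI[of _ p] exI[of _ "1 / e"]) auto
  }
  assume "\<exists>p\<in>Q. \<exists>K\<ge>0. \<forall>x\<in>vcarrier V. norm (f x) \<le> K * p x"
  then obtain p K where p: "p \<in> Q" and K: "0 \<le> K" and le: "\<And>x. x \<in> vcarrier V \<Longrightarrow> norm (f x) \<le> K * p x"
    by blast
  show "continuous_map \<T> euclidean f"
    unfolding continuous_map_def
  proof (intro conjI allI impI)
    fix U :: "'k set" assume U: "openin euclidean U"
    show "openin \<T> {x \<in> topspace \<T>. f x \<in> U}"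
      unfolding openin_seminorm_topology seminorm_open_def topspace_seminorm_topology
    proof (intro conjI ballI)
      fix x assume x: "x \<in> {x \<in> vcarrier V. f x \<in> U}"
      then obtain e where e: "e > 0" "ball (f x) e \<subseteq> U"
        using U by (auto simp: open_contains_ball)
      have "f y \<in> U" if y: "y \<in> vcarrier V" "p (vsub V y x) < e / (K + 1)" for y
      proof -
        have "f y - f x = f (vsub V y x)"
          using x y by (simp add: vsub_def f_add f_scale scale_closed)
        then have "norm (f y - f x) \<le> K * p (vsub V y x)"
          using le[OF sub_closed[of y x]] x y by simp
        also have "\<dots> \<le> K * (e / (K + 1))"
          using y K by (intro mult_left_mono) auto
        also have "\<dots> < e" using K e by (simp add: field_simps)
        finally show ?thesis using e(2) by (auto simp: dist_norm norm_minus_commute)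
      qed
      then show "\<exists>p\<in>Q. \<exists>e>0. \<forall>y\<in>vcarrier V. p (vsub V y x) < e \<longrightarrow> y \<in> {x \<in> vcarrier V. f x \<in> U}"
        using p K e by (intro bexI[of _ p] exI[of _ "e / (K + 1)"]) auto
    qed auto
  qed auto
qed

end

section \<open>Normed spaces and the topologies of the two limits\<close>

locale normed_carrier_space = carrier_space N
  for N :: "('k::real_or_complex, 'v) normed_vspace" +
  assumes norm_add_le: "\<And>x y. x \<in> vcarrier N \<Longrightarrow> y \<in> vcarrier N \<Longrightarrow>
      vnorm N (vadd N x y) \<le> vnorm N x + vnorm N y"
    and norm_scale_eq: "\<And>c x. x \<in> vcarrier N \<Longrightarrow> vnorm N (vscale N c x) = norm c * vnorm N x"
    and norm_zeroD: "\<And>x. x \<in> vcarrier N \<Longrightarrow> vnorm N x = 0 \<Longrightarrow> x = vzero N"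
begin

sublocale seminormed_space N "{vnorm N}"
  by unfold_locales (auto simp: norm_add_le norm_scale_eq)

lemma norm_zero_iff: "x \<in> vcarrier N \<Longrightarrow> vnorm N x = 0 \<longleftrightarrow> x = vzero N"
  using norm_zeroD seminorm_zero by auto

sublocale dist: Metric_space "vcarrier N" "ndist N"
proof
  show "0 \<le> ndist N x y" for x y
    by (simp add: ndist_def seminorm_nonneg sub_closed)
  show "ndist N x y = ndist N y x" for x y
    using seminorm_sub_swap[of "vnorm N" x y] by (simp add: ndist_def)
  show "ndist N x y = 0 \<longleftrightarrow> x = y" if "x \<in> vcarrier N" "y \<in> vcarrier N" for x y
  proof
    assume "ndist N x y = 0"
    then have "vsub N x y = vzero N"
      using that by (simp add: ndist_def norm_zero_iff sub_closed)
    then show "x = y"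
      using add_sub_self[OF that(2,1)] that by (simp add: add_zero)
  qed (use that in \<open>simp add: ndist_def sub_self seminorm_zero\<close>)
  show "ndist N x z \<le> ndist N x y + ndist N y z"
    if "x \<in> vcarrier N" "y \<in> vcarrier N" "z \<in> vcarrier N" for x y z
    using that seminorm_triangle[of "vnorm N" x y z] by (simp add: ndist_def)
qed

text \<open>Metric balls lie in the carrier by definition, where \<open>ndist\<close> is the norm of
  the difference; its default value 0 elsewhere never enters.\<close>

lemma norm_tvs_eq: "norm_tvs N = with_top N (seminorm_topology N {vnorm N})"
proof -
  have mball: "dist.mball x r = {y \<in> vcarrier N. vnorm N (vsub N y x) < r}" if "x \<in> vcarrier N" for x r
    using that seminorm_sub_swap[of "vnorm N" x] by (auto simp: dist.mball_def ndist_def)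
  have "openin dist.mtopology U \<longleftrightarrow> openin (seminorm_topology N {vnorm N}) U" for U
  proof (cases "U \<subseteq> vcarrier N")
    case True
    have "dist.mball x e \<subseteq> U \<longleftrightarrow> (\<forall>y\<in>vcarrier N. vnorm N (vsub N y x) < e \<longrightarrow> y \<in> U)" if "x \<in> U" for x e
      using mball[of x e] True that by auto
    then show ?thesis
      using True unfolding dist.openin_mtopology openin_seminorm_topology seminorm_open_def by auto
  next
    case False
    then show ?thesis
      unfolding dist.openin_mtopology openin_seminorm_topology seminorm_open_def by simp
  qed
  then have "dist.mtopology = \<T>"
    by (auto simp: topology_eq)
  then show ?thesis
    by (simp add: norm_tvs_def)
qed

end

lemma coarsest_topology_eqI:
  assumes "P T" and "\<And>T' U. P T' \<Longrightarrow> openin T U \<Longrightarrow> openin T' U"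
  shows "coarsest_topology P = T"
  unfolding coarsest_topology_def
proof (rule the_equality)
  fix T' assume "P T' \<and> (\<forall>T''. P T'' \<longrightarrow> (\<forall>U. openin T' U \<longrightarrow> openin T'' U))"
  then have "openin T' U \<longleftrightarrow> openin T U" for U
    using assms by blast
  then show "T' = T" by (simp add: topology_eq fun_eq_iff)
qed (use assms in blast)

lemma finest_topology_eqI:
  assumes "P T" and "\<And>T' U. P T' \<Longrightarrow> openin T' U \<Longrightarrow> openin T U"
  shows "finest_topology P = T"
  unfolding finest_topology_def
proof (rule the_equality)
  fix T' assume "P T' \<and> (\<forall>T''. P T'' \<longrightarrow> (\<forall>U. openin T'' U \<longrightarrow> openin T' U))"
  then have "openin T' U \<longleftrightarrow> openin T U" for U
    using assms by blast
  then show "T' = T" by (simp add: topology_eq fun_eq_iff)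
qed (use assms in blast)

locale normed_spectrum =
  fixes N :: "nat \<Rightarrow> ('k::real_or_complex, 'v) normed_vspace"
  assumes normed: "\<And>n. normed_carrier_space (N n)"
    and same_ops: "\<And>n. vadd (N n) = vadd (N 0)" "\<And>n. vzero (N n) = vzero (N 0)"
      "\<And>n. vscale (N n) = vscale (N 0)"
begin

definition "intersection = (norm_tvs (N 0))\<lparr>vcarrier := \<Inter>n. vcarrier (N n)\<rparr>"

text \<open>Partial sums turn the norms into an increasing sequence, hence a directed family that is
  also countable. Both properties are needed for completeness of the strong dual.\<close>

definition "sum_norm k x = (\<Sum>i\<le>k. vnorm (N i) x)"

lemma intersection_carrier: "vcarrier intersection = (\<Inter>n. vcarrier (N n))"
  by (simp add: intersection_def)

lemma intersection_ops:
  "vadd intersection = vadd (N n)"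
  "vzero intersection = vzero (N n)"
  "vscale intersection = vscale (N n)"
  using same_ops[of n] by (simp_all add: intersection_def norm_tvs_def with_top_def)

lemma in_carrier: "x \<in> vcarrier intersection \<Longrightarrow> x \<in> vcarrier (N n)"
  by (simp add: intersection_carrier)

lemma intersection_sub: "vsub intersection x y = vsub (N n) x y"
  by (simp add: vsub_def intersection_ops[of n])

lemma carrier_space_intersection: "carrier_space intersection"
proof -
  interpret N0: normed_carrier_space "N 0" by (rule normed)
  have *: "vadd (N 0) x y \<in> vcarrier (N n)" "vscale (N 0) c x \<in> vcarrier (N n)" "vzero (N 0) \<in> vcarrier (N n)"
    if "x \<in> vcarrier intersection" "y \<in> vcarrier intersection" for x y c n
  proof -
    interpret Nn: normed_carrier_space "N n" by (rule normed)
    show "vadd (N 0) x y \<in> vcarrier (N n)" "vscale (N 0) c x \<in> vcarrier (N n)" "vzero (N 0) \<in> vcarrier (N n)"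
      using that in_carrier Nn.add_closed Nn.scale_closed Nn.zero_closed same_ops[of n] by metis+
  qed
  have z: "vzero (N 0) \<in> vcarrier (N n)" for n
  proof -
    interpret Nn: normed_carrier_space "N n" by (rule normed)
    show ?thesis using Nn.zero_closed same_ops by metis
  qed
  show ?thesis
    using * z in_carrier[of _ 0]
    by unfold_locales (auto simp: intersection_carrier intersection_ops[of 0] N0.add_assoc N0.add_zero N0.scale_add
        N0.add_scale N0.scale_scale N0.scale_one N0.scale_zero intro: N0.add_commute)
qed

lemma sum_norm_mono:
  assumes "i \<le> j" and "x \<in> vcarrier intersection"
  shows "sum_norm i x \<le> sum_norm j x"
  unfolding sum_norm_def
proof (rule sum_mono2)
  fix n
  interpret Nn: normed_carrier_space "N n" by (rule normed)
  show "0 \<le> vnorm (N n) x" using Nn.seminorm_nonneg in_carrier assms by auto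
qed (use assms in auto)

sublocale seminormed_space intersection "range sum_norm"
proof -
  interpret carrier_space intersection by (rule carrier_space_intersection)
  show "seminormed_space intersection (range sum_norm)"
  proof
    fix p x y assume "p \<in> range sum_norm" and xy: "x \<in> vcarrier intersection" "y \<in> vcarrier intersection"
    then obtain k where k: "p = sum_norm k" by blast
    have "vnorm (N i) (vadd intersection x y) \<le> vnorm (N i) x + vnorm (N i) y" for i
      using normed_carrier_space.norm_add_le[OF normed[of i]] xy in_carrier
      by (simp add: intersection_ops[of i])
    then show "p (vadd intersection x y) \<le> p x + p y"
      by (simp add: k sum_norm_def sum_mono flip: sum.distrib)
  next
    fix p c x assume "p \<in> range sum_norm" and x: "x \<in> vcarrier intersection"
    then obtain k where k: "p = sum_norm k" by blast
    have "vnorm (N i) (vscale intersection c x) = norm c * vnorm (N i) x" for i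
      using normed_carrier_space.norm_scale_eq[OF normed[of i]] x in_carrier
      by (simp add: intersection_ops[of i])
    then show "p (vscale intersection c x) = norm c * p x"
      by (simp add: k sum_norm_def sum_distrib_left)
  next
    fix p q assume "p \<in> range sum_norm" "q \<in> range sum_norm"
    then obtain i j where ij: "p = sum_norm i" "q = sum_norm j" by blast
    then show "\<exists>r\<in>range sum_norm. \<forall>x\<in>vcarrier intersection. p x \<le> r x \<and> q x \<le> r x"
      by (intro bexI[of _ "sum_norm (max i j)"]) (auto intro: sum_norm_mono)
  qed simp
qed

lemma norm_le_sum_norm:
  assumes "i \<le> k" and "x \<in> vcarrier intersection"
  shows "vnorm (N i) x \<le> sum_norm k x"
proof -
  have "0 \<le> vnorm (N n) x" for n
  proof -
    interpret Nn: normed_carrier_space "N n" by (rule normed)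
    show ?thesis using Nn.seminorm_nonneg in_carrier assms(2) by auto
  qed
  then show ?thesis
    unfolding sum_norm_def using assms(1) by (intro member_le_sum) auto
qed

lemma proj_limit_eq:
  "proj_limit (\<lambda>n. norm_tvs (N n)) = with_top intersection (seminorm_topology intersection (range sum_norm))"
proof -
  have eq: "(norm_tvs (N 0))\<lparr>vcarrier := \<Inter>n. vcarrier (norm_tvs (N n))\<rparr> = intersection"
    by (simp add: intersection_def norm_tvs_def with_top_def)
  have "coarsest_topology (\<lambda>T. linear_topology intersection T \<and>
      (\<forall>n. continuous_map T (vtop (norm_tvs (N n))) (\<lambda>x. x))) = \<T>"
  proof (rule coarsest_topology_eqI)
    have "continuous_map \<T> (vtop (norm_tvs (N n))) (\<lambda>x. x)" for n
    proof -
      interpret Nn: normed_carrier_space "N n" by (rule normed)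
      have "continuous_map \<T> Nn.\<T> (\<lambda>x. x)"
      proof (rule Nn.continuous_map_into)
        fix x p and e :: real assume x: "x \<in> topspace \<T>" and p: "p \<in> {vnorm (N n)}" and e: "e > 0"
        have xc: "x \<in> vcarrier intersection" using x by (simp add: topspace_seminorm_topology)
        let ?B = "{y \<in> vcarrier intersection. sum_norm n (vsub intersection y x) < e}"
        have "p (vsub (N n) y x) < e" if y: "y \<in> ?B" for y
          using norm_le_sum_norm[of n n "vsub intersection y x"] y p xc sub_closed[of y x]
          by (simp add: intersection_sub[of _ _ n])
        then show "\<exists>U. openin \<T> U \<and> x \<in> U \<and> (\<forall>y\<in>U. p (vsub (N n) y x) < e)"
          using openin_ball[OF _ xc, of "sum_norm n" e] center_in_ball[OF _ xc e, of "sum_norm n"]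
          by (intro exI[of _ ?B]) blast
      qed (auto simp: topspace_seminorm_topology intro: in_carrier)
      then show ?thesis by (simp add: Nn.norm_tvs_eq with_top_def)
    qed
    then show "linear_topology intersection \<T> \<and> (\<forall>n. continuous_map \<T> (vtop (norm_tvs (N n))) (\<lambda>x. x))"
      using linear_topology_seminorm_topology by blast
  next
    fix T U assume T: "linear_topology intersection T \<and> (\<forall>n. continuous_map T (vtop (norm_tvs (N n))) (\<lambda>x. x))"
      and U: "openin \<T> U"
    have top: "topspace T = vcarrier intersection" using T by (simp add: linear_topology_def)
    show "openin T U"
    proof (subst openin_subopen, intro ballI)
      fix x assume x: "x \<in> U"
      then obtain p e where p: "p \<in> range sum_norm" "e > 0"
        "\<And>y. y \<in> vcarrier intersection \<Longrightarrow> p (vsub intersection y x) < e \<Longrightarrow> y \<in> U"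
        using U unfolding openin_seminorm_topology seminorm_open_def by blast
      have xc: "x \<in> vcarrier intersection"
        using x U unfolding openin_seminorm_topology seminorm_open_def by blast
      obtain k where k: "p = sum_norm k" using p(1) by blast
      \<comment> \<open>\<open>sum_norm k\<close> has k + 1 summands. Any admissible topology makes
        each of them smaller than \<open>d\<close> on a neighborhood, and finitely many
        neighborhoods are intersected.\<close>
      define d where "d = e / (real k + 1)"
      have d: "d > 0" using p(2) by (simp add: d_def)
      define B where "B i = {y \<in> topspace T. y \<in> {z \<in> vcarrier (N i). vnorm (N i) (vsub (N i) z x) < d}}" for i
      have B: "openin T (B i) \<and> x \<in> B i" for i
      proof
        interpret Ni: normed_carrier_space "N i" by (rule normed)
        have "vtop (norm_tvs (N i)) = Ni.\<T>"
          by (simp add: Ni.norm_tvs_eq with_top_def)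
        then have cont: "continuous_map T Ni.\<T> (\<lambda>x. x)"
          using T by metis
        show "openin T (B i)"
          unfolding B_def
          by (rule openin_continuous_map_preimage[OF cont Ni.openin_ball]) (use in_carrier[OF xc] in auto)
        show "x \<in> B i"
          unfolding B_def using Ni.center_in_ball[of "vnorm (N i)" x d] in_carrier[OF xc] d xc top by simp
      qed
      have "y \<in> U" if y: "y \<in> (\<Inter>i\<in>{..k}. B i)" for y
      proof -
        have "sum_norm k (vsub intersection y x) < (\<Sum>i\<le>k. d)"
          unfolding sum_norm_def
          by (rule sum_strict_mono) (use y in \<open>auto simp: B_def intersection_sub[symmetric]\<close>)
        also have "\<dots> = e" by (simp add: d_def add.commute[of 1])
        finally show ?thesis using p(3) k y top by (auto simp: B_def)
      qed
      moreover have "openin T (\<Inter>i\<in>{..k}. B i)"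
        using B by (intro openin_Inter) auto
      ultimately show "\<exists>T'. openin T T' \<and> x \<in> T' \<and> T' \<subseteq> U"
        using B by (intro exI[of _ "\<Inter>i\<in>{..k}. B i"]) auto
    qed
  qed
  then show ?thesis
    by (simp add: proj_limit_def eq with_top_def intersection_def norm_tvs_def Let_def)
qed

end


section \<open>Strong duals\<close>

lemma dual_vspace_simps:
  "vadd (dual_vspace E) f g = (\<lambda>x\<in>vcarrier E. f x + g x)"
  "vzero (dual_vspace E) = (\<lambda>x\<in>vcarrier E. 0)"
  "vscale (dual_vspace E) c f = (\<lambda>x\<in>vcarrier E. c * f x)"
  by (simp_all add: dual_vspace_def)

lemma vsub_dual_apply: "x \<in> vcarrier E \<Longrightarrow> vsub (dual_vspace E) f g x = f x - g x"
  by (simp add: vsub_def dual_vspace_simps)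

lemma dual_vspace_iff:
  "f \<in> vcarrier (dual_vspace E) \<longleftrightarrow> f \<in> extensional (vcarrier E) \<and>
    (\<forall>x\<in>vcarrier E. \<forall>y\<in>vcarrier E. f (vadd E x y) = f x + f y) \<and>
    (\<forall>c. \<forall>x\<in>vcarrier E. f (vscale E c x) = c * f x) \<and> continuous_map (vtop E) euclidean f"
  by (auto simp: dual_vspace_def linear_map_def scalars_def)

lemma carrier_space_dual:
  assumes "carrier_space E" and top: "topspace (vtop E) = vcarrier E"
  shows "carrier_space (dual_vspace E)"
proof -
  interpret carrier_space E by fact
  have cont: "continuous_map (vtop E) euclidean (restrict f (vcarrier E))"
    if "continuous_map (vtop E) euclidean f" for f :: "'b \<Rightarrow> 'a"
    by (rule continuous_map_eq[OF that]) (simp add: top)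
  show ?thesis
  proof
    fix f g :: "'b \<Rightarrow> 'a" and c d :: 'a
    assume f: "f \<in> vcarrier (dual_vspace E)"
    have "continuous_map (vtop E) euclidean (\<lambda>x. c * f x)"
      using f by (simp add: dual_vspace_iff continuous_map_atin tendsto_mult_left)
    then show "vscale (dual_vspace E) c f \<in> vcarrier (dual_vspace E)"
      using f cont unfolding dual_vspace_iff dual_vspace_simps
      by (auto simp: add_closed scale_closed algebra_simps)
    show "vadd (dual_vspace E) f (vzero (dual_vspace E)) = f"
      "vscale (dual_vspace E) 1 f = f"
      using f by (auto simp: dual_vspace_simps dual_vspace_iff extensional_def fun_eq_iff)
    show "vscale (dual_vspace E) (c + d) f = vadd (dual_vspace E) (vscale (dual_vspace E) c f) (vscale (dual_vspace E) d f)"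
      "vscale (dual_vspace E) c (vscale (dual_vspace E) d f) = vscale (dual_vspace E) (c * d) f"
      "vscale (dual_vspace E) 0 f = vzero (dual_vspace E)"
      by (auto simp: dual_vspace_simps fun_eq_iff algebra_simps)
    assume g: "g \<in> vcarrier (dual_vspace E)"
    have "continuous_map (vtop E) euclidean (\<lambda>x. f x + g x)"
      using f g by (auto simp: dual_vspace_iff intro: continuous_map_add)
    then show "vadd (dual_vspace E) f g \<in> vcarrier (dual_vspace E)"
      using f g cont unfolding dual_vspace_iff dual_vspace_simps
      by (auto simp: add_closed scale_closed algebra_simps)
    show "vscale (dual_vspace E) c (vadd (dual_vspace E) f g) =
        vadd (dual_vspace E) (vscale (dual_vspace E) c f) (vscale (dual_vspace E) c g)"
      by (auto simp: dual_vspace_simps fun_eq_iff algebra_simps)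
  next
    have "continuous_map (vtop E) euclidean (\<lambda>x. 0 :: 'a)" by simp
    from cont[OF this] show "vzero (dual_vspace E) \<in> vcarrier (dual_vspace E)"
      unfolding dual_vspace_iff dual_vspace_simps by (auto simp: add_closed scale_closed)
  qed (auto simp: dual_vspace_simps fun_eq_iff algebra_simps)
qed

text \<open>Zero is adjoined so that the supremum makes sense for empty \<open>B\<close>. Linear
  functionals vanish there, so the value is otherwise unaffected.\<close>

definition dual_seminorm :: "('k::real_or_complex, 'v) top_vspace \<Rightarrow> 'v set \<Rightarrow> ('v \<Rightarrow> 'k) \<Rightarrow> real" where
  "dual_seminorm E B f = (SUP x\<in>insert (vzero E) B. norm (f x))"

definition dual_seminorms :: "('k::real_or_complex, 'v) top_vspace \<Rightarrow> (('v \<Rightarrow> 'k) \<Rightarrow> real) set" where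
  "dual_seminorms E = {dual_seminorm E B | B. tvs_bounded E B}"

lemma carrier_space_with_top:
  assumes "carrier_space V"
  shows "carrier_space (with_top V T)"
  using assms unfolding carrier_space_def with_top_def vspace.simps .

context seminormed_space
begin

definition "tvs = with_top V \<T>"

lemma tvs_simps:
  "vcarrier tvs = vcarrier V" "vadd tvs = vadd V" "vzero tvs = vzero V" "vscale tvs = vscale V"
  "vtop tvs = \<T>"
  by (simp_all add: tvs_def with_top_def)

lemma carrier_space_dual_tvs: "carrier_space (dual_vspace tvs)"
  unfolding tvs_def
  by (rule carrier_space_dual[OF carrier_space_with_top[OF carrier_space_axioms]])
    (simp add: with_top_def topspace_seminorm_topology)

lemma dual_tvs_iff:
  "f \<in> vcarrier (dual_vspace tvs) \<longleftrightarrow> f \<in> extensional (vcarrier V) \<and>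
    (\<forall>x\<in>vcarrier V. \<forall>y\<in>vcarrier V. f (vadd V x y) = f x + f y) \<and>
    (\<forall>c. \<forall>x\<in>vcarrier V. f (vscale V c x) = c * f x) \<and>
    (\<exists>p\<in>Q. \<exists>K\<ge>0. \<forall>x\<in>vcarrier V. norm (f x) \<le> K * p x)"
proof (cases "linear_map V scalars f")
  case True
  then show ?thesis
    using continuous_functional_iff[OF True]
    unfolding dual_vspace_iff tvs_simps by (auto simp: linear_map_def scalars_def)
next
  case False
  then show ?thesis
    unfolding dual_vspace_iff tvs_simps by (auto simp: linear_map_def scalars_def)
qed

lemma dual_zero_apply: "f \<in> vcarrier (dual_vspace tvs) \<Longrightarrow> f (vzero V) = 0"
proof -
  assume "f \<in> vcarrier (dual_vspace tvs)"
  then have "f (vscale V 0 (vzero V)) = 0 * f (vzero V)"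
    using zero_closed unfolding dual_tvs_iff by blast
  then show ?thesis by (simp add: zero_scale)
qed

lemma bdd_above_dual:
  assumes "tvs_bounded tvs B" and f: "f \<in> vcarrier (dual_vspace tvs)"
  shows "bdd_above ((\<lambda>x. norm (f x)) ` insert (vzero tvs) B)"
proof -
  obtain p K where p: "p \<in> Q" "K \<ge> 0" "\<And>x. x \<in> vcarrier V \<Longrightarrow> norm (f x) \<le> K * p x"
    using f unfolding dual_tvs_iff by blast
  obtain L where L: "\<And>x. x \<in> B \<Longrightarrow> p x \<le> L" and B: "B \<subseteq> vcarrier V"
    using assms(1) p(1) unfolding tvs_def tvs_bounded_iff by blast
  have "norm (f x) \<le> max 0 (K * L)" if x: "x \<in> insert (vzero tvs) B" for x
  proof (cases "x = vzero V")
    case True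
    then show ?thesis using dual_zero_apply[OF f] by simp
  next
    case False
    then have xB: "x \<in> B" using x by (simp add: tvs_simps)
    then have "norm (f x) \<le> K * p x" using p(3) B by blast
    also have "\<dots> \<le> K * L" using L[OF xB] p(2) by (rule mult_left_mono)
    finally show ?thesis by simp
  qed
  then show ?thesis by (auto intro!: bdd_aboveI)
qed

lemma dual_seminorm_upper:
  assumes "tvs_bounded tvs B" "f \<in> vcarrier (dual_vspace tvs)" "x \<in> insert (vzero tvs) B"
  shows "norm (f x) \<le> dual_seminorm tvs B f"
  unfolding dual_seminorm_def by (rule cSUP_upper[OF assms(3) bdd_above_dual[OF assms(1,2)]])

lemma dual_seminorm_least:
  assumes "\<And>x. x \<in> insert (vzero tvs) B \<Longrightarrow> norm (f x) \<le> r"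
  shows "dual_seminorm tvs B f \<le> r"
  unfolding dual_seminorm_def by (rule cSUP_least) (use assms in auto)

lemma bounded_carrier:
  assumes "tvs_bounded tvs B" "x \<in> insert (vzero tvs) B"
  shows "x \<in> vcarrier V"
  using assms zero_closed unfolding tvs_bounded_def tvs_simps by auto

lemma seminormed_space_dual: "seminormed_space (dual_vspace tvs) (dual_seminorms tvs)"
proof -
  interpret D: carrier_space "dual_vspace tvs" by (rule carrier_space_dual_tvs)
  show "seminormed_space (dual_vspace tvs) (dual_seminorms tvs)"
  proof
    fix p f g assume p: "p \<in> dual_seminorms tvs" and f: "f \<in> vcarrier (dual_vspace tvs)"
      and g: "g \<in> vcarrier (dual_vspace tvs)"
    obtain B where B: "p = dual_seminorm tvs B" "tvs_bounded tvs B"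
      using p by (auto simp: dual_seminorms_def)
    show "p (vadd (dual_vspace tvs) f g) \<le> p f + p g"
      unfolding B(1)
    proof (rule dual_seminorm_least)
      fix x assume x: "x \<in> insert (vzero tvs) B"
      have "norm (f x + g x) \<le> dual_seminorm tvs B f + dual_seminorm tvs B g"
        using dual_seminorm_upper[OF B(2) f x] dual_seminorm_upper[OF B(2) g x] norm_triangle_ineq[of "f x" "g x"]
        by linarith
      then show "norm (vadd (dual_vspace tvs) f g x) \<le> dual_seminorm tvs B f + dual_seminorm tvs B g"
        using bounded_carrier[OF B(2) x] by (simp add: dual_vspace_simps tvs_simps)
    qed
  next
    fix p c f assume p: "p \<in> dual_seminorms tvs" and f: "f \<in> vcarrier (dual_vspace tvs)"
    obtain B where B: "p = dual_seminorm tvs B" "tvs_bounded tvs B"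
      using p by (auto simp: dual_seminorms_def)
    show "p (vscale (dual_vspace tvs) c f) = norm c * p f"
    proof (rule D.homogeneousI[OF _ _ f])
      fix c f assume f: "f \<in> vcarrier (dual_vspace tvs)"
      show "p (vscale (dual_vspace tvs) c f) \<le> norm c * p f"
        unfolding B(1)
      proof (rule dual_seminorm_least)
        fix x assume x: "x \<in> insert (vzero tvs) B"
        have "norm (c * f x) \<le> norm c * dual_seminorm tvs B f"
          using dual_seminorm_upper[OF B(2) f x] by (simp add: norm_mult mult_left_mono)
        then show "norm (vscale (dual_vspace tvs) c f x) \<le> norm c * dual_seminorm tvs B f"
          using bounded_carrier[OF B(2) x] by (simp add: dual_vspace_simps tvs_simps)
      qed
      show "0 \<le> p f"
        unfolding B(1)
        by (rule order_trans[OF norm_ge_zero dual_seminorm_upper[OF B(2) f, of "vzero tvs"]]) simp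
    qed
  next
    fix p q assume p: "p \<in> dual_seminorms tvs" and q: "q \<in> dual_seminorms tvs"
    obtain A where A: "p = dual_seminorm tvs A" "tvs_bounded tvs A"
      using p by (auto simp: dual_seminorms_def)
    obtain B where B: "q = dual_seminorm tvs B" "tvs_bounded tvs B"
      using q by (auto simp: dual_seminorms_def)
    have AB: "tvs_bounded tvs (A \<union> B)" by (rule tvs_bounded_Un[OF A(2) B(2)])
    show "\<exists>r\<in>dual_seminorms tvs. \<forall>f\<in>vcarrier (dual_vspace tvs). p f \<le> r f \<and> q f \<le> r f"
    proof (rule bexI[of _ "dual_seminorm tvs (A \<union> B)"])
      show "\<forall>f\<in>vcarrier (dual_vspace tvs). p f \<le> dual_seminorm tvs (A \<union> B) f \<and> q f \<le> dual_seminorm tvs (A \<union> B) f"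
        unfolding A(1) B(1) by (auto intro!: dual_seminorm_least dual_seminorm_upper[OF AB])
      show "dual_seminorm tvs (A \<union> B) \<in> dual_seminorms tvs"
        using AB by (auto simp: dual_seminorms_def)
    qed
  next
    have "tvs_bounded tvs {}"
      unfolding tvs_bounded_def by (auto intro: exI[of _ 1])
    then show "dual_seminorms tvs \<noteq> {}" by (auto simp: dual_seminorms_def)
  qed
qed

lemma strong_dual_eq:
  "strong_dual tvs = with_top (dual_vspace tvs) (seminorm_topology (dual_vspace tvs) (dual_seminorms tvs))"
proof -
  interpret dual: carrier_space "dual_vspace tvs" by (rule carrier_space_dual_tvs)
  have "strong_dual_open tvs U \<longleftrightarrow> seminorm_open (dual_vspace tvs) (dual_seminorms tvs) U" for U
  proof
    assume U: "strong_dual_open tvs U"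
    show "seminorm_open (dual_vspace tvs) (dual_seminorms tvs) U"
      unfolding seminorm_open_def
    proof (intro conjI ballI)
      show UD: "U \<subseteq> vcarrier (dual_vspace tvs)"
        using U unfolding strong_dual_open_def by blast
      fix f assume f: "f \<in> U"
      obtain B e where B: "tvs_bounded tvs B" "e > 0" "strong_dual_nbhd tvs f B e \<subseteq> U"
        using U f unfolding strong_dual_open_def by blast
      have "g \<in> U" if g: "g \<in> vcarrier (dual_vspace tvs)" "dual_seminorm tvs B (vsub (dual_vspace tvs) g f) < e" for g
      proof -
        have "norm (g x - f x) \<le> e" if x: "x \<in> B" for x
          using dual_seminorm_upper[OF B(1) dual.sub_closed[of g f], of x] x f UD g
            bounded_carrier[OF B(1), of x]
          by (auto simp: vsub_dual_apply tvs_simps)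
        then show ?thesis
          using B(3) g(1) by (auto simp: strong_dual_nbhd_def)
      qed
      then show "\<exists>p\<in>dual_seminorms tvs. \<exists>e>0. \<forall>g\<in>vcarrier (dual_vspace tvs). p (vsub (dual_vspace tvs) g f) < e \<longrightarrow> g \<in> U"
        using B by (intro bexI[of _ "dual_seminorm tvs B"] exI[of _ e]) (auto simp: dual_seminorms_def)
    qed
  next
    assume U: "seminorm_open (dual_vspace tvs) (dual_seminorms tvs) U"
    show "strong_dual_open tvs U"
      unfolding strong_dual_open_def
    proof (intro conjI ballI)
      show UD: "U \<subseteq> vcarrier (dual_vspace tvs)"
        using U unfolding seminorm_open_def by blast
      fix f assume f: "f \<in> U"
      obtain B e where B: "tvs_bounded tvs B" "e > 0"
        "\<And>g. g \<in> vcarrier (dual_vspace tvs) \<Longrightarrow> dual_seminorm tvs B (vsub (dual_vspace tvs) g f) < e \<Longrightarrow> g \<in> U"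
        using U f unfolding seminorm_open_def dual_seminorms_def by blast
      \<comment> \<open>The halving reconciles the weak inequality in
        \<open>strong_dual_nbhd\<close> with the strict one in \<open>seminorm_open\<close>.\<close>
      have "strong_dual_nbhd tvs f B (e / 2) \<subseteq> U"
      proof
        fix g assume g: "g \<in> strong_dual_nbhd tvs f B (e / 2)"
        have "dual_seminorm tvs B (vsub (dual_vspace tvs) g f) \<le> e / 2"
        proof (rule dual_seminorm_least)
          fix x assume x: "x \<in> insert (vzero tvs) B"
          have "norm (g x - f x) \<le> e / 2"
          proof (cases "x = vzero V")
            case True
            then show ?thesis
              using dual_zero_apply[of f] dual_zero_apply[of g] f g UD B(2)
              by (auto simp: strong_dual_nbhd_def)
          next
            case False
            then show ?thesis using x g by (auto simp: strong_dual_nbhd_def tvs_simps)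
          qed
          then show "norm (vsub (dual_vspace tvs) g f x) \<le> e / 2"
            using bounded_carrier[OF B(1) x] by (simp add: vsub_dual_apply tvs_simps)
        qed
        then show "g \<in> U"
          using B(2,3) g by (auto simp: strong_dual_nbhd_def)
      qed
      then show "\<exists>B e. tvs_bounded tvs B \<and> e > 0 \<and> strong_dual_nbhd tvs f B e \<subseteq> U"
        using B by (intro exI[of _ B] exI[of _ "e / 2"]) auto
    qed
  qed
  then have "topology (strong_dual_open tvs) = seminorm_topology (dual_vspace tvs) (dual_seminorms tvs)"
    unfolding seminorm_topology_def by presburger
  then show ?thesis by (simp add: strong_dual_def)
qed

lemma tvs_bounded_singleton: "x \<in> vcarrier V \<Longrightarrow> tvs_bounded tvs {x}"
  unfolding tvs_def tvs_bounded_iff by auto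

text \<open>Metrizability enters here: a functional unbounded on all neighborhoods of zero is unbounded
  along a null sequence.\<close>

lemma bounded_functional_continuous:
  fixes f :: "'v \<Rightarrow> 'k" and q :: "nat \<Rightarrow> 'v \<Rightarrow> real"
  assumes Q: "Q = range q" and mono: "\<And>i j x. i \<le> j \<Longrightarrow> x \<in> vcarrier V \<Longrightarrow> q i x \<le> q j x"
    and f_scale: "\<And>c x. x \<in> vcarrier V \<Longrightarrow> f (vscale V c x) = c * f x"
    and bounded: "\<And>B. tvs_bounded tvs B \<Longrightarrow> \<exists>K. \<forall>x\<in>B. norm (f x) \<le> K"
  shows "\<exists>p\<in>Q. \<exists>K\<ge>0. \<forall>x\<in>vcarrier V. norm (f x) \<le> K * p x"
proof (rule ccontr)
  assume neg: "\<not> ?thesis"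
  have "\<exists>x\<in>vcarrier V. norm (f x) > real n * q n x" for n :: nat
  proof (rule ccontr)
    assume "\<not> (\<exists>x\<in>vcarrier V. norm (f x) > real n * q n x)"
    then have "\<forall>x\<in>vcarrier V. norm (f x) \<le> real n * q n x" by (auto simp: not_less)
    then show False using neg Q by (meson of_nat_0_le_iff rangeI)
  qed
  then obtain x where x: "\<And>n. x n \<in> vcarrier V" "\<And>n. norm (f (x n)) > real n * q n (x n)"
    by metis
  have q_nonneg: "0 \<le> q n (x n)" for n
    using seminorm_nonneg x(1) Q by auto
  have fx: "f (x n) \<noteq> 0" for n
    using x(2)[of n] q_nonneg[of n] by (metis mult_nonneg_nonneg norm_zero not_less of_nat_0_le_iff)
  \<comment> \<open>Normalized so that f(y n) = n, while the choice of \<open>x n\<close> keeps q n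
    (y n) at most 1.\<close>
  define y where "y n = vscale V (of_nat n / f (x n)) (x n)" for n
  have yV: "y n \<in> vcarrier V" for n using x by (simp add: y_def scale_closed)
  have fy: "f (y n) = of_nat n" for n using x fx by (simp add: y_def f_scale)
  have qy: "q n (y n) \<le> 1" for n
  proof -
    have "q n (y n) = (real n / norm (f (x n))) * q n (x n)"
      unfolding y_def using Q x(1) by (simp add: seminorm_scale norm_divide)
    then have "q n (y n) = (real n * q n (x n)) / norm (f (x n))" by simp
    then show ?thesis using x(2)[of n] fx[of n] by simp
  qed
  have "tvs_bounded tvs (range y)"
    unfolding tvs_def tvs_bounded_iff
  proof (intro conjI ballI)
    show "range y \<subseteq> vcarrier V" using yV by auto
    fix p assume "p \<in> Q"
    then obtain k where k: "p = q k" using Q by blast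
    have nn: "0 \<le> q k (y n)" for n using seminorm_nonneg yV Q by auto
    \<comment> \<open>From index \<open>k\<close> on, q k is below q n and hence at most 1 at y n;
      the finitely many earlier terms are covered by the sum.\<close>
    have "p (y n) \<le> 1 + (\<Sum>m<k. q k (y m))" for n
    proof (cases "n < k")
      case True
      then have "q k (y n) \<le> (\<Sum>m<k. q k (y m))"
        by (intro member_le_sum) (use nn in auto)
      then show ?thesis by (simp add: k)
    next
      case False
      then have "q k (y n) \<le> 1"
        using mono[of k n "y n"] yV qy[of n] by (meson not_less order_trans)
      then show ?thesis using sum_nonneg[of "{..<k}" "\<lambda>m. q k (y m)"] nn k by auto
    qed
    then show "\<exists>K. \<forall>x\<in>range y. p x \<le> K" by blast
  qed
  then obtain K where "\<And>n. norm (f (y n)) \<le> K" using bounded by blast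
  then have "real n \<le> K" for n by (simp add: fy)
  then show False using reals_Archimedean2[of K] by (meson not_less)
qed

text \<open>A Cauchy filter converges pointwise, uniformly on bounded sets. The limit is bounded on
  bounded sets, being uniformly close to a member of the filter on each, and
  \<open>bounded_functional_continuous\<close> makes it continuous.\<close>

lemma tvs_complete_strong_dual:
  fixes q :: "nat \<Rightarrow> 'v \<Rightarrow> real"
  assumes Q: "Q = range q" and mono: "\<And>i j x. i \<le> j \<Longrightarrow> x \<in> vcarrier V \<Longrightarrow> q i x \<le> q j x"
  shows "tvs_complete (strong_dual tvs)"
  unfolding tvs_complete_def
proof (intro allI impI)
  let ?D = "dual_vspace tvs"
  interpret dual: seminormed_space ?D "dual_seminorms tvs" by (rule seminormed_space_dual)
  fix F assume F: "F \<noteq> bot \<and> tvs_cauchy_filter (strong_dual tvs) F"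
  have evD: "eventually (\<lambda>g. g \<in> vcarrier ?D) F"
    using F by (simp add: tvs_cauchy_filter_def strong_dual_eq with_top_def)
  have uniform: "\<exists>P. eventually P F \<and> (\<forall>g h. P g \<longrightarrow> P h \<longrightarrow>
      g \<in> vcarrier ?D \<and> h \<in> vcarrier ?D \<and> (\<forall>x\<in>B. norm (g x - h x) < e))"
    if B: "tvs_bounded tvs B" and e: "e > 0" for B e
  proof -
    have BD: "dual_seminorm tvs B \<in> dual_seminorms tvs" using B by (auto simp: dual_seminorms_def)
    let ?U = "{g \<in> vcarrier ?D. dual_seminorm tvs B (vsub ?D g (vzero ?D)) < e}"
    have "openin (vtop (strong_dual tvs)) ?U" "vzero (strong_dual tvs) \<in> ?U"
      using dual.openin_ball[OF BD dual.zero_closed, of e] dual.center_in_ball[OF BD dual.zero_closed e]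
      by (simp_all add: strong_dual_eq with_top_def)
    then have "eventually (\<lambda>(g, h). vsub (strong_dual tvs) g h \<in> ?U) (F \<times>\<^sub>F F)"
      using F unfolding tvs_cauchy_filter_def by blast
    then obtain P where P: "eventually P F" "\<And>g h. P g \<Longrightarrow> P h \<Longrightarrow> vsub (strong_dual tvs) g h \<in> ?U"
      unfolding eventually_prod_same by auto
    have sub: "vsub (strong_dual tvs) = vsub ?D"
      by (simp add: fun_eq_iff vsub_def strong_dual_eq with_top_def)
    show ?thesis
    proof (intro exI[of _ "\<lambda>g. P g \<and> g \<in> vcarrier ?D"] conjI allI impI ballI)
      show "eventually (\<lambda>g. P g \<and> g \<in> vcarrier ?D) F"
        using P(1) evD by (rule eventually_conj)
      fix g h x assume g: "P g \<and> g \<in> vcarrier ?D" and h: "P h \<and> h \<in> vcarrier ?D" and x: "x \<in> B"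
      have "dual_seminorm tvs B (vsub ?D g h) < e"
        using P(2)[of g h] g h by (simp add: sub dual.sub_zero dual.sub_closed)
      moreover have "norm (vsub ?D g h x) \<le> dual_seminorm tvs B (vsub ?D g h)"
        by (rule dual_seminorm_upper[OF B dual.sub_closed]) (use g h x in auto)
      ultimately show "norm (g x - h x) < e"
        using bounded_carrier[OF B, of x] x by (simp add: vsub_dual_apply tvs_simps)
    qed auto
  qed
  have "\<exists>l. ((\<lambda>g. g x) \<longlongrightarrow> l) F" if x: "x \<in> vcarrier V" for x
  proof -
    have "cauchy_filter (filtermap (\<lambda>g. g x) F)"
      unfolding cauchy_filter_metric_filtermap
    proof (intro allI impI)
      fix e :: real assume "e > 0"
      then show "\<exists>P. eventually P F \<and> (\<forall>g h. P g \<and> P h \<longrightarrow> dist (g x) (h x) < e)"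
        using uniform[OF tvs_bounded_singleton[OF x]] unfolding dist_norm by (metis singletonI)
    qed
    moreover have "filtermap (\<lambda>g. g x) F \<noteq> bot"
      using F by (simp add: filtermap_bot_iff)
    ultimately have "\<exists>l. filtermap (\<lambda>g. g x) F \<le> nhds l"
      using cauchy_filter_complete_converges[OF _ complete_scalars, of "filtermap (\<lambda>g. g x) F"] by simp
    then show ?thesis by (simp add: filterlim_def)
  qed
  then obtain l0 where l0: "\<And>x. x \<in> vcarrier V \<Longrightarrow> ((\<lambda>g. g x) \<longlongrightarrow> l0 x) F"
    by metis
  define l where "l = restrict l0 (vcarrier V)"
  have l: "((\<lambda>g. g x) \<longlongrightarrow> l x) F" if "x \<in> vcarrier V" for x
    using l0[OF that] that by (simp add: l_def)
  have Fne: "F \<noteq> bot" using F by blast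
  \<comment> \<open>One of the two functionals in the Cauchy estimate is sent to the limit along
    \<open>F\<close>, which weakens < to \<le>.\<close>
  have close: "norm (g x - l x) \<le> e"
    if P: "eventually P F" and close: "\<forall>g h. P g \<longrightarrow> P h \<longrightarrow>
      g \<in> vcarrier ?D \<and> h \<in> vcarrier ?D \<and> (\<forall>x\<in>B. norm (g x - h x) < e)"
      and "P g" "x \<in> B" "x \<in> vcarrier V" for P B e g x
  proof (rule tendsto_upperbound)
    show "((\<lambda>h. norm (g x - h x)) \<longlongrightarrow> norm (g x - l x)) F"
      by (intro tendsto_intros l that)
    show "eventually (\<lambda>h. norm (g x - h x) \<le> e) F"
      using P by (rule eventually_mono) (use that in \<open>auto intro: less_imp_le\<close>)
  qed (rule Fne)
  have l_add: "l (vadd V x y) = l x + l y" if xy: "x \<in> vcarrier V" "y \<in> vcarrier V" for x y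
  proof (rule tendsto_unique[OF Fne l])
    have "((\<lambda>g. g x + g y) \<longlongrightarrow> l x + l y) F"
      by (intro tendsto_intros l xy)
    moreover have "eventually (\<lambda>g. g x + g y = g (vadd V x y)) F"
      using evD by (rule eventually_mono) (use xy in \<open>simp add: dual_tvs_iff\<close>)
    ultimately show "((\<lambda>g. g (vadd V x y)) \<longlongrightarrow> l x + l y) F"
      by (rule Lim_transform_eventually)
  qed (use xy add_closed in auto)
  have l_scale: "l (vscale V c x) = c * l x" if x: "x \<in> vcarrier V" for c x
  proof (rule tendsto_unique[OF Fne l])
    have "((\<lambda>g. c * g x) \<longlongrightarrow> c * l x) F"
      by (intro tendsto_intros l x)
    moreover have "eventually (\<lambda>g. c * g x = g (vscale V c x)) F"
      using evD by (rule eventually_mono) (use x in \<open>simp add: dual_tvs_iff\<close>)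
    ultimately show "((\<lambda>g. g (vscale V c x)) \<longlongrightarrow> c * l x) F"
      by (rule Lim_transform_eventually)
  qed (use x scale_closed in auto)
  have lD: "l \<in> vcarrier ?D"
    unfolding dual_tvs_iff
  proof (intro conjI ballI allI l_add l_scale)
    show "l \<in> extensional (vcarrier V)" by (simp add: l_def)
    show "\<exists>p\<in>Q. \<exists>K\<ge>0. \<forall>x\<in>vcarrier V. norm (l x) \<le> K * p x"
    proof (rule bounded_functional_continuous[OF Q mono l_scale])
      fix B assume B: "tvs_bounded tvs B"
      obtain P where P: "eventually P F" "\<forall>g h. P g \<longrightarrow> P h \<longrightarrow>
          g \<in> vcarrier ?D \<and> h \<in> vcarrier ?D \<and> (\<forall>x\<in>B. norm (g x - h x) < 1)"
        using uniform[OF B, of 1] by auto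
      obtain g where g: "P g" using eventually_happens'[OF Fne P(1)] by blast
      then have gD: "g \<in> vcarrier ?D" using P(2) by blast
      have "norm (l x) \<le> dual_seminorm tvs B g + 1" if x: "x \<in> B" for x
      proof -
        have "norm (g x - l x) \<le> 1"
          by (rule close[OF P g x]) (use bounded_carrier[OF B] x in auto)
        moreover have "norm (g x) \<le> dual_seminorm tvs B g"
          by (rule dual_seminorm_upper[OF B gD]) (use x in auto)
        ultimately show ?thesis
          using norm_triangle_ineq4[of "g x" "g x - l x"] by simp
      qed
      then show "\<exists>K. \<forall>x\<in>B. norm (l x) \<le> K" by blast
    qed
  qed
  have "limitin dual.\<T> (\<lambda>g. g) l F"
    unfolding limitin_def
  proof (intro conjI allI impI)
    show "l \<in> topspace dual.\<T>" using lD by (simp add: dual.topspace_seminorm_topology)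
    fix U assume U: "openin dual.\<T> U \<and> l \<in> U"
    then obtain p e where p: "p \<in> dual_seminorms tvs" "e > 0"
      "\<And>g. g \<in> vcarrier ?D \<Longrightarrow> p (vsub ?D g l) < e \<Longrightarrow> g \<in> U"
      unfolding dual.openin_seminorm_topology seminorm_open_def by blast
    obtain B where B: "p = dual_seminorm tvs B" "tvs_bounded tvs B"
      using p(1) by (auto simp: dual_seminorms_def)
    \<comment> \<open>The seminorm is a supremum including the point zero, so the uniform estimate
      has to cover that point too.\<close>
    have B': "tvs_bounded tvs (insert (vzero tvs) B)"
      using tvs_bounded_Un[OF tvs_bounded_singleton[OF zero_closed] B(2)] by (simp add: tvs_simps)
    obtain P where P: "eventually P F" "\<forall>g h. P g \<longrightarrow> P h \<longrightarrow>
        g \<in> vcarrier ?D \<and> h \<in> vcarrier ?D \<and> (\<forall>x\<in>insert (vzero tvs) B. norm (g x - h x) < e / 2)"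
      using uniform[OF B', of "e / 2"] p(2) by auto
    show "eventually (\<lambda>g. g \<in> U) F"
      using P(1)
    proof (rule eventually_mono)
      fix g assume g: "P g"
      then have gD: "g \<in> vcarrier ?D" using P(2) by blast
      have "p (vsub ?D g l) \<le> e / 2"
        unfolding B(1)
      proof (rule dual_seminorm_least)
        fix x assume x: "x \<in> insert (vzero tvs) B"
        have xV: "x \<in> vcarrier V" by (rule bounded_carrier[OF B(2) x])
        have "norm (g x - l x) \<le> e / 2" by (rule close[OF P g x xV])
        then show "norm (vsub ?D g l x) \<le> e / 2"
          using xV by (simp add: vsub_dual_apply tvs_simps)
      qed
      then show "g \<in> U" using p(2,3) gD by force
    qed
  qed
  then show "\<exists>l. limitin (vtop (strong_dual tvs)) (\<lambda>x. x) l F"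
    by (auto simp: strong_dual_eq with_top_def)
qed

end

section \<open>Transport along linear bijections\<close>

text \<open>Cauchy filters depend only on the linear structure and the topology. The filter is
  pulled back by the inverse of \<open>f\<close>, converges there, and the limit is mapped
  forward.\<close>

lemma tvs_complete_transport:
  assumes lin: "linear_map V W f" and bij: "bij_betw f (vcarrier V) (vcarrier W)"
    and homeo: "homeomorphic_map (vtop V) (vtop W) f" and zero: "f (vzero V) = vzero W"
    and V: "carrier_space V" and top: "topspace (vtop V) = vcarrier V" and compl: "tvs_complete V"
  shows "tvs_complete W"
  unfolding tvs_complete_def
proof (intro allI impI)
  interpret V: carrier_space V by fact
  define g where "g = inv_into (vcarrier V) f"
  have gV: "g w \<in> vcarrier V" and fg: "f (g w) = w" if "w \<in> vcarrier W" for w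
    unfolding g_def using bij that by (auto simp: bij_betw_def inv_into_into f_inv_into_f)
  fix F assume F: "F \<noteq> bot \<and> tvs_cauchy_filter W F"
  have evW: "eventually (\<lambda>w. w \<in> vcarrier W) F"
    using F by (simp add: tvs_cauchy_filter_def)
  have "tvs_cauchy_filter V (filtermap g F)"
    unfolding tvs_cauchy_filter_def
  proof (intro conjI allI impI)
    show "eventually (\<lambda>x. x \<in> vcarrier V) (filtermap g F)"
      unfolding eventually_filtermap using evW by (rule eventually_mono) (rule gV)
    fix U assume U: "openin (vtop V) U \<and> vzero V \<in> U"
    have "openin (vtop W) (f ` U)"
      using homeo U openin_subset by (metis homeomorphic_map_openness_eq)
    moreover have "vzero W \<in> f ` U" using U zero by (metis image_eqI)
    ultimately have "eventually (\<lambda>(x, y). vsub W x y \<in> f ` U) (F \<times>\<^sub>F F)"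
      using F unfolding tvs_cauchy_filter_def by blast
    then obtain P where P: "eventually P F" "\<And>x y. P x \<Longrightarrow> P y \<Longrightarrow> vsub W x y \<in> f ` U"
      unfolding eventually_prod_same by auto
    have UV: "U \<subseteq> vcarrier V" using U top openin_subset by metis
    have sub: "vsub V (g x) (g y) \<in> U" if x: "P x \<and> x \<in> vcarrier W" and y: "P y \<and> y \<in> vcarrier W" for x y
    proof -
      have "f (vsub V (g x) (g y)) = vsub W x y"
        using lin x y gV fg V.scale_closed unfolding linear_map_def vsub_def by auto
      then obtain u where "u \<in> U" "f (vsub V (g x) (g y)) = f u"
        using P(2) x y by auto
      then show ?thesis
        using bij UV V.sub_closed[OF gV gV] x y unfolding bij_betw_def by (metis inj_onD subsetD)
    qed
    have "eventually (\<lambda>w. P w \<and> w \<in> vcarrier W) F"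
      using P(1) evW by (rule eventually_conj)
    then show "eventually (\<lambda>(x, y). vsub V x y \<in> U) (filtermap g F \<times>\<^sub>F filtermap g F)"
      unfolding eventually_prod_same eventually_filtermap
      by (intro exI[of _ "\<lambda>v. \<exists>w. v = g w \<and> P w \<and> w \<in> vcarrier W"] conjI)
        (auto elim: eventually_mono intro: sub)
  qed
  moreover have "filtermap g F \<noteq> bot" using F by (simp add: filtermap_bot_iff)
  ultimately obtain l where l: "limitin (vtop V) (\<lambda>x. x) l (filtermap g F)"
    using compl unfolding tvs_complete_def by blast
  have "limitin (vtop W) (\<lambda>x. x) (f l) F"
    unfolding limitin_def
  proof (intro conjI allI impI)
    show "f l \<in> topspace (vtop W)"
      using l homeo limitin_topspace by (metis homeomorphic_imp_surjective_map image_eqI)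
    fix U assume U: "openin (vtop W) U \<and> f l \<in> U"
    have "openin (vtop V) {x \<in> topspace (vtop V). f x \<in> U}"
      using homeomorphic_imp_continuous_map[OF homeo] U by (auto intro: openin_continuous_map_preimage)
    moreover have "l \<in> {x \<in> topspace (vtop V). f x \<in> U}"
      using l U limitin_topspace by fastforce
    ultimately have "eventually (\<lambda>x. x \<in> {x \<in> topspace (vtop V). f x \<in> U}) (filtermap g F)"
      using l unfolding limitin_def by blast
    then have "eventually (\<lambda>w. f (g w) \<in> U) F"
      unfolding eventually_filtermap by (rule eventually_mono) simp
    then show "eventually (\<lambda>w. w \<in> U) F"
      using evW by eventually_elim (simp add: fg)
  qed
  then show "\<exists>l. limitin (vtop W) (\<lambda>x. x) l F" by blast
qed

text \<open>The operations of \<open>W\<close> are those of \<open>V\<close> conjugated by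
  \<open>f\<close>, so their continuity follows by composition with \<open>f\<close> and its
  inverse.\<close>

lemma linear_topology_transport:
  fixes V :: "('k::real_or_complex, 'v, 'y) vspace_scheme" and W :: "('k, 'w, 'z) vspace_scheme"
  assumes lin: "linear_map V W f" and bij: "bij_betw f (vcarrier V) (vcarrier W)"
    and V: "carrier_space V" and S: "linear_topology V S"
  defines "T \<equiv> pullback_topology (vcarrier W) (inv_into (vcarrier V) f) S"
  shows "linear_topology W T" and "homeomorphic_map S T f"
    and "\<And>U. openin T U \<longleftrightarrow> U \<subseteq> vcarrier W \<and> openin S {x \<in> vcarrier V. f x \<in> U}"
proof -
  interpret V: carrier_space V by fact
  define g where "g = inv_into (vcarrier V) f"
  have gV: "g w \<in> vcarrier V" and fg: "f (g w) = w" if "w \<in> vcarrier W" for w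
    unfolding g_def using bij that by (auto simp: bij_betw_def inv_into_into f_inv_into_f)
  have gf: "g (f v) = v" and fW: "f v \<in> vcarrier W" if "v \<in> vcarrier V" for v
    unfolding g_def using bij that by (auto simp: bij_betw_def)
  have topS: "topspace S = vcarrier V" using S by (simp add: linear_topology_def)
  have topT: "topspace T = vcarrier W"
    unfolding T_def topspace_pullback_topology topS using gV by (auto simp: g_def)
  show openin_T: "openin T U \<longleftrightarrow> U \<subseteq> vcarrier W \<and> openin S {x \<in> vcarrier V. f x \<in> U}" for U
  proof
    assume "openin T U"
    then obtain O' where O': "openin S O'" "U = g -` O' \<inter> vcarrier W"
      unfolding T_def openin_pullback_topology g_def by blast
    have "{x \<in> vcarrier V. f x \<in> U} = O'"
      using openin_subset[OF O'(1)] gf fW by (auto simp: O'(2) topS)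
    then show "U \<subseteq> vcarrier W \<and> openin S {x \<in> vcarrier V. f x \<in> U}" using O' by auto
  next
    assume U: "U \<subseteq> vcarrier W \<and> openin S {x \<in> vcarrier V. f x \<in> U}"
    then have "U = g -` {x \<in> vcarrier V. f x \<in> U} \<inter> vcarrier W"
      using gV fg by auto
    then show "openin T U"
      unfolding T_def openin_pullback_topology using U by (auto simp: g_def)
  qed
  have cont_f: "continuous_map S T f"
    unfolding continuous_map_def using openin_T fW by (auto simp: topS topT)
  have cont_g: "continuous_map T S g"
    unfolding continuous_map_def
  proof (intro conjI allI impI)
    show "g \<in> topspace T \<rightarrow> topspace S" using gV by (simp add: topS topT)
    fix U assume U: "openin S U"
    have "{x \<in> vcarrier V. f x \<in> {x \<in> topspace T. g x \<in> U}} = U"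
      using openin_subset[OF U] gf fW by (auto simp: topS topT)
    then show "openin T {x \<in> topspace T. g x \<in> U}"
      using U unfolding openin_T by (auto simp: topT)
  qed
  have "homeomorphic_maps S T f g"
    unfolding homeomorphic_maps_def using cont_f cont_g gf fg by (simp add: topS topT)
  then show "homeomorphic_map S T f"
    using homeomorphic_map_maps by blast
  have f_add: "f (vadd V x y) = vadd W (f x) (f y)" if "x \<in> vcarrier V" "y \<in> vcarrier V" for x y
    using lin that by (simp add: linear_map_def)
  have f_scale: "f (vscale V c x) = vscale W c (f x)" if "x \<in> vcarrier V" for c x
    using lin that by (simp add: linear_map_def)
  show "linear_topology W T"
    unfolding linear_topology_def
  proof (intro conjI)
    show "topspace T = vcarrier W" by (rule topT)
    have "continuous_map (prod_topology T T) (prod_topology S S) (\<lambda>(x, y). (g x, g y))"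
      unfolding continuous_map_prod_top using cont_g by blast
    moreover have "continuous_map (prod_topology S S) S (\<lambda>(x, y). vadd V x y)"
      using S by (simp add: linear_topology_def)
    ultimately have "continuous_map (prod_topology T T) T (f \<circ> ((\<lambda>(x, y). vadd V x y) \<circ> (\<lambda>(x, y). (g x, g y))))"
      using cont_f by (intro continuous_map_compose)
    then show "continuous_map (prod_topology T T) T (\<lambda>(x, y). vadd W x y)"
      by (rule continuous_map_eq) (auto simp: topT f_add gV fg)
    have "continuous_map (prod_topology (euclidean :: 'k topology) T) (prod_topology euclidean S) (\<lambda>(c, x). (c, g x))"
      unfolding continuous_map_prod_top using cont_g by auto
    moreover have "continuous_map (prod_topology euclidean S) S (\<lambda>(c, x). vscale V c x)"
      using S by (simp add: linear_topology_def)
    ultimately have "continuous_map (prod_topology euclidean T) T (f \<circ> ((\<lambda>(c, x). vscale V c x) \<circ> (\<lambda>(c, x). (c, g x))))"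
      using cont_f by (intro continuous_map_compose)
    then show "continuous_map (prod_topology euclidean T) T (\<lambda>(c, x). vscale W c x)"
      by (rule continuous_map_eq) (auto simp: topT f_scale gV fg)
  qed
qed

section \<open>Normed duals\<close>

text \<open>The value at x is the scalar k with g(c x) = Re(c k) for all c; over the complex numbers
  this is g(x) - i g(i x). Rotating x by a phase makes its modulus a value of \<open>g\<close>, so
  the bound is inherited without loss.\<close>

lemma (in carrier_space) kre_lift:
  fixes g :: "'v \<Rightarrow> real"
  assumes g_add: "\<And>x y. x \<in> vcarrier V \<Longrightarrow> y \<in> vcarrier V \<Longrightarrow> g (vadd V x y) = g x + g y"
    and g_scale: "\<And>r x. x \<in> vcarrier V \<Longrightarrow> g (vscale V (of_real r) x) = r * g x"
    and g_le: "\<And>x. x \<in> vcarrier V \<Longrightarrow> \<bar>g x\<bar> \<le> K * p x"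
    and p_scale: "\<And>c x. x \<in> vcarrier V \<Longrightarrow> p (vscale V c x) = norm c * p x"
    and nonneg: "\<And>x. x \<in> vcarrier V \<Longrightarrow> 0 \<le> p x" "0 \<le> K"
  obtains f :: "'v \<Rightarrow> 'k" where "f \<in> extensional (vcarrier V)"
    and "\<And>x y. x \<in> vcarrier V \<Longrightarrow> y \<in> vcarrier V \<Longrightarrow> f (vadd V x y) = f x + f y"
    and "\<And>c x. x \<in> vcarrier V \<Longrightarrow> f (vscale V c x) = c * f x"
    and "\<And>x. x \<in> vcarrier V \<Longrightarrow> kre (f x) = g x"
    and "\<And>x. x \<in> vcarrier V \<Longrightarrow> norm (f x) \<le> K * p x"
proof -
  define f where "f = (\<lambda>x\<in>vcarrier V. SOME k. \<forall>c. g (vscale V c x) = kre (c * k))"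
  have f: "g (vscale V c x) = kre (c * f x)" if x: "x \<in> vcarrier V" for c x
  proof -
    have "\<exists>k. \<forall>c. g (vscale V c x) = kre (c * k)"
    proof (rule kre_represents)
      show "g (vscale V (c + d) x) = g (vscale V c x) + g (vscale V d x)" for c d
        using x by (simp add: add_scale g_add scale_closed)
      show "g (vscale V (r *\<^sub>R c) x) = r * g (vscale V c x)" for r c
        using x g_scale[OF scale_closed[OF x], of r c] by (simp add: scale_scale scaleR_conv_of_real)
    qed
    then have some: "\<forall>c. g (vscale V c x) = kre (c * (SOME k. \<forall>c. g (vscale V c x) = kre (c * k)))"
      by (rule someI_ex)
    have fx: "f x = (SOME k. \<forall>c. g (vscale V c x) = kre (c * k))"
      using x by (simp add: f_def)
    show ?thesis unfolding fx by (rule spec[OF some])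
  qed
  show thesis
  proof (rule that[of f])
    show "f \<in> extensional (vcarrier V)" by (simp add: f_def)
    show "f (vadd V x y) = f x + f y" if "x \<in> vcarrier V" "y \<in> vcarrier V" for x y
    proof (rule kre_eqI)
      fix c
      have "kre (c * f (vadd V x y)) = g (vscale V c (vadd V x y))"
        using f that add_closed by simp
      also have "\<dots> = kre (c * f x) + kre (c * f y)"
        using that by (simp add: scale_add g_add scale_closed f)
      finally show "kre (c * f (vadd V x y)) = kre (c * (f x + f y))"
        by (simp add: distrib_left kre_add)
    qed
    show "f (vscale V d x) = d * f x" if "x \<in> vcarrier V" for d x
    proof (rule kre_eqI)
      fix c
      have "kre (c * f (vscale V d x)) = g (vscale V c (vscale V d x))"
        using f that scale_closed by simp
      also have "\<dots> = kre (c * d * f x)"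
        using that f by (simp add: scale_scale)
      finally show "kre (c * f (vscale V d x)) = kre (c * (d * f x))"
        by (simp add: mult.assoc)
    qed
    show "kre (f x) = g x" if "x \<in> vcarrier V" for x
      using f[OF that, of 1] that by (simp add: scale_one)
    show "norm (f x) \<le> K * p x" if x: "x \<in> vcarrier V" for x
    proof -
      obtain c where c: "norm c \<le> 1" "kre (c * f x) = norm (f x)" by (rule kre_attains_norm)
      have "norm (f x) = g (vscale V c x)" using f[OF x, of c] c by simp
      also have "\<dots> \<le> K * p (vscale V c x)" using g_le[OF scale_closed[OF x], of c] by linarith
      also have "\<dots> = K * (norm c * p x)" using x by (simp add: p_scale)
      also have "\<dots> \<le> K * p x"
        using c nonneg x by (intro mult_left_mono mult_left_le_one_le) auto
      finally show ?thesis .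
    qed
  qed
qed

context normed_carrier_space
begin

lemma norm_tvs_eq_tvs: "norm_tvs N = tvs"
  by (simp add: tvs_def norm_tvs_eq)

abbreviation "dual_norm \<equiv> vnorm (normed_dual N)"

lemma normed_dual_simps:
  "vcarrier (normed_dual N) = vcarrier (dual_vspace tvs)"
  "vadd (normed_dual N) f g = (\<lambda>x\<in>vcarrier N. f x + g x)"
  "vzero (normed_dual N) = (\<lambda>x\<in>vcarrier N. 0)"
  "vscale (normed_dual N) c f = (\<lambda>x\<in>vcarrier N. c * f x)"
  by (simp_all add: normed_dual_def with_norm_def norm_tvs_eq_tvs dual_vspace_simps tvs_simps)

lemma normed_dual_iff:
  "f \<in> vcarrier (normed_dual N) \<longleftrightarrow> f \<in> extensional (vcarrier N) \<and>
    (\<forall>x\<in>vcarrier N. \<forall>y\<in>vcarrier N. f (vadd N x y) = f x + f y) \<and>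
    (\<forall>c. \<forall>x\<in>vcarrier N. f (vscale N c x) = c * f x) \<and>
    (\<exists>K\<ge>0. \<forall>x\<in>vcarrier N. norm (f x) \<le> K * vnorm N x)"
  by (simp add: normed_dual_simps dual_tvs_iff)

lemma dual_norm_least:
  assumes "\<And>x. x \<in> vcarrier N \<Longrightarrow> norm (f x) \<le> K * vnorm N x" and "0 \<le> K"
  shows "dual_norm f \<le> K"
proof -
  have "(SUP x\<in>{x \<in> vcarrier N. vnorm N x \<le> 1}. norm (f x)) \<le> K"
  proof (rule cSUP_least)
    show "{x \<in> vcarrier N. vnorm N x \<le> 1} \<noteq> {}"
      using zero_closed seminorm_zero[of "vnorm N"] by auto
    fix x assume x: "x \<in> {x \<in> vcarrier N. vnorm N x \<le> 1}"
    then have "norm (f x) \<le> K * vnorm N x" using assms(1) by blast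
    also have "\<dots> \<le> K" using x assms(2) by (simp add: mult_left_le)
    finally show "norm (f x) \<le> K" .
  qed
  then show ?thesis by (simp add: normed_dual_def with_norm_def)
qed

lemma dual_norm_bound:
  assumes f: "f \<in> vcarrier (normed_dual N)" and x: "x \<in> vcarrier N"
  shows "norm (f x) \<le> dual_norm f * vnorm N x"
proof -
  obtain K where K: "K \<ge> 0" "\<And>x. x \<in> vcarrier N \<Longrightarrow> norm (f x) \<le> K * vnorm N x"
    using f unfolding normed_dual_iff by blast
  have f_scale: "f (vscale N c x) = c * f x" if "x \<in> vcarrier N" for c x
    using f that unfolding normed_dual_iff by blast
  have bdd: "bdd_above ((\<lambda>x. norm (f x)) ` {x \<in> vcarrier N. vnorm N x \<le> 1})"
  proof (rule bdd_aboveI2)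
    fix x assume x: "x \<in> {x \<in> vcarrier N. vnorm N x \<le> 1}"
    then have "norm (f x) \<le> K * vnorm N x" using K by blast
    also have "\<dots> \<le> K" using x K(1) by (simp add: mult_left_le)
    finally show "norm (f x) \<le> K" .
  qed
  have le: "norm (f y) \<le> dual_norm f" if "y \<in> vcarrier N" "vnorm N y \<le> 1" for y
    unfolding normed_dual_def with_norm_def normed_vspace.simps
    by (rule cSUP_upper[OF _ bdd]) (use that in auto)
  show ?thesis
  proof (cases "vnorm N x = 0")
    case True
    then show ?thesis using K(2)[OF x] by simp
  next
    case False
    then have n: "vnorm N x > 0" using seminorm_nonneg[of "vnorm N" x] x by simp
    let ?c = "of_real (inverse (vnorm N x)) :: 'k"
    have "vnorm N (vscale N ?c x) \<le> 1"
      using n x by (simp only: norm_scale_eq norm_of_real) simp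
    then have "norm (f (vscale N ?c x)) \<le> dual_norm f"
      using le x scale_closed by blast
    then have "inverse (vnorm N x) * norm (f x) \<le> dual_norm f"
      using n by (simp only: f_scale[OF x] norm_mult norm_of_real) simp
    then show ?thesis using n by (simp add: field_simps)
  qed
qed

text \<open>A negative supremum would force f = 0 through \<open>dual_norm_bound\<close>, and then
  the supremum is 0.\<close>

lemma dual_norm_nonneg: "f \<in> vcarrier (normed_dual N) \<Longrightarrow> 0 \<le> dual_norm f"
proof -
  assume f: "f \<in> vcarrier (normed_dual N)"
  show ?thesis
  proof (rule ccontr)
    assume neg: "\<not> ?thesis"
    have "norm (f x) \<le> 0 * vnorm N x" if "x \<in> vcarrier N" for x
      using dual_norm_bound[OF f that] neg seminorm_nonneg[of "vnorm N" x] that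
      by (smt (verit) insertI1 mult_nonpos_nonneg norm_ge_zero)
    then have zero: "f x = 0" if "x \<in> vcarrier N" for x using that by force
    then have "(\<lambda>x. norm (f x)) ` {x \<in> vcarrier N. vnorm N x \<le> 1} = {0}"
      using zero_closed seminorm_zero[of "vnorm N"] by (auto simp: image_iff)
    then have "dual_norm f = 0" by (simp add: normed_dual_def with_norm_def)
    then show False using neg by simp
  qed
qed

lemma normed_carrier_space_dual: "normed_carrier_space (normed_dual N)"
proof -
  interpret D: carrier_space "dual_vspace tvs" by (rule carrier_space_dual_tvs)
  have ops: "vadd (normed_dual N) = vadd (dual_vspace tvs)" "vzero (normed_dual N) = vzero (dual_vspace tvs)"
    "vscale (normed_dual N) = vscale (dual_vspace tvs)"
    by (simp_all add: normed_dual_def with_norm_def norm_tvs_eq_tvs)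
  have "carrier_space (normed_dual N)"
    using carrier_space_dual_tvs unfolding carrier_space_def ops normed_dual_simps(1) .
  then interpret C: carrier_space "normed_dual N" .
  show ?thesis
  proof
    fix f g assume f: "f \<in> vcarrier (normed_dual N)" and g: "g \<in> vcarrier (normed_dual N)"
    show "dual_norm (vadd (normed_dual N) f g) \<le> dual_norm f + dual_norm g"
    proof (rule dual_norm_least)
      fix x assume x: "x \<in> vcarrier N"
      show "norm (vadd (normed_dual N) f g x) \<le> (dual_norm f + dual_norm g) * vnorm N x"
        using dual_norm_bound[OF f x] dual_norm_bound[OF g x] norm_triangle_ineq[of "f x" "g x"] x
        by (simp add: normed_dual_simps distrib_right)
    qed (use dual_norm_nonneg f g in auto)
  next
    fix c f assume f: "f \<in> vcarrier (normed_dual N)"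
    show "dual_norm (vscale (normed_dual N) c f) = norm c * dual_norm f"
    proof (rule C.homogeneousI[OF _ dual_norm_nonneg f])
      fix c f assume f: "f \<in> vcarrier (normed_dual N)"
      show "dual_norm (vscale (normed_dual N) c f) \<le> norm c * dual_norm f"
      proof (rule dual_norm_least)
        fix x assume x: "x \<in> vcarrier N"
        show "norm (vscale (normed_dual N) c f x) \<le> norm c * dual_norm f * vnorm N x"
          using dual_norm_bound[OF f x] x
          by (simp add: normed_dual_simps norm_mult mult.assoc mult_left_mono)
      qed (use dual_norm_nonneg f in auto)
    qed
  next
    fix f assume f: "f \<in> vcarrier (normed_dual N)" and "dual_norm f = 0"
    then have "f x = 0" if "x \<in> vcarrier N" for x using dual_norm_bound[OF f that] by simp
    then show "f = vzero (normed_dual N)"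
      using f by (auto simp: normed_dual_simps(3) normed_dual_iff extensional_def fun_eq_iff)
  qed
qed

end


section \<open>The operator and its dual\<close>

locale invertible_operator = banach_space smul
  for smul :: "'k::real_or_complex \<Rightarrow> 'a::banach \<Rightarrow> 'a" +
  fixes D :: "'a set" and A :: "'a \<Rightarrow> 'a"
  assumes reflexive: "reflexive (whole_space smul)"
    and linear_operator: "linear_operator smul D A"
    and dense_domain: "closure D = UNIV"
    and bij: "bij_betw A D UNIV"
    and bounded_inverse: "bounded_linear (inv_into D A)"
begin

abbreviation "X \<equiv> whole_space smul"
abbreviation "X' \<equiv> normed_dual X"
abbreviation "b \<equiv> inv_into D A"

lemma X_simps: "vcarrier X = UNIV" "vadd X = (+)" "vzero X = 0" "vscale X = smul" "vnorm X = norm"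
  by (simp_all add: whole_space_def)

sublocale X: normed_carrier_space X
  by unfold_locales
    (auto simp: X_simps add.assoc scale_right_distrib scale_left_distrib norm_triangle_ineq norm_scale)

sublocale X': normed_carrier_space X'
  by (rule X.normed_carrier_space_dual)

lemma X'_simps:
  "vadd X' f g = (\<lambda>x. f x + g x)" "vzero X' = (\<lambda>x. 0)" "vscale X' c f = (\<lambda>x. c * f x)"
  by (simp_all add: X.normed_dual_simps X_simps restrict_def)

lemma X'_iff:
  "\<phi> \<in> vcarrier X' \<longleftrightarrow> (\<forall>x y. \<phi> (x + y) = \<phi> x + \<phi> y) \<and> (\<forall>c x. \<phi> (smul c x) = c * \<phi> x) \<and>
    (\<exists>K\<ge>0. \<forall>x. norm (\<phi> x) \<le> K * norm x)"
  by (simp add: X.normed_dual_iff X_simps)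

lemma dual_bound: "\<phi> \<in> vcarrier X' \<Longrightarrow> norm (\<phi> x) \<le> vnorm X' \<phi> * norm x"
  using X.dual_norm_bound[of \<phi> x] by (simp add: X_simps)

lemma dual_least: "(\<And>x. norm (\<phi> x) \<le> K * norm x) \<Longrightarrow> 0 \<le> K \<Longrightarrow> vnorm X' \<phi> \<le> K"
  using X.dual_norm_least[of \<phi> K] by (simp add: X_simps)

lemma b_add: "b (x + y) = b x + b y"
  by (rule linear_add[OF bounded_linear.linear[OF bounded_inverse]])

lemma A_b: "A (b x) = x" and b_in: "b x \<in> D"
  using bij f_inv_into_f[of x A D] inv_into_into[of x A D] by (auto simp: bij_betw_def)

lemma b_A: "x \<in> D \<Longrightarrow> b (A x) = x"
  using bij by (simp add: bij_betw_def)

lemma b_smul: "b (smul c x) = smul c (b x)"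
proof -
  have "smul c (b x) \<in> D" "A (smul c (b x)) = smul c x"
    using linear_operator b_in[of x] by (auto simp: linear_operator_def A_b subspace_scale)
  then show ?thesis using b_A by metis
qed

lemma inj_b: "inj b"
  by (metis A_b injI)

lemma range_b: "range b = D"
  using b_in b_A by (auto simp: image_iff) metis

lemma bn_add: "(b ^^ n) (x + y) = (b ^^ n) x + (b ^^ n) y"
  by (induction n) (auto simp: b_add)

lemma bn_smul: "(b ^^ n) (smul c x) = smul c ((b ^^ n) x)"
  by (induction n) (auto simp: b_smul)

lemma inj_bn: "inj (b ^^ n)"
proof (induction n)
  case (Suc n)
  have "inj (b \<circ> (b ^^ n))" by (rule inj_compose[OF inj_b Suc])
  then show ?case by (simp only: funpow.simps)
qed simp

definition B :: "'a \<Rightarrow>\<^sub>L 'a" where "B = Blinfun b"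

lemma bpow_B: "blinfun_apply (bpow B n) = b ^^ n"
  by (simp add: fun_eq_iff bpow_apply B_def bounded_linear_Blinfun_apply[OF bounded_inverse])

lemma bounded_linear_bn: "bounded_linear (b ^^ n)"
  using blinfun.bounded_linear_right[of "bpow B n"] by (simp add: bpow_B)

text \<open>The range of \<open>b\<close> is the dense domain D, and by continuity the n-th power
  maps it onto a dense part of its own range.\<close>

lemma dense_range_bn: "closure (range (b ^^ n)) = UNIV"
proof (induction n)
  case (Suc n)
  have "closure (range (b ^^ n)) \<subseteq> closure (range (b ^^ Suc n))"
  proof (rule closure_minimal)
    have "range (b ^^ n) = (b ^^ n) ` closure (range b)"
      by (simp add: range_b dense_domain)
    also have "\<dots> \<subseteq> closure ((b ^^ n) ` range b)"
      by (rule image_closure_subset)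
        (auto intro: linear_continuous_on[OF bounded_linear_bn] closure_subset[THEN subsetD])
    also have "(b ^^ n) ` range b = range (b ^^ Suc n)"
      by (auto simp: image_iff funpow_swap1)
    finally show "range (b ^^ n) \<subseteq> closure (range (b ^^ Suc n))" .
  qed simp
  then show ?case using Suc by auto
qed simp

section \<open>The dual of X and its real form\<close>

definition Re_dual :: "('a \<Rightarrow> 'k) \<Rightarrow> 'a \<Rightarrow>\<^sub>L real" where
  "Re_dual \<phi> = Blinfun (\<lambda>x. kre (\<phi> x))"

lemma Re_dual_apply:
  assumes "\<phi> \<in> vcarrier X'"
  shows "blinfun_apply (Re_dual \<phi>) x = kre (\<phi> x)"
proof -
  have "bounded_linear \<phi>"
  proof (rule bounded_linear_intro[of _ "vnorm X' \<phi>"])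
    show "\<phi> (r *\<^sub>R x) = r *\<^sub>R \<phi> x" for r x
      using assms by (simp add: X'_iff flip: scale_of_real scaleR_conv_of_real)
    show "norm (\<phi> x) \<le> norm x * vnorm X' \<phi>" for x
      using dual_bound[OF assms, of x] by (simp add: mult.commute)
  qed (use assms in \<open>simp add: X'_iff\<close>)
  then have "bounded_linear (\<lambda>x. kre (\<phi> x))"
    using bounded_linear_compose[OF bounded_linear_kre] by blast
  then show ?thesis by (simp add: Re_dual_def bounded_linear_Blinfun_apply)
qed

lemma Re_dual_add: "f \<in> vcarrier X' \<Longrightarrow> g \<in> vcarrier X' \<Longrightarrow> Re_dual (vadd X' f g) = Re_dual f + Re_dual g"
  using X'.add_closed[of f g]
  by (intro blinfun_eqI) (simp add: Re_dual_apply X'_simps kre_add blinfun.add_left)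

lemma Re_dual_scale: "f \<in> vcarrier X' \<Longrightarrow> Re_dual (vscale X' (of_real r) f) = r *\<^sub>R Re_dual f"
  using X'.scale_closed[of f "of_real r"]
  by (intro blinfun_eqI)
    (simp add: Re_dual_apply X'_simps kre_scaleR blinfun.scaleR_left flip: scaleR_conv_of_real)

lemma norm_Re_dual_le: "\<phi> \<in> vcarrier X' \<Longrightarrow> norm (Re_dual \<phi>) \<le> vnorm X' \<phi>"
  using abs_kre_le[of "\<phi> _"] dual_bound
  by (intro norm_blinfun_bound) (auto simp: Re_dual_apply X.dual_norm_nonneg intro: order_trans)

lemma Re_dual_eqD:
  assumes \<phi>: "\<phi> \<in> vcarrier X'" and \<psi>: "\<psi> \<in> vcarrier X'" and eq: "Re_dual \<phi> = Re_dual \<psi>"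
  shows "\<phi> = \<psi>"
proof
  fix x
  show "\<phi> x = \<psi> x"
  proof (rule kre_eqI)
    fix c
    have "kre (\<phi> (smul c x)) = kre (\<psi> (smul c x))"
      using eq Re_dual_apply[OF \<phi>] Re_dual_apply[OF \<psi>] by metis
    then show "kre (c * \<phi> x) = kre (c * \<psi> x)"
      using \<phi> \<psi> by (simp add: X'_iff)
  qed
qed

text \<open>Together with \<open>Re_dual_eqD\<close> and \<open>norm_Re_dual_le\<close> this makes
  \<open>Re_dual\<close> an isometric bijection onto the real dual.\<close>

lemma Re_dual_surj:
  fixes g :: "'a \<Rightarrow>\<^sub>L real"
  obtains \<phi> where "\<phi> \<in> vcarrier X'" and "Re_dual \<phi> = g" and "vnorm X' \<phi> \<le> norm g"
proof -
  obtain \<phi> :: "'a \<Rightarrow> 'k" where \<phi>: "\<And>x y. \<phi> (x + y) = \<phi> x + \<phi> y" "\<And>c x. \<phi> (smul c x) = c * \<phi> x"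
    "\<And>x. kre (\<phi> x) = g x" "\<And>x. norm (\<phi> x) \<le> norm g * norm x"
  proof (rule X.kre_lift[of g "norm g" norm])
    show "g (vscale X (of_real r) x) = r * g x" for r x
      by (simp add: X_simps scale_of_real blinfun.scaleR_right)
    show "\<bar>g x\<bar> \<le> norm g * norm x" for x
      using norm_blinfun[of g x] by simp
  qed (auto simp: X_simps blinfun.add_right norm_scale)
  have "\<phi> \<in> vcarrier X'" using \<phi> by (auto simp: X'_iff intro!: exI[of _ "norm g"])
  moreover from this have "Re_dual \<phi> = g" using \<phi>(3) by (intro blinfun_eqI) (simp add: Re_dual_apply)
  moreover have "vnorm X' \<phi> \<le> norm g" using \<phi>(4) by (intro dual_least) auto
  ultimately show thesis by (rule that)
qed

lemma compose_bn:
  assumes "\<phi> \<in> vcarrier X'"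
  shows "\<phi> \<circ> (b ^^ n) \<in> vcarrier X'" and "Re_dual (\<phi> \<circ> (b ^^ n)) = Re_dual \<phi> o\<^sub>L bpow B n"
    and "vnorm X' (\<phi> \<circ> (b ^^ n)) \<le> onorm (b ^^ n) * vnorm X' \<phi>"
proof -
  have le: "norm ((\<phi> \<circ> (b ^^ n)) x) \<le> (onorm (b ^^ n) * vnorm X' \<phi>) * norm x" for x
  proof -
    have "norm (\<phi> ((b ^^ n) x)) \<le> vnorm X' \<phi> * norm ((b ^^ n) x)" by (rule dual_bound[OF assms])
    also have "\<dots> \<le> vnorm X' \<phi> * (onorm (b ^^ n) * norm x)"
      by (intro mult_left_mono onorm[OF bounded_linear_bn] X.dual_norm_nonneg assms)
    finally show ?thesis by (simp add: mult_ac)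
  qed
  have nn: "0 \<le> onorm (b ^^ n) * vnorm X' \<phi>"
    by (intro mult_nonneg_nonneg onorm_pos_le[OF bounded_linear_bn] X.dual_norm_nonneg assms)
  show X': "\<phi> \<circ> (b ^^ n) \<in> vcarrier X'"
    using assms le nn unfolding X'_iff by (auto simp: bn_add bn_smul)
  show "Re_dual (\<phi> \<circ> (b ^^ n)) = Re_dual \<phi> o\<^sub>L bpow B n"
    by (rule blinfun_eqI) (simp add: Re_dual_apply[OF X'] Re_dual_apply[OF assms] bpow_B)
  show "vnorm X' (\<phi> \<circ> (b ^^ n)) \<le> onorm (b ^^ n) * vnorm X' \<phi>"
    by (rule dual_least[OF le nn])
qed

sublocale smooth_dual B
proof
  have B: "blinfun_apply B = b"
    by (simp add: B_def bounded_linear_Blinfun_apply[OF bounded_inverse])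
  show "inj (blinfun_apply B)" by (simp add: B inj_b)
  show "closure (range (blinfun_apply B)) = UNIV" by (simp add: B range_b dense_domain)
  fix G :: "('a \<Rightarrow>\<^sub>L real) \<Rightarrow>\<^sub>L real"
  \<comment> \<open>Reflexivity is available over \<open>'k\<close> only. A real functional
    \<open>G\<close> on the real dual is therefore read as the real part of a functional \<Phi> on
    X', whose representing point also represents \<open>G\<close>.\<close>
  obtain \<Phi> where \<Phi>: "\<Phi> \<in> extensional (vcarrier X')"
    "\<And>f g. f \<in> vcarrier X' \<Longrightarrow> g \<in> vcarrier X' \<Longrightarrow> \<Phi> (vadd X' f g) = \<Phi> f + \<Phi> g"
    "\<And>c f. f \<in> vcarrier X' \<Longrightarrow> \<Phi> (vscale X' c f) = c * \<Phi> f"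
    "\<And>f. f \<in> vcarrier X' \<Longrightarrow> kre (\<Phi> f) = G (Re_dual f)"
    "\<And>f. f \<in> vcarrier X' \<Longrightarrow> norm (\<Phi> f) \<le> norm G * vnorm X' f"
  proof (rule X'.kre_lift[of "\<lambda>f. G (Re_dual f)" "norm G" "vnorm X'"])
    show "\<bar>G (Re_dual f)\<bar> \<le> norm G * vnorm X' f" if "f \<in> vcarrier X'" for f
      using norm_blinfun[of G "Re_dual f"] mult_left_mono[OF norm_Re_dual_le[OF that], of "norm G"]
      by simp
  qed (auto simp: Re_dual_add Re_dual_scale blinfun.add_right blinfun.scaleR_right X'.norm_scale_eq X.dual_norm_nonneg)
  have "\<Phi> \<in> vcarrier (normed_dual X')"
    unfolding X'.normed_dual_iff using \<Phi> by (auto intro!: exI[of _ "norm G"])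
  then obtain x where x: "\<And>\<phi>. \<phi> \<in> vcarrier X' \<Longrightarrow> \<Phi> \<phi> = \<phi> x"
    using reflexive unfolding reflexive_def by blast
  have "blinfun_apply G g = blinfun_apply g x" for g :: "'a \<Rightarrow>\<^sub>L real"
  proof -
    obtain \<phi> where \<phi>: "\<phi> \<in> vcarrier X'" "Re_dual \<phi> = g" by (rule Re_dual_surj)
    then show ?thesis using \<Phi>(4)[OF \<phi>(1)] x[OF \<phi>(1)] Re_dual_apply[OF \<phi>(1), of x] by simp
  qed
  then show "\<exists>x. \<forall>g :: 'a \<Rightarrow>\<^sub>L real. blinfun_apply G g = blinfun_apply g x" by blast
qed

section \<open>The dual operator as the inverse of composition with b\<close>

abbreviation "A' \<equiv> dual_operator X D A"

text \<open>The defining relation \<phi>(A x) = \<psi>(x) on D says exactly that \<phi> is \<psi>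
  composed with \<open>b\<close>.\<close>

lemma dual_domain_eq: "dual_domain X D A = {\<phi> \<circ> b | \<phi>. \<phi> \<in> vcarrier X'}"
proof (intro set_eqI iffI)
  fix \<phi> assume "\<phi> \<in> dual_domain X D A"
  then obtain \<psi> where \<psi>: "\<psi> \<in> vcarrier X'" "\<And>x. x \<in> D \<Longrightarrow> \<phi> (A x) = \<psi> x"
    unfolding dual_domain_def by blast
  have "\<phi> = \<psi> \<circ> b" using \<psi>(2)[OF b_in] by (simp add: fun_eq_iff A_b)
  then show "\<phi> \<in> {\<phi> \<circ> b | \<phi>. \<phi> \<in> vcarrier X'}" using \<psi>(1) by blast
next
  fix \<phi> assume "\<phi> \<in> {\<phi> \<circ> b | \<phi>. \<phi> \<in> vcarrier X'}"
  then obtain \<psi> where "\<psi> \<in> vcarrier X'" "\<phi> = \<psi> \<circ> b" by blast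
  then show "\<phi> \<in> dual_domain X D A"
    using compose_bn(1)[of \<psi> 1] by (auto simp: dual_domain_def b_A)
qed

lemma compose_b: "\<phi> \<in> vcarrier X' \<Longrightarrow> \<phi> \<circ> b \<in> vcarrier X'"
  using compose_bn(1)[of \<phi> 1] by simp

lemma compose_Suc: "\<phi> \<circ> (b ^^ Suc n) = (\<phi> \<circ> b) \<circ> (b ^^ n)"
  by (simp add: fun_eq_iff)

lemma compose_bn_cancel:
  assumes "\<phi> \<in> vcarrier X'" "\<psi> \<in> vcarrier X'" "\<phi> \<circ> (b ^^ n) = \<psi> \<circ> (b ^^ n)"
  shows "\<phi> = \<psi>"
  using assms compose_bn(2) compose_bpow_cancel Re_dual_eqD by metis

text \<open>The definite description needs uniqueness: two candidates agree on the dense set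
  D.\<close>

lemma dual_operator_compose:
  assumes \<psi>: "\<psi> \<in> vcarrier X'"
  shows "A' (\<psi> \<circ> b) = \<psi>"
  unfolding dual_operator_def
proof (rule the_equality)
  show "\<psi> \<in> vcarrier X' \<and> (\<forall>x\<in>D. (\<psi> \<circ> b) (A x) = \<psi> x)"
    using \<psi> by (simp add: b_A)
  fix \<phi> assume \<phi>: "\<phi> \<in> vcarrier X' \<and> (\<forall>x\<in>D. (\<psi> \<circ> b) (A x) = \<phi> x)"
  then have "\<phi> \<circ> (b ^^ 1) = \<psi> \<circ> (b ^^ 1)"
    using b_in by (simp add: fun_eq_iff b_A)
  then show "\<phi> = \<psi>" using compose_bn_cancel \<phi> \<psi> by blast
qed

lemma dual_operator_power: "\<phi> \<in> vcarrier X' \<Longrightarrow> (A' ^^ n) (\<phi> \<circ> (b ^^ n)) = \<phi>"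
proof (induction n arbitrary: \<phi>)
  case (Suc n)
  have "(A' ^^ Suc n) (\<phi> \<circ> (b ^^ Suc n)) = A' ((A' ^^ n) ((\<phi> \<circ> b) \<circ> (b ^^ n)))"
    by (subst compose_Suc) (simp only: funpow.simps comp_apply)
  also have "\<dots> = A' (\<phi> \<circ> b)"
    by (simp only: Suc.IH[OF compose_b[OF Suc.prems]])
  finally show ?case using dual_operator_compose[OF Suc.prems] by (simp only:)
qed simp

lemma power_domain_eq:
  "power_domain (vcarrier X') (dual_domain X D A) A' n = {\<phi> \<circ> (b ^^ n) | \<phi>. \<phi> \<in> vcarrier X'}"
proof (induction n)
  case (Suc n)
  show ?case
  proof (intro set_eqI iffI)
    fix \<psi> assume "\<psi> \<in> power_domain (vcarrier X') (dual_domain X D A) A' (Suc n)"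
    then obtain \<phi> where \<phi>: "\<phi> \<in> vcarrier X'" "\<psi> = \<phi> \<circ> (b ^^ n)" "(A' ^^ n) \<psi> \<in> dual_domain X D A"
      unfolding power_domain.simps Suc.IH by blast
    then have "\<phi> \<in> dual_domain X D A"
      using dual_operator_power[OF \<phi>(1), of n] by (simp only:)
    then obtain \<phi>' where \<phi>': "\<phi>' \<in> vcarrier X'" "\<phi> = \<phi>' \<circ> b"
      unfolding dual_domain_eq by blast
    have "\<psi> = \<phi>' \<circ> (b ^^ Suc n)"
      unfolding compose_Suc \<phi>(2) \<phi>'(2) ..
    then show "\<psi> \<in> {\<phi> \<circ> (b ^^ Suc n) | \<phi>. \<phi> \<in> vcarrier X'}"
      using \<phi>'(1) by blast
  next
    fix \<psi> assume "\<psi> \<in> {\<phi> \<circ> (b ^^ Suc n) | \<phi>. \<phi> \<in> vcarrier X'}"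
    then obtain \<phi> where \<phi>: "\<phi> \<in> vcarrier X'" "\<psi> = (\<phi> \<circ> b) \<circ> (b ^^ n)"
      unfolding compose_Suc by blast
    have X': "\<phi> \<circ> b \<in> vcarrier X'" by (rule compose_b[OF \<phi>(1)])
    then have "(A' ^^ n) \<psi> = \<phi> \<circ> b" using dual_operator_power \<phi>(2) by blast
    then have "(A' ^^ n) \<psi> \<in> dual_domain X D A"
      unfolding dual_domain_eq using \<phi>(1) by blast
    moreover have "\<psi> \<in> power_domain (vcarrier X') (dual_domain X D A) A' n"
      unfolding Suc.IH using X' \<phi>(2) by blast
    ultimately show "\<psi> \<in> power_domain (vcarrier X') (dual_domain X D A) A' (Suc n)"
      by (simp only: power_domain.simps mem_Collect_eq)
  qed
qed (auto simp: o_def)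

section \<open>The projective limit\<close>


abbreviation "interpolation n \<equiv> dual_interpolation_space X D A (Suc n)"

lemma interpolation_simps:
  "vcarrier (interpolation n) = {\<phi> \<circ> (b ^^ Suc n) | \<phi>. \<phi> \<in> vcarrier X'}"
  "vadd (interpolation n) = vadd X'" "vzero (interpolation n) = vzero X'"
  "vscale (interpolation n) = vscale X'"
  "vnorm (interpolation n) \<psi> = vnorm X' \<psi> + vnorm X' ((A' ^^ Suc n) \<psi>)"
  unfolding dual_interpolation_space_def with_norm_def power_domain_eq by simp_all

lemma vadd_compose: "vadd X' \<phi> \<psi> \<circ> f = vadd X' (\<phi> \<circ> f) (\<psi> \<circ> f)"
  and vscale_compose: "vscale X' c \<phi> \<circ> f = vscale X' c (\<phi> \<circ> f)"
  and vzero_compose: "vzero X' \<circ> f = vzero X'"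
  by (auto simp: X'_simps fun_eq_iff)

lemma interpolation_subset: "vcarrier (interpolation n) \<subseteq> vcarrier X'"
  unfolding interpolation_simps using compose_bn(1) by blast

text \<open>The dual operator is known only on its domain, as a definite description. Its linearity
  is read off from the representation of the elements as compositions with a power of
  \<open>b\<close>.\<close>

lemma interpolation_ops:
  assumes "\<phi> \<in> vcarrier (interpolation n)" and "\<psi> \<in> vcarrier (interpolation n)"
  shows "vadd X' \<phi> \<psi> \<in> vcarrier (interpolation n)"
    and "(A' ^^ Suc n) (vadd X' \<phi> \<psi>) = vadd X' ((A' ^^ Suc n) \<phi>) ((A' ^^ Suc n) \<psi>)"
    and "vscale X' c \<phi> \<in> vcarrier (interpolation n)"
    and "(A' ^^ Suc n) (vscale X' c \<phi>) = vscale X' c ((A' ^^ Suc n) \<phi>)"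
    and "(A' ^^ Suc n) \<phi> \<in> vcarrier X'"
proof -
  obtain \<phi>' \<psi>' where *: "\<phi>' \<in> vcarrier X'" "\<phi> = \<phi>' \<circ> (b ^^ Suc n)" "\<psi>' \<in> vcarrier X'" "\<psi> = \<psi>' \<circ> (b ^^ Suc n)"
    using assms unfolding interpolation_simps by blast
  have add: "vadd X' \<phi> \<psi> = vadd X' \<phi>' \<psi>' \<circ> (b ^^ Suc n)" and scale: "vscale X' c \<phi> = vscale X' c \<phi>' \<circ> (b ^^ Suc n)"
    by (simp_all only: * vadd_compose vscale_compose)
  have A: "(A' ^^ Suc n) \<phi> = \<phi>'" "(A' ^^ Suc n) \<psi> = \<psi>'"
    unfolding * by (rule dual_operator_power; rule *)+
  have cl: "vadd X' \<phi>' \<psi>' \<in> vcarrier X'" "vscale X' c \<phi>' \<in> vcarrier X'"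
    using * X'.add_closed X'.scale_closed by blast+
  show "vadd X' \<phi> \<psi> \<in> vcarrier (interpolation n)" "vscale X' c \<phi> \<in> vcarrier (interpolation n)"
    unfolding add scale interpolation_simps using cl by blast+
  show "(A' ^^ Suc n) (vadd X' \<phi> \<psi>) = vadd X' ((A' ^^ Suc n) \<phi>) ((A' ^^ Suc n) \<psi>)"
    unfolding A unfolding add by (rule dual_operator_power[OF cl(1)])
  show "(A' ^^ Suc n) (vscale X' c \<phi>) = vscale X' c ((A' ^^ Suc n) \<phi>)"
    unfolding A unfolding scale by (rule dual_operator_power[OF cl(2)])
  show "(A' ^^ Suc n) \<phi> \<in> vcarrier X'"
    unfolding A by (rule *)
qed

lemma normed_carrier_space_interpolation: "normed_carrier_space (interpolation n)"
proof -
  note sub = subsetD[OF interpolation_subset]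
  show ?thesis
  proof
    fix \<phi> \<psi> \<eta> and c d :: 'k assume \<phi>: "\<phi> \<in> vcarrier (interpolation n)"
    note S = interpolation_simps(2-5)
    show "vadd (interpolation n) \<phi> (vzero (interpolation n)) = \<phi>"
      unfolding S by (rule X'.add_zero[OF sub[OF \<phi>]])
    show "vscale (interpolation n) c \<phi> \<in> vcarrier (interpolation n)"
      unfolding S by (rule interpolation_ops(3)[OF \<phi> \<phi>])
    show "vscale (interpolation n) (c + d) \<phi> = vadd (interpolation n) (vscale (interpolation n) c \<phi>) (vscale (interpolation n) d \<phi>)"
      unfolding S by (rule X'.add_scale[OF sub[OF \<phi>]])
    show "vscale (interpolation n) c (vscale (interpolation n) d \<phi>) = vscale (interpolation n) (c * d) \<phi>"
      unfolding S by (rule X'.scale_scale[OF sub[OF \<phi>]])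
    show "vscale (interpolation n) 1 \<phi> = \<phi>"
      unfolding S by (rule X'.scale_one[OF sub[OF \<phi>]])
    show "vscale (interpolation n) 0 \<phi> = vzero (interpolation n)"
      unfolding S by (rule X'.scale_zero[OF sub[OF \<phi>]])
    show "vnorm (interpolation n) (vscale (interpolation n) c \<phi>) = norm c * vnorm (interpolation n) \<phi>"
      unfolding S interpolation_ops(4)[OF \<phi> \<phi>]
      using X'.norm_scale_eq[OF sub[OF \<phi>]] X'.norm_scale_eq[OF interpolation_ops(5)[OF \<phi> \<phi>]]
      by (simp add: distrib_left)
    show "\<phi> = vzero (interpolation n)" if "vnorm (interpolation n) \<phi> = 0"
      using that X.dual_norm_nonneg[OF sub[OF \<phi>]] X.dual_norm_nonneg[OF interpolation_ops(5)[OF \<phi> \<phi>]]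
        X'.norm_zeroD[OF sub[OF \<phi>]] unfolding S by simp
    assume \<psi>: "\<psi> \<in> vcarrier (interpolation n)"
    show "vadd (interpolation n) \<phi> \<psi> \<in> vcarrier (interpolation n)"
      unfolding S by (rule interpolation_ops(1)[OF \<phi> \<psi>])
    show "vadd (interpolation n) \<phi> \<psi> = vadd (interpolation n) \<psi> \<phi>"
      unfolding S by (rule X'.add_commute[OF sub[OF \<phi>] sub[OF \<psi>]])
    show "vscale (interpolation n) c (vadd (interpolation n) \<phi> \<psi>) =
        vadd (interpolation n) (vscale (interpolation n) c \<phi>) (vscale (interpolation n) c \<psi>)"
      unfolding S by (rule X'.scale_add[OF sub[OF \<phi>] sub[OF \<psi>]])
    show "vnorm (interpolation n) (vadd (interpolation n) \<phi> \<psi>) \<le> vnorm (interpolation n) \<phi> + vnorm (interpolation n) \<psi>"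
      unfolding S interpolation_ops(2)[OF \<phi> \<psi>]
      using X'.norm_add_le[OF sub[OF \<phi>] sub[OF \<psi>]]
        X'.norm_add_le[OF interpolation_ops(5)[OF \<phi> \<phi>] interpolation_ops(5)[OF \<psi> \<psi>]] by simp
    assume \<eta>: "\<eta> \<in> vcarrier (interpolation n)"
    show "vadd (interpolation n) (vadd (interpolation n) \<phi> \<psi>) \<eta> = vadd (interpolation n) \<phi> (vadd (interpolation n) \<psi> \<eta>)"
      unfolding S by (rule X'.add_assoc[OF sub[OF \<phi>] sub[OF \<psi>] sub[OF \<eta>]])
  next
    have "vzero X' = vzero X' \<circ> (b ^^ Suc n)" by (rule vzero_compose[symmetric])
    then show "vzero (interpolation n) \<in> vcarrier (interpolation n)"
      unfolding interpolation_simps using X'.zero_closed by blast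
  qed
qed

sublocale proj: normed_spectrum "\<lambda>n. dual_interpolation_space X D A (Suc n)"
  by (rule normed_spectrum.intro)
    (use normed_carrier_space_interpolation in \<open>simp_all only: interpolation_simps(2-4)\<close>)

abbreviation "P \<equiv> vcarrier proj.intersection"
abbreviation "component n \<psi> \<equiv> (A' ^^ Suc n) \<psi>"

lemma P_eq: "P = (\<Inter>n. {\<phi> \<circ> (b ^^ Suc n) | \<phi>. \<phi> \<in> vcarrier X'})"
  unfolding proj.intersection_carrier interpolation_simps ..

lemma intersection_ops: "vadd proj.intersection = vadd X'" "vscale proj.intersection = vscale X'"
  using proj.intersection_ops(1,3)[of 0] unfolding interpolation_simps .

lemma P_subset: "P \<subseteq> vcarrier X'"
proof
  fix \<psi> assume "\<psi> \<in> P"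
  then have "\<psi> \<in> vcarrier (interpolation 0)" by (rule proj.in_carrier)
  then show "\<psi> \<in> vcarrier X'" by (rule subsetD[OF interpolation_subset])
qed

lemma component:
  assumes "\<psi> \<in> P"
  shows "component n \<psi> \<in> vcarrier X'" and "\<psi> = component n \<psi> \<circ> (b ^^ Suc n)"
proof -
  have "\<psi> \<in> {\<phi> \<circ> (b ^^ Suc n) | \<phi>. \<phi> \<in> vcarrier X'}"
    using assms unfolding P_eq by (rule INT_D) simp
  then obtain \<phi> where \<phi>: "\<phi> \<in> vcarrier X'" "\<psi> = \<phi> \<circ> (b ^^ Suc n)" by blast
  have "component n \<psi> = \<phi>" unfolding \<phi>(2) by (rule dual_operator_power[OF \<phi>(1)])
  then show "component n \<psi> \<in> vcarrier X'" "\<psi> = component n \<psi> \<circ> (b ^^ Suc n)"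
    using \<phi> by (simp_all only:)
qed

lemma component_unique: "\<phi> \<in> vcarrier X' \<Longrightarrow> \<psi> = \<phi> \<circ> (b ^^ Suc n) \<Longrightarrow> component n \<psi> = \<phi>"
  using dual_operator_power[of \<phi> "Suc n"] by (simp only:)

lemma component_add: "\<phi> \<in> P \<Longrightarrow> \<psi> \<in> P \<Longrightarrow> component n (vadd X' \<phi> \<psi>) = vadd X' (component n \<phi>) (component n \<psi>)"
  and component_scale: "\<phi> \<in> P \<Longrightarrow> component n (vscale X' c \<phi>) = vscale X' c (component n \<phi>)"
  using interpolation_ops(2,4) proj.in_carrier by blast+

lemma component_compose:
  assumes \<psi>: "\<psi> \<in> P" and "n \<le> m"
  shows "component n \<psi> = component m \<psi> \<circ> (b ^^ (m - n))"
proof (rule component_unique)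
  show "component m \<psi> \<circ> (b ^^ (m - n)) \<in> vcarrier X'"
    by (rule compose_bn(1)[OF component(1)[OF \<psi>]])
  have "b ^^ Suc m = (b ^^ (m - n)) \<circ> (b ^^ Suc n)"
    using \<open>n \<le> m\<close> by (simp only: funpow_add[symmetric]) simp
  then show "\<psi> = component m \<psi> \<circ> (b ^^ (m - n)) \<circ> (b ^^ Suc n)"
    using component(2)[OF \<psi>, of m] by (simp only: comp_assoc)
qed

lemma Re_dual_component: "\<psi> \<in> P \<Longrightarrow> Re_dual \<psi> = Re_dual (component n \<psi>) o\<^sub>L bpow B (Suc n)"
  using compose_bn(2)[OF component(1), of \<psi> n "Suc n"] by (simp only: component(2)[symmetric])

text \<open>The bridge to the real theory: a factorization of the real part lifts to one of \<psi>,
  because a functional is determined by its real part.\<close>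

lemma P_iff: "\<psi> \<in> P \<longleftrightarrow> \<psi> \<in> vcarrier X' \<and> Re_dual \<psi> \<in> smooth_functionals B"
proof
  assume \<psi>: "\<psi> \<in> P"
  have "\<exists>\<xi>. Re_dual \<psi> = \<xi> o\<^sub>L bpow B n" for n
  proof (cases n)
    case 0
    then show ?thesis by (intro exI[of _ "Re_dual \<psi>"]) (simp add: blinfun_compose_id_right)
  next
    case (Suc m)
    show ?thesis
      unfolding Suc by (rule exI, rule Re_dual_component[OF \<psi>])
  qed
  then show "\<psi> \<in> vcarrier X' \<and> Re_dual \<psi> \<in> smooth_functionals B"
    using \<psi> P_subset by (auto simp: smooth_functionals_def)
next
  assume \<psi>: "\<psi> \<in> vcarrier X' \<and> Re_dual \<psi> \<in> smooth_functionals B"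
  have "\<exists>\<phi>. \<psi> = \<phi> \<circ> (b ^^ Suc n) \<and> \<phi> \<in> vcarrier X'" for n
  proof -
    obtain \<xi> where \<xi>: "Re_dual \<psi> = \<xi> o\<^sub>L bpow B (Suc n)"
      using \<psi> unfolding smooth_functionals_def by blast
    obtain \<phi> where \<phi>: "\<phi> \<in> vcarrier X'" "Re_dual \<phi> = \<xi>" by (rule Re_dual_surj)
    have "\<psi> = \<phi> \<circ> (b ^^ Suc n)"
      by (rule Re_dual_eqD[OF _ compose_bn(1)[OF \<phi>(1)]]) (use \<psi> \<xi> \<phi>(2) compose_bn(2)[OF \<phi>(1), of "Suc n"] in \<open>simp_all only:\<close>)
    then show ?thesis using \<phi>(1) by blast
  qed
  then show "\<psi> \<in> P" unfolding P_eq by blast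
qed

lemma P_compose:
  assumes "\<phi> \<in> P"
  shows "\<phi> \<circ> (b ^^ n) \<in> P"
  using assms smooth_functionals_compose compose_bn(1,2) unfolding P_iff by metis

text \<open>P is invariant under the dual operator because smooth functionals have smooth factors.
  This is what allows \<open>eval_surj\<close> to use density of P in the dual.\<close>

lemma component_P:
  assumes "\<psi> \<in> P"
  shows "component n \<psi> \<in> P"
proof -
  have "Re_dual \<psi> \<in> smooth_functionals B" using assms P_iff by blast
  then obtain \<xi> where \<xi>: "\<xi> \<in> smooth_functionals B" "Re_dual \<psi> = \<xi> o\<^sub>L bpow B (Suc n)"
    by (rule smooth_functionals_decompose)
  have "Re_dual (component n \<psi>) = \<xi>"
    by (rule compose_bpow_cancel[of _ "Suc n"]) (simp only: \<xi>(2)[symmetric] Re_dual_component[OF assms, symmetric])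
  then show ?thesis using \<xi>(1) component(1)[OF assms] unfolding P_iff by blast
qed

text \<open>Formally the pairing of \<psi> with A^(n+1) x. If x is the image of z under the power n
  + 1 of \<open>b\<close>, the value is \<psi>(z), so the pairing of X with its dual is
  extended.\<close>

definition eval :: "nat \<Rightarrow> 'a \<Rightarrow> ('a \<Rightarrow> 'k) \<Rightarrow> 'k" where
  "eval n x = (\<lambda>\<psi>\<in>P. component n \<psi> x)"

lemma eval_apply: "\<psi> \<in> P \<Longrightarrow> eval n x \<psi> = component n \<psi> x"
  by (simp add: eval_def)

lemma component_norm_le: "\<psi> \<in> P \<Longrightarrow> vnorm X' (component n \<psi>) \<le> proj.sum_norm n \<psi>"
  using proj.norm_le_sum_norm[of n n \<psi>] X.dual_norm_nonneg[OF subsetD[OF P_subset, of \<psi>]]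
  unfolding interpolation_simps by simp

text \<open>Lower components, and \<psi> itself, arise from the k-th component by composition with
  bounded powers of \<open>b\<close>. Up to constants the k-th seminorm is thus the norm of one
  component.\<close>

lemma sum_norm_le:
  obtains C where "C \<ge> 0" and "\<And>\<psi>. \<psi> \<in> P \<Longrightarrow> proj.sum_norm k \<psi> \<le> C * vnorm X' (component k \<psi>)"
proof -
  define C where "C i = onorm (b ^^ Suc k) + onorm (b ^^ (k - i))" for i
  have C: "C i \<ge> 0" for i
    unfolding C_def by (intro add_nonneg_nonneg onorm_pos_le bounded_linear_bn)
  have "proj.sum_norm k \<psi> \<le> (\<Sum>i\<le>k. C i) * vnorm X' (component k \<psi>)" if \<psi>: "\<psi> \<in> P" for \<psi>
    unfolding proj.sum_norm_def sum_distrib_right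
  proof (rule sum_mono)
    fix i assume i: "i \<in> {..k}"
    have "vnorm X' \<psi> \<le> onorm (b ^^ Suc k) * vnorm X' (component k \<psi>)"
      using compose_bn(3)[OF component(1)[OF \<psi>], of k "Suc k"] component(2)[OF \<psi>, of k] by metis
    moreover have "vnorm X' (component i \<psi>) \<le> onorm (b ^^ (k - i)) * vnorm X' (component k \<psi>)"
      using compose_bn(3)[OF component(1)[OF \<psi>], of k "k - i"] component_compose[OF \<psi>, of i k] i by (metis atMost_iff)
    ultimately show "vnorm (interpolation i) \<psi> \<le> C i * vnorm X' (component k \<psi>)"
      unfolding interpolation_simps C_def distrib_right by (rule add_mono)
  qed
  then show thesis using that[of "\<Sum>i\<le>k. C i"] C by (simp add: sum_nonneg)
qed

abbreviation "dual_P \<equiv> dual_vspace proj.tvs"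

lemma dual_P_iff:
  "f \<in> vcarrier dual_P \<longleftrightarrow> f \<in> extensional P \<and>
    (\<forall>\<phi>\<in>P. \<forall>\<psi>\<in>P. f (vadd X' \<phi> \<psi>) = f \<phi> + f \<psi>) \<and> (\<forall>c. \<forall>\<psi>\<in>P. f (vscale X' c \<psi>) = c * f \<psi>) \<and>
    (\<exists>k. \<exists>K\<ge>0. \<forall>\<psi>\<in>P. norm (f \<psi>) \<le> K * proj.sum_norm k \<psi>)"
  unfolding proj.dual_tvs_iff intersection_ops by auto

lemma P_add: "\<phi> \<in> P \<Longrightarrow> \<psi> \<in> P \<Longrightarrow> vadd X' \<phi> \<psi> \<in> P"
  using proj.add_closed unfolding intersection_ops .

lemma P_scale: "\<phi> \<in> P \<Longrightarrow> vscale X' c \<phi> \<in> P"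
  using proj.scale_closed unfolding intersection_ops .

lemma eval_in_dual: "eval n x \<in> vcarrier dual_P"
  unfolding dual_P_iff
proof (intro conjI ballI allI)
  show "eval n x \<in> extensional P" by (simp add: eval_def)
  fix \<psi> assume \<psi>: "\<psi> \<in> P"
  show "eval n x (vadd X' \<psi> \<phi>) = eval n x \<psi> + eval n x \<phi>" if \<phi>: "\<phi> \<in> P" for \<phi>
    unfolding eval_apply[OF \<psi>] eval_apply[OF \<phi>] eval_apply[OF P_add[OF \<psi> \<phi>]] component_add[OF \<psi> \<phi>]
    by (simp only: X'_simps)
  show "eval n x (vscale X' c \<psi>) = c * eval n x \<psi>" for c
    unfolding eval_apply[OF \<psi>] eval_apply[OF P_scale[OF \<psi>]] component_scale[OF \<psi>]
    by (simp only: X'_simps)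
next
  show "\<exists>k. \<exists>K\<ge>0. \<forall>\<psi>\<in>P. norm (eval n x \<psi>) \<le> K * proj.sum_norm k \<psi>"
  proof (intro exI[of _ n] exI[of _ "norm x"] conjI ballI)
    fix \<psi> assume \<psi>: "\<psi> \<in> P"
    have "norm (component n \<psi> x) \<le> vnorm X' (component n \<psi>) * norm x"
      by (rule dual_bound[OF component(1)[OF \<psi>]])
    also have "\<dots> \<le> proj.sum_norm n \<psi> * norm x"
      by (rule mult_right_mono[OF component_norm_le[OF \<psi>]]) simp
    finally show "norm (eval n x \<psi>) \<le> norm x * proj.sum_norm n \<psi>"
      by (simp only: eval_apply[OF \<psi>] mult.commute)
  qed simp
qed

lemma component_linear:
  assumes "\<psi> \<in> P"
  shows "component n \<psi> (x + y) = component n \<psi> x + component n \<psi> y"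
    and "component n \<psi> (smul c x) = c * component n \<psi> x"
  using component(1)[OF assms, of n] unfolding X'_iff by blast+

lemma tvs_P_carrier: "vcarrier proj.tvs = P"
  by (rule proj.tvs_simps(1))

lemma eval_add: "eval n (x + y) = vadd dual_P (eval n x) (eval n y)"
  unfolding dual_vspace_simps tvs_P_carrier
  by (rule ext) (auto simp: eval_def component_linear simp del: funpow.simps)

lemma eval_smul: "eval n (smul c x) = vscale dual_P c (eval n x)"
  unfolding dual_vspace_simps tvs_P_carrier
  by (rule ext) (auto simp: eval_def component_linear simp del: funpow.simps)

text \<open>Passing to a higher level applies \<open>b\<close>, exactly as the linking maps do in
  the coordinates of X.\<close>

lemma eval_shift: "n \<le> m \<Longrightarrow> eval n x = eval m ((b ^^ (m - n)) x)"
  by (rule ext) (auto simp: eval_def component_compose[of _ n m] simp del: funpow.simps)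

text \<open>Every \<phi> in P is the n-th component of an element of P, namely of its composition
  with the power n + 1 of \<open>b\<close>. Hence x and y agree on P, which separates
  points.\<close>

lemma eval_inj: "eval n x = eval n y \<Longrightarrow> x = y"
proof -
  assume eq: "eval n x = eval n y"
  have "x - y = 0"
  proof (rule smooth_functionals_separate)
    fix g :: "'a \<Rightarrow>\<^sub>L real" assume g: "g \<in> smooth_functionals B"
    obtain \<phi> where \<phi>: "\<phi> \<in> vcarrier X'" "Re_dual \<phi> = g" by (rule Re_dual_surj)
    then have \<phi>P: "\<phi> \<in> P" using g P_iff by blast
    have c: "component n (\<phi> \<circ> (b ^^ Suc n)) = \<phi>" by (rule component_unique[OF \<phi>(1) refl])
    have "\<phi> x = \<phi> y"
      using fun_cong[OF eq, of "\<phi> \<circ> (b ^^ Suc n)"]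
      unfolding eval_apply[OF P_compose[OF \<phi>P]] c .
    then show "blinfun_apply g (x - y) = 0"
      using Re_dual_apply[OF \<phi>(1)] \<phi>(2) by (simp add: blinfun.diff_right)
  qed
  then show ?thesis by simp
qed

lemma norm_Re_dual_ge: "\<phi> \<in> vcarrier X' \<Longrightarrow> vnorm X' \<phi> \<le> norm (Re_dual \<phi>)"
  using Re_dual_surj[of "Re_dual \<phi>"] Re_dual_eqD by metis

text \<open>A continuous functional is bounded by some \<open>sum_norm k\<close>, hence by the norm
  of the k-th component, and so represented by a point at level k.\<close>

lemma eval_surj:
  assumes f: "f \<in> vcarrier dual_P"
  obtains n x where "f = eval n x"
proof -
  note f' = iffD1[OF dual_P_iff f]
  have f_ext: "f \<in> extensional P"
    by (rule conjunct1[OF f'])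
  have f_add: "f (vadd X' \<phi> \<psi>) = f \<phi> + f \<psi>" if "\<phi> \<in> P" "\<psi> \<in> P" for \<phi> \<psi>
    by (rule conjunct1[OF conjunct2[OF f'], rule_format]) (rule that)+
  have f_scale: "f (vscale X' c \<psi>) = c * f \<psi>" if "\<psi> \<in> P" for c \<psi>
    by (rule conjunct1[OF conjunct2[OF conjunct2[OF f']], rule_format]) (rule that)
  obtain k K where K: "K \<ge> 0" "\<And>\<psi>. \<psi> \<in> P \<Longrightarrow> norm (f \<psi>) \<le> K * proj.sum_norm k \<psi>"
    using conjunct2[OF conjunct2[OF conjunct2[OF f']]] by blast
  obtain C where C: "C \<ge> 0" "\<And>\<psi>. \<psi> \<in> P \<Longrightarrow> proj.sum_norm k \<psi> \<le> C * vnorm X' (component k \<psi>)"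
    by (rule sum_norm_le[of k]) blast
  \<comment> \<open>The inverse of \<open>Re_dual\<close>, which moves the real part of
    \<open>f\<close> onto the smooth functionals.\<close>
  define lift where "lift g = (THE \<phi>. \<phi> \<in> vcarrier X' \<and> Re_dual \<phi> = g)" for g
  have lift: "lift (Re_dual \<phi>) = \<phi>" if "\<phi> \<in> vcarrier X'" for \<phi>
    unfolding lift_def by (rule the_equality) (use that Re_dual_eqD in auto)
  have lift_ex: "\<exists>\<phi>\<in>P. Re_dual \<phi> = g" if "g \<in> smooth_functionals B" for g
    using Re_dual_surj[of g] that P_iff by metis
  obtain x where x: "\<And>g. g \<in> smooth_functionals B \<Longrightarrow> kre (f (lift (g o\<^sub>L bpow B (Suc k)))) = blinfun_apply g x"
  proof (rule functional_on_smooth_is_evaluation[of "\<lambda>g. kre (f (lift g))" "Suc k" "K * C"])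
    fix g h :: "'a \<Rightarrow>\<^sub>L real" assume g: "g \<in> smooth_functionals B" and h: "h \<in> smooth_functionals B"
    obtain \<phi> \<psi> where *: "\<phi> \<in> P" "Re_dual \<phi> = g" "\<psi> \<in> P" "Re_dual \<psi> = h"
      using lift_ex g h by metis
    then have X': "\<phi> \<in> vcarrier X'" "\<psi> \<in> vcarrier X'" using P_subset by auto
    have "lift (g + h) = vadd X' \<phi> \<psi>"
      using Re_dual_add[OF X'] lift[OF X'.add_closed[OF X']] * by simp
    moreover have "lift g = \<phi>" "lift h = \<psi>" using lift X' * by auto
    ultimately show "kre (f (lift (g + h))) = kre (f (lift g)) + kre (f (lift h))"
      using f_add * by (simp add: kre_add)
  next
    fix r and g :: "'a \<Rightarrow>\<^sub>L real" assume g: "g \<in> smooth_functionals B"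
    obtain \<phi> where *: "\<phi> \<in> P" "Re_dual \<phi> = g" using lift_ex g by metis
    then have X': "\<phi> \<in> vcarrier X'" using P_subset by auto
    have "lift (r *\<^sub>R g) = vscale X' (of_real r) \<phi>"
      using Re_dual_scale[OF X'] lift[OF X'.scale_closed[OF X']] * by metis
    moreover have "lift g = \<phi>" using lift X' * by auto
    ultimately show "kre (f (lift (r *\<^sub>R g))) = r * kre (f (lift g))"
      using f_scale * by (simp add: kre_scaleR flip: scaleR_conv_of_real)
  next
    fix g :: "'a \<Rightarrow>\<^sub>L real" assume g: "g \<in> smooth_functionals B"
    obtain \<phi> where *: "\<phi> \<in> P" "Re_dual \<phi> = g" using lift_ex g by metis
    then have X': "\<phi> \<in> vcarrier X'" using P_subset by auto
    have "lift (g o\<^sub>L bpow B (Suc k)) = \<phi> \<circ> (b ^^ Suc k)"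
      using lift[OF compose_bn(1)[OF X']] compose_bn(2)[OF X'] *(2) by metis
    then have "\<bar>kre (f (lift (g o\<^sub>L bpow B (Suc k))))\<bar> \<le> norm (f (\<phi> \<circ> (b ^^ Suc k)))"
      using abs_kre_le by metis
    also have "\<dots> \<le> K * proj.sum_norm k (\<phi> \<circ> (b ^^ Suc k))"
      by (rule K(2)[OF P_compose[OF *(1)]])
    also have "\<dots> \<le> K * (C * vnorm X' (component k (\<phi> \<circ> (b ^^ Suc k))))"
      by (rule mult_left_mono[OF C(2)[OF P_compose[OF *(1)]] K(1)])
    also have "component k (\<phi> \<circ> (b ^^ Suc k)) = \<phi>"
      by (rule component_unique[OF X' refl])
    also have "K * (C * vnorm X' \<phi>) \<le> K * (C * norm g)"
      using norm_Re_dual_ge[OF X'] *(2) K(1) C(1) by (intro mult_left_mono) auto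
    finally show "\<bar>kre (f (lift (g o\<^sub>L bpow B (Suc k))))\<bar> \<le> K * C * norm g"
      by (simp only: mult.assoc)
  qed (use K C in auto)
  have re: "kre (f \<psi>) = kre (component k \<psi> x)" if \<psi>: "\<psi> \<in> P" for \<psi>
  proof -
    have c: "component k \<psi> \<in> P" "component k \<psi> \<in> vcarrier X'"
      by (rule component_P[OF \<psi>], rule component(1)[OF \<psi>])
    have "lift (Re_dual (component k \<psi>) o\<^sub>L bpow B (Suc k)) = \<psi>"
      unfolding Re_dual_component[OF \<psi>, symmetric] by (rule lift[OF subsetD[OF P_subset \<psi>]])
    from x[OF conjunct2[OF iffD1[OF P_iff c(1)]], unfolded this] show ?thesis
      unfolding Re_dual_apply[OF c(2)] .
  qed
  have "f \<psi> = eval k x \<psi>" for \<psi>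
  proof (cases "\<psi> \<in> P")
    case True
    have "f \<psi> = component k \<psi> x"
    \<comment> \<open>Real parts agree on all of P, in particular at every multiple of \<psi>; this
      determines the values in \<open>'k\<close>.\<close>
    proof (rule kre_eqI)
      fix c
      have "kre (f (vscale X' c \<psi>)) = kre (component k (vscale X' c \<psi>) x)"
        by (rule re[OF P_scale[OF True]])
      then show "kre (c * f \<psi>) = kre (c * component k \<psi> x)"
        unfolding component_scale[OF True] f_scale[OF True] by (simp only: X'_simps)
    qed
    then show ?thesis by (simp only: eval_apply[OF True])
  next
    case False
    then show ?thesis
      by (simp only: eval_def restrict_apply if_False) (rule extensional_arb[OF f_ext])
  qed
  then have "f = eval k x" by (rule ext)
  then show thesis by (rule that)
qed

text \<open>The real statement carried over to \<open>'k\<close>: bounded real families lift to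
  elements of P without loss of norm, and the identity of real parts at all multiples of \<psi>
  gives the full identity.\<close>

lemma eval_bounded_decomposition:
  assumes c: "\<And>n. 0 \<le> c n"
    and bound: "\<And>\<psi>. \<psi> \<in> P \<Longrightarrow> (\<And>n. vnorm X' (component n \<psi>) \<le> c n) \<Longrightarrow> norm (eval m y \<psi>) \<le> 1"
  obtains N x where "(\<Sum>i<N. c i * norm (x i)) < 2"
    and "\<And>\<psi>. \<psi> \<in> P \<Longrightarrow> eval m y \<psi> = (\<Sum>i<N. eval i (x i) \<psi>)"
proof (rule evaluation_bounded_decomposition[of c m y])
  show "0 \<le> c n" for n by (rule c)
next
  fix \<psi>' :: "'a \<Rightarrow>\<^sub>L real" and \<xi> :: "nat \<Rightarrow> 'a \<Rightarrow>\<^sub>L real"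
  assume \<xi>: "\<And>n. \<psi>' = \<xi> n o\<^sub>L bpow B (Suc n)" "\<And>n. norm (\<xi> n) \<le> c n"
  have "\<exists>\<phi>. \<phi> \<in> vcarrier X' \<and> Re_dual \<phi> = \<xi> n \<and> vnorm X' \<phi> \<le> c n" for n
    using Re_dual_surj[of "\<xi> n"] \<xi>(2)[of n] order_trans by metis
  then obtain \<phi> where \<phi>: "\<And>n. \<phi> n \<in> vcarrier X'" "\<And>n. Re_dual (\<phi> n) = \<xi> n" "\<And>n. vnorm X' (\<phi> n) \<le> c n"
    by metis
  \<comment> \<open>Level 0 has order 1, hence \<open>Suc 0\<close>. All other lifts compose to the
    same \<psi>, because the real parts do.\<close>
  define \<psi> where "\<psi> = \<phi> 0 \<circ> (b ^^ Suc 0)"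
  have \<psi>: "\<psi> = \<phi> n \<circ> (b ^^ Suc n)" for n
  proof (rule Re_dual_eqD)
    show "\<psi> \<in> vcarrier X'" "\<phi> n \<circ> (b ^^ Suc n) \<in> vcarrier X'"
      unfolding \<psi>_def by (rule compose_bn(1)[OF \<phi>(1)])+
    show "Re_dual \<psi> = Re_dual (\<phi> n \<circ> (b ^^ Suc n))"
      unfolding \<psi>_def compose_bn(2)[OF \<phi>(1)] \<phi>(2) using \<xi>(1) by metis
  qed
  have P: "\<psi> \<in> P" unfolding P_eq using \<psi> \<phi>(1) by blast
  have comp: "component n \<psi> = \<phi> n" for n by (rule component_unique[OF \<phi>(1) \<psi>])
  have "norm (\<phi> m y) \<le> 1"
    using bound[OF P] \<phi>(3) unfolding comp eval_apply[OF P] by blast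
  then show "\<xi> m y \<le> 1"
    using abs_kre_le[of "\<phi> m y"] Re_dual_apply[OF \<phi>(1), of m y] \<phi>(2)[of m] by simp
next
  fix N x
  assume sum: "(\<Sum>i<N. c i * norm (x i)) < 2"
    and eq: "\<And>(\<psi>' :: 'a \<Rightarrow>\<^sub>L real) (\<xi> :: nat \<Rightarrow> 'a \<Rightarrow>\<^sub>L real).
      (\<And>n. \<psi>' = \<xi> n o\<^sub>L bpow B (Suc n)) \<Longrightarrow> \<xi> m y = (\<Sum>i<N. \<xi> i (x i))"
  have re: "kre (component m \<psi> y) = kre (\<Sum>i<N. component i \<psi> (x i))" if \<psi>: "\<psi> \<in> P" for \<psi>
  proof -
    from eq[of "Re_dual \<psi>", OF Re_dual_component[OF \<psi>]] show ?thesis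
      unfolding Re_dual_apply[OF component(1)[OF \<psi>]] kre_sum .
  qed
  have "eval m y \<psi> = (\<Sum>i<N. eval i (x i) \<psi>)" if \<psi>: "\<psi> \<in> P" for \<psi>
    unfolding eval_apply[OF \<psi>]
  proof (rule kre_eqI)
    fix c
    show "kre (c * component m \<psi> y) = kre (c * (\<Sum>i<N. component i \<psi> (x i)))"
      using re[OF P_scale[OF \<psi>, of c]] unfolding component_scale[OF \<psi>] sum_distrib_left
      by (simp only: X'_simps)
  qed
  then show thesis using that sum by blast
qed

lemma bounded_polar_set:
  "tvs_bounded proj.tvs {\<psi> \<in> P. \<forall>n. vnorm X' (component n \<psi>) \<le> c n}"
  unfolding proj.tvs_def proj.tvs_bounded_iff
proof (intro conjI ballI)
  fix p assume "p \<in> range proj.sum_norm"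
  then obtain k where k: "p = proj.sum_norm k" by blast
  obtain C where C: "C \<ge> 0" "\<And>\<psi>. \<psi> \<in> P \<Longrightarrow> proj.sum_norm k \<psi> \<le> C * vnorm X' (component k \<psi>)"
    by (rule sum_norm_le[of k]) blast
  have "p \<psi> \<le> C * c k" if \<psi>: "\<psi> \<in> P" "\<forall>n. vnorm X' (component n \<psi>) \<le> c n" for \<psi>
  proof -
    have "p \<psi> \<le> C * vnorm X' (component k \<psi>)" unfolding k by (rule C(2)[OF \<psi>(1)])
    also have "\<dots> \<le> C * c k" using \<psi>(2) C(1) by (intro mult_left_mono) blast+
    finally show ?thesis .
  qed
  then show "\<exists>K. \<forall>\<psi>\<in>{\<psi> \<in> P. \<forall>n. vnorm X' (component n \<psi>) \<le> c n}. p \<psi> \<le> K" by blast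
qed blast

section \<open>The extrapolation spaces\<close>


abbreviation "Y \<equiv> extrapolation_norm_space smul D A"
abbreviation "Z \<equiv> extrapolation_space smul D A"

lemma Y_simps:
  "vcarrier (Y n) = UNIV" "vadd (Y n) = (+)" "vzero (Y n) = 0" "vscale (Y n) = smul"
  "vnorm (Y n) = (\<lambda>x. norm ((b ^^ n) x))"
  by (simp_all add: extrapolation_norm_space_def with_norm_def whole_space_def)

lemma bn_zero: "(b ^^ n) 0 = 0"
  by (rule linear_0[OF bounded_linear.linear[OF bounded_linear_bn]])

lemma bn_diff: "(b ^^ n) (x - y) = (b ^^ n) x - (b ^^ n) y"
  by (rule linear_diff[OF bounded_linear.linear[OF bounded_linear_bn]])

lemma normed_carrier_space_Y: "normed_carrier_space (Y n)"
proof
  fix x assume "vnorm (Y n) x = 0"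
  then have "(b ^^ n) x = (b ^^ n) 0" by (simp add: Y_simps bn_zero)
  then show "x = vzero (Y n)" by (simp add: Y_simps inj_eq[OF inj_bn])
qed (auto simp: Y_simps add.assoc scale_right_distrib scale_left_distrib bn_add bn_smul norm_scale
    norm_triangle_ineq)

lemma ndist_Y: "ndist (Y n) x y = dist ((b ^^ n) x) ((b ^^ n) y)"
  by (simp add: ndist_def vsub_def Y_simps dist_norm flip: bn_diff)

text \<open>The class of the completion belonging to the point \<open>y\<close> of \<open>X\<close>, under the isometry of
  \<open>X\<^sub>-\<^sub>n\<close> with \<open>X\<close> that extends \<open>A\<close> to the power \<open>-n\<close>.\<close>

definition cls :: "nat \<Rightarrow> 'a \<Rightarrow> (nat \<Rightarrow> 'a) set" where
  "cls n y = {v. (\<lambda>k. (b ^^ n) (v k)) \<longlonglongrightarrow> y}"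

text \<open>\<open>b ^^ n\<close> turns the metric of \<open>Y n\<close> into that of X, where
  Cauchy sequences converge; the limit labels the class.\<close>

lemma MCauchy_Y:
  "Metric_space.MCauchy (vcarrier (Y n)) (ndist (Y n)) u \<longleftrightarrow> (\<exists>y. u \<in> cls n y)"
proof -
  interpret Y: normed_carrier_space "Y n" by (rule normed_carrier_space_Y)
  have "Y.dist.MCauchy u \<longleftrightarrow> Cauchy (\<lambda>k. (b ^^ n) (u k))"
    unfolding Y.dist.MCauchy_def Cauchy_def ndist_Y by (auto simp: Y_simps)
  then show ?thesis
    by (simp add: Cauchy_convergent_iff convergent_def cls_def)
qed

lemma cls_unique: "u \<in> cls n x \<Longrightarrow> u \<in> cls n y \<Longrightarrow> x = y"
  unfolding cls_def by (blast intro: LIMSEQ_unique)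

text \<open>Dense range of the n-th power of \<open>b\<close> makes every point of X a label of the
  completion.\<close>

lemma cls_nonempty: "\<exists>u. u \<in> cls n y"
proof -
  have "y \<in> closure (range (b ^^ n))" by (simp add: dense_range_bn)
  then obtain s where s: "\<And>k. s k \<in> range (b ^^ n)" "s \<longlonglongrightarrow> y"
    unfolding closure_sequential by blast
  then have "\<exists>u. \<forall>k. s k = (b ^^ n) (u k)" by (intro choice) blast
  then obtain u where "\<And>k. s k = (b ^^ n) (u k)" by blast
  then have "s = (\<lambda>k. (b ^^ n) (u k))" by (rule ext)
  then show ?thesis using s(2) unfolding cls_def by blast
qed

lemma cls_inj: "cls n x = cls n y \<Longrightarrow> x = y"
  using cls_nonempty[of n x] cls_unique by metis

lemma cauchy_rel_Y: "(u, v) \<in> cauchy_rel (Y n) \<longleftrightarrow> (\<exists>y. u \<in> cls n y \<and> v \<in> cls n y)"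
proof
  assume "(u, v) \<in> cauchy_rel (Y n)"
  then obtain x y where x: "u \<in> cls n x" and y: "v \<in> cls n y"
    and lim: "(\<lambda>k. ndist (Y n) (u k) (v k)) \<longlonglongrightarrow> 0"
    unfolding cauchy_rel_def MCauchy_Y by blast
  have "(\<lambda>k. ndist (Y n) (u k) (v k)) \<longlonglongrightarrow> dist x y"
    unfolding ndist_Y using x y unfolding cls_def by (intro tendsto_dist) auto
  then have "dist x y = 0" using lim LIMSEQ_unique by blast
  then show "\<exists>y. u \<in> cls n y \<and> v \<in> cls n y" using x y by auto
next
  assume "\<exists>y. u \<in> cls n y \<and> v \<in> cls n y"
  then obtain y where y: "u \<in> cls n y" "v \<in> cls n y" by blast
  have "(\<lambda>k. ndist (Y n) (u k) (v k)) \<longlonglongrightarrow> dist y y"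
    unfolding ndist_Y using y unfolding cls_def by (intro tendsto_dist) auto
  then show "(u, v) \<in> cauchy_rel (Y n)"
    using y unfolding cauchy_rel_def MCauchy_Y by auto
qed

lemma cauchy_rel_class: "u \<in> cls n y \<Longrightarrow> cauchy_rel (Y n) `` {u} = cls n y"
  by (auto simp: cauchy_rel_Y dest: cls_unique[of u n y])

lemma cls_add: "u \<in> cls n x \<Longrightarrow> v \<in> cls n y \<Longrightarrow> (\<lambda>k. u k + v k) \<in> cls n (x + y)"
  unfolding cls_def by (auto simp: bn_add intro: tendsto_add)

lemma bounded_linear_smul: "bounded_linear (smul c)"
  by (rule bounded_linear_intro[of _ "norm c"])
    (auto simp: scale_right_distrib norm_scale mult.commute simp flip: scale_of_real)

lemma cls_smul: "u \<in> cls n x \<Longrightarrow> (\<lambda>k. smul c (u k)) \<in> cls n (smul c x)"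
  unfolding cls_def by (auto simp: bn_smul intro: bounded_linear.tendsto[OF bounded_linear_smul])

lemma Z_carrier: "vcarrier (Z n) = range (cls n)"
proof -
  have "vcarrier (Z n) = {u. \<exists>y. u \<in> cls n y} // cauchy_rel (Y n)"
    by (simp add: extrapolation_space_def completion_def MCauchy_Y)
  also have "\<dots> = range (cls n)"
  proof (intro set_eqI iffI)
    fix \<xi> assume "\<xi> \<in> {u. \<exists>y. u \<in> cls n y} // cauchy_rel (Y n)"
    then show "\<xi> \<in> range (cls n)"
      by (auto elim!: quotientE simp: cauchy_rel_class)
  next
    fix \<xi> assume "\<xi> \<in> range (cls n)"
    then obtain y where y: "\<xi> = cls n y" by blast
    obtain u where u: "u \<in> cls n y" using cls_nonempty by blast
    have "cauchy_rel (Y n) `` {u} \<in> {u. \<exists>y. u \<in> cls n y} // cauchy_rel (Y n)"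
      using u by (intro quotientI) blast
    then show "\<xi> \<in> {u. \<exists>y. u \<in> cls n y} // cauchy_rel (Y n)"
      by (simp only: cauchy_rel_class[OF u] y)
  qed
  finally show ?thesis .
qed

lemma Z_add: "vadd (Z n) (cls n x) (cls n y) = cls n (x + y)"
proof -
  have "vadd (Z n) (cls n x) (cls n y) =
      (\<Union>u\<in>cls n x. \<Union>v\<in>cls n y. cauchy_rel (Y n) `` {\<lambda>k. u k + v k})"
    by (simp add: extrapolation_space_def completion_def Y_simps)
  \<comment> \<open>All representatives yield the same class, so the union in the definition
    collapses once representatives exist.\<close>
  also have "\<dots> = (\<Union>u\<in>cls n x. \<Union>v\<in>cls n y. cls n (x + y))"
    by (intro SUP_cong refl cauchy_rel_class cls_add)
  also have "\<dots> = cls n (x + y)" using cls_nonempty by auto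
  finally show ?thesis .
qed

lemma Z_zero: "vzero (Z n) = cls n 0"
proof -
  have "(\<lambda>k. 0) \<in> cls n 0" by (simp add: cls_def bn_zero)
  then show ?thesis
    using cauchy_rel_class[of "\<lambda>k. 0" n 0]
    by (simp add: extrapolation_space_def completion_def Y_simps)
qed

lemma Z_scale: "vscale (Z n) c (cls n x) = cls n (smul c x)"
proof -
  have "vscale (Z n) c (cls n x) = (\<Union>u\<in>cls n x. cauchy_rel (Y n) `` {\<lambda>k. smul c (u k)})"
    by (simp add: extrapolation_space_def completion_def Y_simps)
  also have "\<dots> = (\<Union>u\<in>cls n x. cls n (smul c x))"
    by (intro SUP_cong refl cauchy_rel_class cls_smul)
  also have "\<dots> = cls n (smul c x)" using cls_nonempty by auto
  finally show ?thesis .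
qed

lemma Z_norm: "vnorm (Z n) (cls n x) = norm x"
proof -
  have "lim (\<lambda>k. norm ((b ^^ n) (u k))) = norm x" if "u \<in> cls n x" for u
    using that unfolding cls_def by (intro limI tendsto_norm) simp
  then have "(\<lambda>u. lim (\<lambda>k. norm ((b ^^ n) (u k)))) ` cls n x = {norm x}"
    using cls_nonempty[of n x] by (auto simp: image_iff)
  then show ?thesis
    by (simp add: extrapolation_space_def completion_def Y_simps)
qed

lemma completion_embed_eq: "completion_embed (Y n) x = cls n ((b ^^ n) x)"
  unfolding completion_embed_def by (rule cauchy_rel_class) (simp add: cls_def)

lemma Z_sub: "vsub (Z n) (cls n x) (cls n y) = cls n (x - y)"
  by (simp add: vsub_def Z_scale Z_add)

lemma normed_carrier_space_Z: "normed_carrier_space (Z n)"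
  by unfold_locales
    (auto simp: Z_carrier Z_add Z_zero Z_scale Z_norm ac_simps scale_right_distrib
      scale_left_distrib norm_triangle_ineq norm_scale)

section \<open>Topology and linking maps of the extrapolation spaces in coordinates of X\<close>

definition pt :: "nat \<Rightarrow> (nat \<Rightarrow> 'a) set \<Rightarrow> 'a" where
  "pt n \<xi> = (THE x. \<xi> = cls n x)"

lemma pt_cls: "pt n (cls n x) = x"
  unfolding pt_def by (rule the_equality) (auto dest: cls_inj)

lemma vtop_Z: "vtop (norm_tvs (Z n)) = seminorm_topology (Z n) {vnorm (Z n)}"
  by (simp add: normed_carrier_space.norm_tvs_eq[OF normed_carrier_space_Z] with_top_def)

lemma norm_tvs_simps:
  "vcarrier (norm_tvs N) = vcarrier N" "vadd (norm_tvs N) = vadd N" "vzero (norm_tvs N) = vzero N"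
  "vscale (norm_tvs N) = vscale N"
  by (simp_all add: norm_tvs_def with_top_def)

lemma openin_vtop_Z:
  "openin (vtop (norm_tvs (Z n))) U \<longleftrightarrow> U \<subseteq> range (cls n) \<and> open {x. cls n x \<in> U}"
proof -
  interpret Z: normed_carrier_space "Z n" by (rule normed_carrier_space_Z)
  show ?thesis
    unfolding vtop_Z Z.openin_seminorm_topology seminorm_open_def Z_carrier
  proof (intro conj_cong refl iffI)
    assume U: "U \<subseteq> range (cls n)"
    { assume nbhd: "\<forall>x\<in>U. \<exists>p\<in>{vnorm (Z n)}. \<exists>e>0. \<forall>y\<in>range (cls n). p (vsub (Z n) y x) < e \<longrightarrow> y \<in> U"
      show "open {x. cls n x \<in> U}"
        unfolding open_dist
      proof (intro ballI)
        fix x assume "x \<in> {x. cls n x \<in> U}"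
        then obtain e where "e > 0" "\<And>\<eta>. \<eta> \<in> range (cls n) \<Longrightarrow> vnorm (Z n) (vsub (Z n) \<eta> (cls n x)) < e \<Longrightarrow> \<eta> \<in> U"
          using nbhd by blast
        then show "\<exists>e>0. \<forall>y. dist y x < e \<longrightarrow> y \<in> {x. cls n x \<in> U}"
          by (auto simp: Z_sub Z_norm dist_norm)
      qed }
    assume "open {x. cls n x \<in> U}"
    then have "\<forall>x. cls n x \<in> U \<longrightarrow> (\<exists>e>0. \<forall>y. norm (y - x) < e \<longrightarrow> cls n y \<in> U)"
      unfolding open_dist dist_norm by blast
    then show "\<forall>x\<in>U. \<exists>p\<in>{vnorm (Z n)}. \<exists>e>0. \<forall>y\<in>range (cls n). p (vsub (Z n) y x) < e \<longrightarrow> y \<in> U"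
      using U by (auto simp: Z_sub Z_norm)
  qed
qed

lemma topspace_vtop_Z: "topspace (vtop (norm_tvs (Z n))) = range (cls n)"
proof -
  interpret Z: normed_carrier_space "Z n" by (rule normed_carrier_space_Z)
  show ?thesis by (simp add: vtop_Z Z.topspace_seminorm_topology Z_carrier)
qed

lemma continuous_map_pt: "continuous_map (vtop (norm_tvs (Z n))) euclidean (pt n)"
  unfolding continuous_map_def topspace_vtop_Z openin_vtop_Z by (auto simp: pt_cls)

lemma continuous_map_cls: "continuous_map euclidean (vtop (norm_tvs (Z n))) (cls n)"
  unfolding continuous_map_def topspace_vtop_Z openin_vtop_Z by auto

lemma extrapolation_link_cls:
  "extrapolation_link smul D A n (cls n x) = cls (Suc n) (b x)"
proof -
  let ?E = "norm_tvs (Z n)" and ?E' = "norm_tvs (Z (Suc n))"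
  let ?P = "\<lambda>f. f \<in> extensional (vcarrier ?E) \<and> linear_map ?E ?E' f \<and>
    continuous_map (vtop ?E) (vtop ?E') f \<and>
    (\<forall>x. f (completion_embed (Y n) x) = completion_embed (Y (Suc n)) x)"
  define f where "f = restrict (\<lambda>\<xi>. cls (Suc n) (b (pt n \<xi>))) (range (cls n))"
  have f_cls: "f (cls n x) = cls (Suc n) (b x)" for x
    by (simp add: f_def pt_cls)
  have "?P f"
  proof (intro conjI allI)
    show "f \<in> extensional (vcarrier ?E)" by (simp add: f_def norm_tvs_simps Z_carrier)
    show "linear_map ?E ?E' f"
      by (auto simp: linear_map_def norm_tvs_simps Z_carrier Z_add Z_scale f_cls b_add b_smul)
    have "continuous_map euclidean euclidean b"
      using linear_continuous_on[OF bounded_inverse] by simp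
    then have "continuous_map (vtop ?E) (vtop ?E') (cls (Suc n) \<circ> (b \<circ> pt n))"
      by (intro continuous_map_compose[OF _ continuous_map_cls] continuous_map_compose[OF continuous_map_pt])
    then show "continuous_map (vtop ?E) (vtop ?E') f"
      by (rule continuous_map_eq) (auto simp: topspace_vtop_Z f_cls pt_cls)
    show "f (completion_embed (Y n) x) = completion_embed (Y (Suc n)) x" for x
      by (simp add: completion_embed_eq f_cls)
  qed
  \<comment> \<open>In coordinates any other extension is a continuous map \<open>h\<close> of X. It
    agrees with \<open>b\<close> on the range of the n-th power of \<open>b\<close>, where the
    embedded copy of X sits, and that range is dense.\<close>
  moreover have "g = f" if g: "?P g" for g
  proof -
    have gc: "g (cls n x) \<in> range (cls (Suc n))" for x
      using g unfolding linear_map_def norm_tvs_simps Z_carrier by blast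
    define h where "h = pt (Suc n) \<circ> (g \<circ> cls n)"
    have "continuous_map euclidean euclidean h"
      unfolding h_def using g
      by (intro continuous_map_compose[OF _ continuous_map_pt] continuous_map_compose[OF continuous_map_cls]) blast
    then have h: "continuous_on UNIV h" by simp
    have "closed {x. h x = b x}"
      by (intro closed_Collect_eq h linear_continuous_on[OF bounded_inverse])
    moreover have "h ((b ^^ n) x) = b ((b ^^ n) x)" for x
      using g unfolding h_def completion_embed_eq by (simp add: pt_cls)
    ultimately have "closure (range (b ^^ n)) \<subseteq> {x. h x = b x}"
      by (intro closure_minimal) auto
    then have hb: "h x = b x" for x using dense_range_bn by auto
    have g_cls: "g (cls n x) = cls (Suc n) (b x)" for x
    proof -
      obtain y where "g (cls n x) = cls (Suc n) y" using gc by blast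
      then show ?thesis using hb[of x] by (simp add: h_def pt_cls)
    qed
    show "g = f"
    proof
      fix \<xi>
      show "g \<xi> = f \<xi>"
      proof (cases "\<xi> \<in> range (cls n)")
        case True
        then show ?thesis using g_cls f_cls by auto
      next
        case False
        have "g \<in> extensional (vcarrier ?E)" using g by blast
        then have "g \<xi> = undefined"
          by (rule extensional_arb) (simp add: norm_tvs_simps Z_carrier False)
        then show ?thesis using False by (simp add: f_def)
      qed
    qed
  qed
  ultimately have "(THE f. ?P f) = f" by (rule the_equality)
  then show ?thesis
    unfolding extrapolation_link_def Let_def by (simp only: f_cls)
qed


section \<open>The inductive limit\<close>

abbreviation "step n \<equiv> norm_tvs (extrapolation_space smul D A (Suc n))"
abbreviation "link n \<equiv> extrapolation_link smul D A (Suc n)"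
abbreviation "rel \<equiv> direct_rel (\<lambda>n. norm_tvs (extrapolation_space smul D A (Suc n)))
  (\<lambda>n. extrapolation_link smul D A (Suc n))"
abbreviation "ind \<equiv> direct_limit (\<lambda>n. norm_tvs (extrapolation_space smul D A (Suc n)))
  (\<lambda>n. extrapolation_link smul D A (Suc n))"

lemma transit_cls:
  assumes "n \<le> m"
  shows "transit (\<lambda>n. link n) n m (cls (Suc n) x) = cls (Suc m) ((b ^^ (m - n)) x)"
proof -
  have "transit_by (\<lambda>n. link n) n d (cls (Suc n) x) = cls (Suc (n + d)) ((b ^^ d) x)" for d
    by (induction d) (simp_all add: extrapolation_link_cls)
  then show ?thesis using assms by (simp add: transit_def)
qed

lemma step_carrier: "vcarrier (step n) = range (cls (Suc n))"
  by (simp add: norm_tvs_simps Z_carrier)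

text \<open>Identification at a later level k means equality of two points of X;
  \<open>eval_shift\<close> and \<open>eval_inj\<close> translate this into equality of functionals.
  This makes \<open>iso\<close> well defined and injective.\<close>

lemma rel_iff: "((n, cls (Suc n) x), (m, cls (Suc m) y)) \<in> rel \<longleftrightarrow> eval n x = eval m y"
proof
  assume "((n, cls (Suc n) x), (m, cls (Suc m) y)) \<in> rel"
  then obtain k where k: "n \<le> k" "m \<le> k"
    "transit (\<lambda>n. link n) n k (cls (Suc n) x) = transit (\<lambda>n. link n) m k (cls (Suc m) y)"
    by (auto simp: direct_rel_def)
  then have "(b ^^ (k - n)) x = (b ^^ (k - m)) y"
    by (simp add: transit_cls) (blast dest: cls_inj)
  then show "eval n x = eval m y"
    using eval_shift[OF k(1), of x] eval_shift[OF k(2), of y] by metis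
next
  assume eq: "eval n x = eval m y"
  define k where "k = max n m"
  have k: "n \<le> k" "m \<le> k" by (auto simp: k_def)
  have "eval k ((b ^^ (k - n)) x) = eval k ((b ^^ (k - m)) y)"
    using eq eval_shift[OF k(1), of x] eval_shift[OF k(2), of y] by metis
  then have "(b ^^ (k - n)) x = (b ^^ (k - m)) y" by (rule eval_inj)
  then have "transit (\<lambda>n. link n) n k (cls (Suc n) x) = transit (\<lambda>n. link n) m k (cls (Suc m) y)"
    by (simp add: transit_cls k)
  then show "((n, cls (Suc n) x), (m, cls (Suc m) y)) \<in> rel"
    using k by (auto simp: direct_rel_def step_carrier)
qed

text \<open>Since \<open>eval m y\<close> is the functional on the projective limit given by the element of
  \<open>X\<^sub>-\<^sub>m\<^sub>-\<^sub>1\<close> belonging to \<open>y\<close>, this is the isomorphism of the theorem.\<close>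

definition iso :: "(('a \<Rightarrow> 'k) \<Rightarrow> 'k) \<Rightarrow> (nat \<times> (nat \<Rightarrow> 'a) set) set" where
  "iso f = {(m, cls (Suc m) y) | m y. eval m y = f}"

lemma rel_class: "rel `` {(n, cls (Suc n) x)} = iso (eval n x)"
proof (intro set_eqI iffI)
  fix z assume "z \<in> rel `` {(n, cls (Suc n) x)}"
  then have z: "((n, cls (Suc n) x), z) \<in> rel" by simp
  then have "snd z \<in> range (cls (Suc (fst z)))"
    by (auto simp: direct_rel_def step_carrier split: prod.splits)
  then obtain y where "z = (fst z, cls (Suc (fst z)) y)" by (metis imageE prod.collapse)
  then show "z \<in> iso (eval n x)"
    using z rel_iff[of n x "fst z" y] unfolding iso_def by auto
next
  fix z assume "z \<in> iso (eval n x)"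
  then show "z \<in> rel `` {(n, cls (Suc n) x)}"
    by (auto simp: iso_def rel_iff)
qed

lemma iso_iff: "(m, \<xi>) \<in> iso f \<longleftrightarrow> (\<exists>y. \<xi> = cls (Suc m) y \<and> eval m y = f)"
  by (auto simp: iso_def)

lemma iso_nonempty: "f \<in> vcarrier dual_P \<Longrightarrow> \<exists>m y. (m, cls (Suc m) y) \<in> iso f"
  using eval_surj iso_iff by metis

lemma iso_inj: "f \<in> vcarrier dual_P \<Longrightarrow> iso f = iso g \<Longrightarrow> f = g"
  using iso_nonempty iso_iff cls_inj by metis

lemma ind_carrier: "vcarrier ind = iso ` vcarrier dual_P"
proof -
  have "vcarrier ind = (SIGMA n:UNIV. range (cls (Suc n))) // rel"
    by (simp add: direct_limit_def step_carrier)
  also have "\<dots> = iso ` vcarrier dual_P"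
  proof (intro set_eqI iffI)
    fix w assume "w \<in> (SIGMA n:UNIV. range (cls (Suc n))) // rel"
    then obtain n x where "w = rel `` {(n, cls (Suc n) x)}"
      by (auto elim!: quotientE)
    then show "w \<in> iso ` vcarrier dual_P"
      using rel_class eval_in_dual by blast
  next
    fix w assume "w \<in> iso ` vcarrier dual_P"
    then obtain f where f: "w = iso f" "f \<in> vcarrier dual_P" by blast
    obtain n x where x: "f = eval n x" by (rule eval_surj[OF f(2)])
    have "rel `` {(n, cls (Suc n) x)} \<in> (SIGMA n:UNIV. range (cls (Suc n))) // rel"
      by (rule quotientI) blast
    then show "w \<in> (SIGMA n:UNIV. range (cls (Suc n))) // rel"
      by (simp only: rel_class f(1) x)
  qed
  finally show ?thesis .
qed

lemma iso_add:
  assumes f: "f \<in> vcarrier dual_P" and g: "g \<in> vcarrier dual_P"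
  shows "vadd ind (iso f) (iso g) = iso (vadd dual_P f g)"
proof -
  have "(case p of (n, \<xi>) \<Rightarrow> case q of (m, \<eta>) \<Rightarrow> rel `` {(max n m, vadd (step (max n m))
      (transit (\<lambda>n. link n) n (max n m) \<xi>) (transit (\<lambda>n. link n) m (max n m) \<eta>))}) = iso (vadd dual_P f g)"
    if p: "p \<in> iso f" and q: "q \<in> iso g" for p q
  proof -
    obtain n x where x: "p = (n, cls (Suc n) x)" "eval n x = f" using p by (auto simp: iso_def)
    obtain m y where y: "q = (m, cls (Suc m) y)" "eval m y = g" using q by (auto simp: iso_def)
    define k where "k = max n m"
    have k: "n \<le> k" "m \<le> k" by (auto simp: k_def)
    have "eval k ((b ^^ (k - n)) x + (b ^^ (k - m)) y) = vadd dual_P f g"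
      unfolding eval_add eval_shift[OF k(1), symmetric] eval_shift[OF k(2), symmetric] x(2) y(2) ..
    then show ?thesis
      unfolding x(1) y(1) prod.case k_def[symmetric] transit_cls[OF k(1)] transit_cls[OF k(2)]
      by (simp add: norm_tvs_simps Z_add rel_class)
  qed
  note this[rule_format]
  moreover have "vadd ind (iso f) (iso g) = (\<Union>p\<in>iso f. \<Union>q\<in>iso g. case p of (n, \<xi>) \<Rightarrow> case q of (m, \<eta>) \<Rightarrow>
      rel `` {(max n m, vadd (step (max n m))
      (transit (\<lambda>n. link n) n (max n m) \<xi>) (transit (\<lambda>n. link n) m (max n m) \<eta>))})"
    unfolding direct_limit_def vspace.simps by (intro SUP_cong refl) (auto split: prod.splits)
  \<comment> \<open>The union over representatives is constant, and every class is nonempty by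
    \<open>eval_surj\<close>.\<close>
  ultimately have "vadd ind (iso f) (iso g) = (\<Union>p\<in>iso f. \<Union>q\<in>iso g. iso (vadd dual_P f g))"
    by simp
  then show ?thesis using iso_nonempty[OF f] iso_nonempty[OF g] by auto
qed

lemma iso_scale:
  assumes f: "f \<in> vcarrier dual_P"
  shows "vscale ind c (iso f) = iso (vscale dual_P c f)"
proof -
  have "(case p of (n, \<xi>) \<Rightarrow> rel `` {(n, vscale (step n) c \<xi>)}) = iso (vscale dual_P c f)" if p: "p \<in> iso f" for p
  proof -
    obtain m y where y: "p = (m, cls (Suc m) y)" "eval m y = f" using p by (auto simp: iso_def)
    then show ?thesis
      unfolding y(1) prod.case by (simp add: norm_tvs_simps Z_scale rel_class eval_smul)
  qed
  moreover have "vscale ind c (iso f) = (\<Union>p\<in>iso f. case p of (n, \<xi>) \<Rightarrow> rel `` {(n, vscale (step n) c \<xi>)})"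
    by (simp add: direct_limit_def)
  ultimately have "vscale ind c (iso f) = (\<Union>p\<in>iso f. iso (vscale dual_P c f))"
    by simp
  then show ?thesis using iso_nonempty[OF f] by auto
qed

lemma eval_zero: "eval n 0 = vzero dual_P"
  using eval_smul[of n 0 0] carrier_space.scale_zero[OF proj.carrier_space_dual_tvs eval_in_dual]
  by simp

lemma iso_zero: "vzero ind = iso (vzero dual_P)"
  by (simp add: direct_limit_def norm_tvs_simps Z_zero rel_class eval_zero)

lemma linear_map_iso: "linear_map dual_P ind iso"
  unfolding linear_map_def by (auto simp: ind_carrier iso_add iso_scale)

lemma bij_iso: "bij_betw iso (vcarrier dual_P) (vcarrier ind)"
  unfolding bij_betw_def ind_carrier by (auto intro: inj_onI iso_inj)


section \<open>The strong topology, carried over by iso, is the inductive limit topology\<close>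

abbreviation "dual_topology \<equiv> seminorm_topology dual_P (dual_seminorms proj.tvs)"
abbreviation "limit_topology \<equiv> pullback_topology (vcarrier ind) (inv_into (vcarrier dual_P) iso) dual_topology"

lemma carrier_space_dual_P: "carrier_space dual_P"
  by (rule proj.carrier_space_dual_tvs)

lemma linear_topology_dual_P: "linear_topology dual_P dual_topology"
  by (rule seminormed_space.linear_topology_seminorm_topology[OF proj.seminormed_space_dual])

lemmas limit_topology = linear_topology_transport[OF linear_map_iso bij_iso carrier_space_dual_P linear_topology_dual_P]

lemma openin_dual_topology: "openin dual_topology = strong_dual_open proj.tvs"
  using openin_strong_dual[of proj.tvs] by (simp add: proj.strong_dual_eq with_top_def)

text \<open>A bounded set has bounded n-th components, so evaluation there is Lipschitz in the
  point, uniformly over the set.\<close>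

lemma continuous_map_eval: "continuous_map euclidean dual_topology (eval n)"
proof -
  interpret dual: seminormed_space dual_P "dual_seminorms proj.tvs" by (rule proj.seminormed_space_dual)
  show ?thesis
  proof (rule dual.continuous_map_into)
    fix x p and e :: real assume p: "p \<in> dual_seminorms proj.tvs" and e: "e > 0"
    obtain M where M: "p = dual_seminorm proj.tvs M" "tvs_bounded proj.tvs M"
      using p by (auto simp: dual_seminorms_def)
    have "tvs_bounded proj.tvs (insert (vzero proj.tvs) M)"
      using tvs_bounded_Un[OF proj.tvs_bounded_singleton[OF proj.zero_closed] M(2)]
      by (simp add: proj.tvs_simps)
    then obtain K where K: "\<And>\<psi>. \<psi> \<in> insert (vzero proj.tvs) M \<Longrightarrow> proj.sum_norm n \<psi> \<le> K"
      unfolding proj.tvs_def proj.tvs_bounded_iff by blast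
    have le: "p (vsub dual_P (eval n y) (eval n x)) \<le> K * norm (y - x)" for y
      unfolding M(1)
    proof (rule proj.dual_seminorm_least)
      fix \<psi> assume \<psi>: "\<psi> \<in> insert (vzero proj.tvs) M"
      have \<psi>P: "\<psi> \<in> P" by (rule proj.bounded_carrier[OF M(2) \<psi>])
      have "eval n y \<psi> - eval n x \<psi> = component n \<psi> (y - x)"
        using component_linear(1)[OF \<psi>P, of n "y - x" x] by (simp add: eval_apply[OF \<psi>P] del: funpow.simps)
      then have "norm (vsub dual_P (eval n y) (eval n x) \<psi>) \<le> vnorm X' (component n \<psi>) * norm (y - x)"
        using dual_bound[OF component(1)[OF \<psi>P], of n "y - x"] \<psi>P
        by (simp add: vsub_dual_apply proj.tvs_simps del: funpow.simps)
      also have "\<dots> \<le> K * norm (y - x)"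
        using order_trans[OF component_norm_le[OF \<psi>P] K[OF \<psi>]] by (rule mult_right_mono) simp
      finally show "norm (vsub dual_P (eval n y) (eval n x) \<psi>) \<le> K * norm (y - x)" .
    qed
    define d where "d = e / (\<bar>K\<bar> + 1)"
    have d: "d > 0" using e by (simp add: d_def)
    have "p (vsub dual_P (eval n y) (eval n x)) < e" if "y \<in> ball x d" for y
    proof -
      have "p (vsub dual_P (eval n y) (eval n x)) \<le> \<bar>K\<bar> * norm (y - x)"
        using le[of y] mult_right_mono[OF abs_ge_self[of K] norm_ge_zero[of "y - x"]] by linarith
      also have "\<dots> \<le> \<bar>K\<bar> * d"
        using that by (intro mult_left_mono) (auto simp: dist_norm norm_minus_commute)
      also have "\<dots> < e" using e by (simp add: d_def field_simps)
      finally show ?thesis .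
    qed
    then show "\<exists>U. openin euclidean U \<and> x \<in> U \<and> (\<forall>y\<in>U. p (vsub dual_P (eval n y) (eval n x)) < e)"
      using d by (intro exI[of _ "ball x d"]) auto
  qed (rule eval_in_dual)
qed

lemma continuous_map_limit_topology:
  "continuous_map (vtop (step n)) limit_topology (\<lambda>\<xi>. rel `` {(n, \<xi>)})"
proof -
  have "continuous_map (vtop (step n)) limit_topology (iso \<circ> (eval n \<circ> pt (Suc n)))"
    by (rule continuous_map_compose[OF continuous_map_compose[OF continuous_map_pt continuous_map_eval]
          homeomorphic_imp_continuous_map[OF limit_topology(2)]])
  then show ?thesis
  proof (rule continuous_map_eq)
    fix \<xi> assume "\<xi> \<in> topspace (vtop (step n))"
    then obtain x where "\<xi> = cls (Suc n) x" unfolding topspace_vtop_Z by blast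
    then show "(iso \<circ> (eval n \<circ> pt (Suc n))) \<xi> = rel `` {(n, \<xi>)}"
      by (simp only: comp_apply pt_cls rel_class)
  qed
qed

text \<open>Continuity of addition at (0, 0), iterated. The sequence replaces the scaled copies of a
  convex neighborhood.\<close>

lemma halving_neighborhoods:
  assumes T: "linear_topology ind T" and U: "openin T U" "vzero ind \<in> U"
  obtains W where "W 0 = U" and "\<And>n. openin T (W n)" and "\<And>n. vzero ind \<in> W n"
    and "\<And>n v w. v \<in> W (Suc n) \<Longrightarrow> w \<in> W (Suc n) \<Longrightarrow> vadd ind v w \<in> W n"
proof -
  let ?Q = "\<lambda>U. openin T U \<and> vzero ind \<in> U"
  have zero: "vadd ind (vzero ind) (vzero ind) = vzero ind"
    unfolding iso_zero
    by (simp add: iso_add carrier_space.zero_closed[OF carrier_space_dual_P]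
        carrier_space.add_zero[OF carrier_space_dual_P])
  have "\<exists>U'. ?Q U' \<and> (\<forall>v\<in>U'. \<forall>w\<in>U'. vadd ind v w \<in> U)" if U: "?Q U" for U
  proof -
    have cont: "continuous_map (prod_topology T T) T (\<lambda>(x, y). vadd ind x y)"
      and top: "topspace T = vcarrier ind"
      using T by (simp_all add: linear_topology_def)
    define S where "S = {z \<in> topspace (prod_topology T T). (case z of (x, y) \<Rightarrow> vadd ind x y) \<in> U}"
    have S: "openin (prod_topology T T) S"
      unfolding S_def using U by (intro openin_continuous_map_preimage[OF cont]) blast
    have "(vzero ind, vzero ind) \<in> S"
      using U openin_subset[of T U] zero by (auto simp: S_def)
    from S[unfolded openin_prod_topology_alt, rule_format, OF this]
    obtain U1 U2 where U12: "openin T U1" "openin T U2" "vzero ind \<in> U1" "vzero ind \<in> U2"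
      "U1 \<times> U2 \<subseteq> S"
      by (elim exE conjE)
    have "vadd ind v w \<in> U" if "v \<in> U1 \<inter> U2" "w \<in> U1 \<inter> U2" for v w
    proof -
      have "(v, w) \<in> S" using that U12(5) by blast
      then show ?thesis by (simp add: S_def)
    qed
    then show ?thesis
      using U12 by (intro exI[of _ "U1 \<inter> U2"]) blast
  qed
  then obtain g where g: "\<And>U. ?Q U \<Longrightarrow> ?Q (g U) \<and> (\<forall>v\<in>g U. \<forall>w\<in>g U. vadd ind v w \<in> U)"
    by metis
  define W where "W = rec_nat U (\<lambda>_. g)"
  have W: "W 0 = U" "\<And>n. W (Suc n) = g (W n)" by (simp_all add: W_def)
  have Q: "?Q (W n)" for n by (induction n) (use U g in \<open>auto simp: W\<close>)
  show thesis
  proof (rule that[of W])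
    show "vadd ind v w \<in> W n" if "v \<in> W (Suc n)" "w \<in> W (Suc n)" for n v w
      using that g[OF Q[of n]] W(2) by auto
  qed (use W Q in auto)
qed

text \<open>The sum of the balls of radius \<open>\<epsilon> n\<close> of the steps lies in the given neighborhood, and it
  contains the polar of the bounded set on which the \<open>n\<close>-th norm is at most \<open>2 / \<epsilon> n\<close>.\<close>

lemma neighborhood_contains_polar:
  assumes T: "linear_topology ind T"
    and cont: "\<And>n. continuous_map (vtop (step n)) T (\<lambda>\<xi>. rel `` {(n, \<xi>)})"
    and U: "openin T U" "vzero ind \<in> U"
  obtains M where "tvs_bounded proj.tvs M"
    and "\<And>f. f \<in> vcarrier dual_P \<Longrightarrow> (\<And>\<psi>. \<psi> \<in> M \<Longrightarrow> norm (f \<psi>) \<le> 1) \<Longrightarrow> iso f \<in> U"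
proof -
  obtain W where W: "W 0 = U" "\<And>n. openin T (W n)" "\<And>n. vzero ind \<in> W n"
    "\<And>n v w. v \<in> W (Suc n) \<Longrightarrow> w \<in> W (Suc n) \<Longrightarrow> vadd ind v w \<in> W n"
    using halving_neighborhoods[OF T U] by metis
  \<comment> \<open>The n-th ball goes into \<open>W (Suc n)\<close>, not \<open>W n\<close>: its
    elements still have to be added to the sum of all later terms, which lies in
    \<open>W (Suc n)\<close> as well.\<close>
  have "\<exists>\<epsilon>>0. \<forall>x. norm x < \<epsilon> \<longrightarrow> iso (eval n x) \<in> W (Suc n)" for n
  proof -
    have "openin (vtop (step n)) {\<xi> \<in> topspace (vtop (step n)). rel `` {(n, \<xi>)} \<in> W (Suc n)}"
      by (rule openin_continuous_map_preimage[OF cont W(2)])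
    then have "open {x. cls (Suc n) x \<in> {\<xi> \<in> topspace (vtop (step n)). rel `` {(n, \<xi>)} \<in> W (Suc n)}}"
      unfolding openin_vtop_Z by blast
    then have op: "open {x. iso (eval n x) \<in> W (Suc n)}"
      by (simp add: topspace_vtop_Z rel_class)
    have "0 \<in> {x. iso (eval n x) \<in> W (Suc n)}"
      using W(3)[of "Suc n"] by (simp add: eval_zero iso_zero)
    then obtain \<epsilon> where "\<epsilon> > 0" "ball 0 \<epsilon> \<subseteq> {x. iso (eval n x) \<in> W (Suc n)}"
      using op open_contains_ball by blast
    then show ?thesis by (auto simp: subset_iff)
  qed
  then obtain \<epsilon> where \<epsilon>: "\<And>n. \<epsilon> n > 0" "\<And>n x. norm x < \<epsilon> n \<Longrightarrow> iso (eval n x) \<in> W (Suc n)"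
    by metis
  define M where "M = {\<psi> \<in> P. \<forall>n. vnorm X' (component n \<psi>) \<le> 2 / \<epsilon> n}"
  show thesis
  proof (rule that[of M])
    show "tvs_bounded proj.tvs M" unfolding M_def by (rule bounded_polar_set)
    fix f assume f: "f \<in> vcarrier dual_P" and le: "\<And>\<psi>. \<psi> \<in> M \<Longrightarrow> norm (f \<psi>) \<le> 1"
    obtain m y where my: "f = eval m y" by (rule eval_surj[OF f])
    obtain N x where x: "(\<Sum>i<N. 2 / \<epsilon> i * norm (x i)) < 2"
      "\<And>\<psi>. \<psi> \<in> P \<Longrightarrow> eval m y \<psi> = (\<Sum>i<N. eval i (x i) \<psi>)"
    proof (rule eval_bounded_decomposition[of "\<lambda>n. 2 / \<epsilon> n" m y])
      show "0 \<le> 2 / \<epsilon> n" for n using \<epsilon>(1)[of n] by simp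
      show "norm (eval m y \<psi>) \<le> 1" if "\<psi> \<in> P" "\<And>n. vnorm X' (component n \<psi>) \<le> 2 / \<epsilon> n" for \<psi>
        using le[of \<psi>] that unfolding my M_def by blast
    qed blast
    \<comment> \<open>The weights 2 / \<epsilon> i were chosen for this: a total cost below 2 bounds
      every single term.\<close>
    have small: "norm (x i) < \<epsilon> i" if "i < N" for i
    proof -
      have "0 \<le> 2 / \<epsilon> i * norm (x i)" for i
        using \<epsilon>(1)[of i] by simp
      then have "2 / \<epsilon> i * norm (x i) \<le> (\<Sum>i<N. 2 / \<epsilon> i * norm (x i))"
        by (intro member_le_sum[of i "{..<N}" "\<lambda>i. 2 / \<epsilon> i * norm (x i)"]) (use that in simp_all)
      then have "2 / \<epsilon> i * norm (x i) < 2" using x(1) by (rule le_less_trans)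
      then show ?thesis using \<epsilon>(1)[of i] by (simp add: field_simps)
    qed
    \<comment> \<open>Induction on the number of terms for all starting indices at once: removing
      the first term leaves a sum that starts at \<open>Suc k\<close>.\<close>
    have "k + j \<le> N \<Longrightarrow> (\<lambda>\<psi>\<in>P. \<Sum>i\<in>{k..<k + j}. eval i (x i) \<psi>) \<in> vcarrier dual_P \<and>
        iso (\<lambda>\<psi>\<in>P. \<Sum>i\<in>{k..<k + j}. eval i (x i) \<psi>) \<in> W k" for k j
    proof (induction j arbitrary: k)
      case 0
      have "(\<lambda>\<psi>\<in>P. \<Sum>i\<in>{k..<k + 0}. eval i (x i) \<psi>) = vzero dual_P"
        by (simp add: dual_vspace_simps tvs_P_carrier)
      then show ?case
        using carrier_space.zero_closed[OF carrier_space_dual_P] W(3)[of k] by (simp add: iso_zero)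
    next
      case (Suc j)
      define g where "g = (\<lambda>\<psi>\<in>P. \<Sum>i\<in>{Suc k..<Suc k + j}. eval i (x i) \<psi>)"
      have "Suc k + j \<le> N" using Suc.prems by simp
      from Suc.IH[OF this] have g: "g \<in> vcarrier dual_P" "iso g \<in> W (Suc k)"
        unfolding g_def by (rule conjunct1, rule conjunct2)
      have "{k..<k + Suc j} = insert k {Suc k..<Suc k + j}" by auto
      then have sum: "(\<Sum>i\<in>{k..<k + Suc j}. h i) = h k + (\<Sum>i\<in>{Suc k..<Suc k + j}. h i)" for h :: "nat \<Rightarrow> 'k"
        by simp
      have eq: "(\<lambda>\<psi>\<in>P. \<Sum>i\<in>{k..<k + Suc j}. eval i (x i) \<psi>) = vadd dual_P (eval k (x k)) g"
        unfolding dual_vspace_simps tvs_P_carrier g_def sum by (rule restrict_ext) (simp only: restrict_apply if_True)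
      have "iso (eval k (x k)) \<in> W (Suc k)"
        by (rule \<epsilon>(2)[OF small]) (use Suc.prems in simp)
      then have "iso (vadd dual_P (eval k (x k)) g) \<in> W k"
        using W(4) g(2) by (simp flip: iso_add[OF eval_in_dual g(1)])
      then show ?case
        unfolding eq using carrier_space.add_closed[OF carrier_space_dual_P eval_in_dual g(1)] by blast
    qed
    from this[of 0 N] have "iso (\<lambda>\<psi>\<in>P. \<Sum>i<N. eval i (x i) \<psi>) \<in> U"
      by (simp add: W(1) atLeast0LessThan)
    moreover have "(\<lambda>\<psi>\<in>P. \<Sum>i<N. eval i (x i) \<psi>) = f"
    proof
      fix \<psi>
      show "(\<lambda>\<psi>\<in>P. \<Sum>i<N. eval i (x i) \<psi>) \<psi> = f \<psi>"
      proof (cases "\<psi> \<in> P")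
        case True
        then show ?thesis unfolding my by (simp only: x(2)[OF True] restrict_apply if_True)
      next
        case False
        then show ?thesis unfolding my by (simp only: eval_def restrict_apply if_False)
      qed
    qed
    ultimately show "iso f \<in> U" by (simp only:)
  qed
qed

text \<open>Translation by \<open>iso f\<close> moves the problem to zero, where the neighborhood
  contains a polar. Moved back, this polar is a strong neighborhood of \<open>f\<close> with bound
  1.\<close>

lemma limit_topology_finest:
  assumes T: "linear_topology ind T"
    and cont: "\<And>n. continuous_map (vtop (step n)) T (\<lambda>\<xi>. rel `` {(n, \<xi>)})"
    and U: "openin T U"
  shows "openin limit_topology U"
  unfolding limit_topology(3) openin_dual_topology strong_dual_open_def
proof (intro conjI ballI)
  interpret dual: carrier_space dual_P by (rule carrier_space_dual_P)
  have top: "topspace T = vcarrier ind" using T by (simp add: linear_topology_def)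
  show "U \<subseteq> vcarrier ind" using openin_subset[OF U] top by simp
  fix f assume "f \<in> {f \<in> vcarrier dual_P. iso f \<in> U}"
  then have f: "f \<in> vcarrier dual_P" "iso f \<in> U" by auto
  let ?U = "{w \<in> topspace T. vadd ind (iso f) w \<in> U}"
  have f_ind: "iso f \<in> vcarrier ind" using f(1) by (simp add: ind_carrier)
  have "continuous_map T (prod_topology T T) (\<lambda>w. (iso f, w))"
    using f_ind top by (simp add: continuous_map_paired)
  moreover have "continuous_map (prod_topology T T) T (\<lambda>(x, y). vadd ind x y)"
    using T by (simp add: linear_topology_def)
  ultimately have "continuous_map T T ((\<lambda>(x, y). vadd ind x y) \<circ> (\<lambda>w. (iso f, w)))"
    by (rule continuous_map_compose)
  then have "continuous_map T T (\<lambda>w. vadd ind (iso f) w)" by (simp add: o_def)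
  then have U_open: "openin T ?U" using U by (rule openin_continuous_map_preimage)
  have U_zero: "vzero ind \<in> ?U"
    using f by (simp add: top iso_zero ind_carrier iso_add dual.zero_closed dual.add_zero)
  obtain M where M: "tvs_bounded proj.tvs M"
    "\<And>g. g \<in> vcarrier dual_P \<Longrightarrow> (\<And>\<psi>. \<psi> \<in> M \<Longrightarrow> norm (g \<psi>) \<le> 1) \<Longrightarrow> iso g \<in> ?U"
    by (rule neighborhood_contains_polar[OF T cont U_open U_zero]) blast
  have "strong_dual_nbhd proj.tvs f M 1 \<subseteq> {f \<in> vcarrier dual_P. iso f \<in> U}"
  proof
    fix g assume "g \<in> strong_dual_nbhd proj.tvs f M 1"
    then have g: "g \<in> vcarrier dual_P" "\<And>\<psi>. \<psi> \<in> M \<Longrightarrow> norm (g \<psi> - f \<psi>) \<le> 1"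
      by (auto simp: strong_dual_nbhd_def)
    have "iso (vsub dual_P g f) \<in> ?U"
    proof (rule M(2)[OF dual.sub_closed[OF g(1) f(1)]])
      fix \<psi> assume \<psi>: "\<psi> \<in> M"
      then have "\<psi> \<in> vcarrier proj.tvs" using M(1) unfolding tvs_bounded_def by blast
      then show "norm (vsub dual_P g f \<psi>) \<le> 1" using g(2)[OF \<psi>] by (simp add: vsub_dual_apply)
    qed
    then have "iso (vadd dual_P f (vsub dual_P g f)) \<in> U"
      using iso_add[OF f(1) dual.sub_closed[OF g(1) f(1)]] by simp
    then show "g \<in> {f \<in> vcarrier dual_P. iso f \<in> U}"
      using g(1) dual.add_sub_self[OF f(1) g(1)] by simp
  qed
  then show "\<exists>B \<epsilon>. tvs_bounded proj.tvs B \<and> \<epsilon> > 0 \<and> strong_dual_nbhd proj.tvs f B \<epsilon> \<subseteq> {f \<in> vcarrier dual_P. iso f \<in> U}"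
    using M(1) zero_less_one by blast
qed blast

lemma ind_extrapolation_eq: "ind_extrapolation smul D A = with_top ind limit_topology"
proof -
  have "finest_topology (\<lambda>T. linear_topology ind T \<and>
      (\<forall>n. continuous_map (vtop (step n)) T (\<lambda>\<xi>. rel `` {(n, \<xi>)}))) = limit_topology"
    by (rule finest_topology_eqI)
      (use limit_topology(1) continuous_map_limit_topology limit_topology_finest in blast)+
  then show ?thesis
    by (simp add: ind_extrapolation_def ind_limit_def)
qed

lemma proj_dual_interpolation_eq: "proj_dual_interpolation X D A = proj.tvs"
  unfolding proj_dual_interpolation_def proj.tvs_def by (rule proj.proj_limit_eq)

lemma strong_dual_isomorphic_ind:
  "tvs_isomorphic (strong_dual (proj_dual_interpolation X D A)) (ind_extrapolation smul D A)"
  "tvs_complete (ind_extrapolation smul D A)"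
proof -
  let ?V = "strong_dual proj.tvs" and ?W = "with_top ind limit_topology"
  have V: "vcarrier ?V = vcarrier dual_P" "vadd ?V = vadd dual_P" "vzero ?V = vzero dual_P"
    "vscale ?V = vscale dual_P" "vtop ?V = dual_topology"
    by (simp_all add: proj.strong_dual_eq with_top_def)
  have W: "vcarrier ?W = vcarrier ind" "vadd ?W = vadd ind" "vzero ?W = vzero ind"
    "vscale ?W = vscale ind" "vtop ?W = limit_topology"
    by (simp_all add: with_top_def)
  have lin: "linear_map ?V ?W iso"
    using linear_map_iso unfolding linear_map_def V W .
  have bij: "bij_betw iso (vcarrier ?V) (vcarrier ?W)"
    unfolding V W by (rule bij_iso)
  have homeo: "homeomorphic_map (vtop ?V) (vtop ?W) iso"
    unfolding V W by (rule limit_topology(2))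
  show "tvs_isomorphic (strong_dual (proj_dual_interpolation X D A)) (ind_extrapolation smul D A)"
    unfolding tvs_isomorphic_def proj_dual_interpolation_eq ind_extrapolation_eq
    using lin bij homeo by blast
  \<comment> \<open>Metrizability of the projective limit enters as the increasing sequence
    \<open>sum_norm\<close> that defines its topology.\<close>
  have "tvs_complete ?V"
    by (rule proj.tvs_complete_strong_dual[OF refl proj.sum_norm_mono])
  moreover have "carrier_space ?V"
    unfolding proj.strong_dual_eq by (rule carrier_space_with_top[OF carrier_space_dual_P])
  moreover have "topspace (vtop ?V) = vcarrier ?V"
    using linear_topology_dual_P by (simp add: V linear_topology_def)
  moreover have "iso (vzero ?V) = vzero ?W"
    unfolding V W iso_zero ..
  ultimately show "tvs_complete (ind_extrapolation smul D A)"
    unfolding ind_extrapolation_eq using tvs_complete_transport[OF lin bij homeo] by blast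
qed

end

theorem theorem5:
  fixes smul :: "'k::real_or_complex \<Rightarrow> 'a::banach \<Rightarrow> 'a"
    and D :: "'a set" and A :: "'a \<Rightarrow> 'a"
  assumes "banach_space smul"
    and "reflexive (whole_space smul)"
    and "linear_operator smul D A"
    and "closure D = UNIV"
    and "closed_operator D A"
    and "bij_betw A D UNIV"
    and "bounded_linear (inv_into D A)"
  shows "tvs_isomorphic (strong_dual (proj_dual_interpolation (whole_space smul) D A))
           (ind_extrapolation smul D A) \<and>
         tvs_complete (ind_extrapolation smul D A)"
proof -
  interpret banach_space smul by fact
  interpret invertible_operator smul D A
    by (intro invertible_operator.intro invertible_operator_axioms.intro assms)
  show ?thesis using strong_dual_isomorphic_ind by blast
qed

end
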